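(* Let $(\mathcal A,\mathcal T,\mathcal G)$ be a regularity structure with a model $(\Pi,\Gamma)$. Let $1\le p<\infty$, $1\le q\le\infty$ and $\gamma>0$ with $\gamma\notin\mathcal A$. (i) Given $f\in\mathcal F^\gamma_{p,q}$, define for all $n\ge0$ and $y\in\Lambda_n$ $$\bar f^{(n)}(y)=\frac1{|Q(y,2^{-n})|}\int_{Q(y,2^{-n})}\Gamma_{y,z}f(z)\,dz.$$ Then $\bar f\in\bar{\mathcal F}^\gamma_{p,q}$ and $\|\bar f\|_{\bar{\mathcal F}^\gamma_{p,q}}\lesssim\|f\|_{\mathcal F^\gamma_{p,q}}$ (with a constant independent of $f$). (ii) Let again $f\in\mathcal F^\gamma_{p,q}$ and define, for $x\in\mathbf R^d$ and $n\in\mathbf N_0$, $$f_n(x)=\Gamma_{x,x_n}\bar f^{(n)}(x_n),$$ with $\bar f^{(n)}$ as in (i). Then $\mathcal Q_\zeta f_n\to\mathcal Q_\zeta f$ in $L^p(\mathbf R^d)$ for all $\zeta\in\mathcal A_\gamma$.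
   Context: Basic notation. Fix $d\ge1$ and a scaling $\mathfrak s=(\mathfrak s_1,\dots,\mathfrak s_d)$ of positive integers; $|\mathfrak s|=\sum_i\mathfrak s_i$, $\|x\|_{\mathfrak s}=\max_i|x_i|^{1/\mathfrak s_i}$, $Q(x,R)=\{y\in\mathbf R^d:\|y-x\|_{\mathfrak s}\le R\}$, $|k|_{\mathfrak s}=\sum_ik_i\mathfrak s_i$. $L^p=L^p(\mathbf R^d,dx)$, $L^q_\lambda=L^q((0,1],\lambda^{-1}d\lambda)$; $\ell^q$-type sums are suprema if $q=\infty$. $\eta^\lambda_x(z)=\lambda^{-|\mathfrak s|}\eta(\lambda^{-\mathfrak s_1}(z_1-x_1),\dots,\lambda^{-\mathfrak s_d}(z_d-x_d))$. $\mathfrak B^r$ is the set of $\eta\in\mathcal C^\infty(\mathbf R^d)$ supported in $Q(0,1)$ with $\mathcal C^r$-norm (involving derivatives $D^k$, $|k|_{\mathfrak s}\le r$) at most $1$. Lattices. $\Lambda_n=\{y\in\mathbf R^d:y_i=2^{-n\mathfrak s_i}k_i,\ k_i\in\mathbf Z\}$, $Q^n_y=\prod_{i=1}^d[y_i,y_i+2^{-n\mathfrak s_i})$ for $y\in\Lambda_n$, $\chi^n_y$ its characteristic function, $\mathcal E_n=Q(0,2^{-n})\cap\Lambda_n\setminus\{0\}$. For $x\in\mathbf R^d$, $x_n$ is the unique point of $\Lambda_n$ with $x\in Q^n_{x_n}$. Regularity structure. A triple $(\mathcal A,\mathcal T,\mathcal G)$: $\mathcal A\subset\mathbf R$ bounded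 below and locally finite; $\mathcal T=\bigoplus_{\zeta\in\mathcal A}\mathcal T_\zeta$ with Banach spaces $\mathcal T_\zeta$; $\mathcal G$ a group of linear maps on $\mathcal T$ with $\Gamma\tau-\tau\in\bigoplus_{\beta\in\mathcal A,\beta<\zeta}\mathcal T_\beta$ for $\tau\in\mathcal T_\zeta$. $\mathcal Q_\zeta$ is the projection onto $\mathcal T_\zeta$, $|\tau|_\zeta=\|\mathcal Q_\zeta\tau\|_{\mathcal T_\zeta}$, $\mathcal A_\gamma=\mathcal A\cap(-\infty,\gamma)$, $\mathcal T^-_\gamma=\bigoplus_{\beta\in\mathcal A_\gamma}\mathcal T_\beta$. Model. A pair $(\Pi,\Gamma)$: continuous linear maps $\Pi_x:\mathcal T\to\mathcal D'(\mathbf R^d)$ and $\Gamma:\mathbf R^d\times\mathbf R^d\to\mathcal G$ with $\Gamma_{x,x}=1$, $\Gamma_{x,z}\Gamma_{z,y}=\Gamma_{x,y}$, $\Pi_y=\Pi_x\Gamma_{x,y}$, such that for every $\gamma>0$ (with $r$ the smallest positive integer larger than $|\min\mathcal A|\vee|\max\mathcal A_\gamma|$): $|\langle\Pi_x\tau,\eta^\lambda_x\rangle|\lesssim|\tau|_\zeta\lambda^\zeta$ and $|\Gamma_{x,y}\tau|_\beta\lesssim|\tau|_\zeta\|x-y\|_{\mathfrak s}^{\zeta-\beta}$, uniformly over $x\in\mathbf R^d$, $y\in Q(x,1)$, $\eta\in\mathfrak B^r$, $\lambda\in(0,1]$, $\zeta\in\mathcal A_\gamma$, $\tau\in\mathcal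 T_\zeta$, $\beta\in\mathcal A$ with $\beta\le\zeta$. Space $\mathcal F^\gamma_{p,q}$: the Banach space of $f:\mathbf R^d\to\mathcal T^-_\gamma$ with finite norm $$\|f\|_{\mathcal F^\gamma_{p,q}}=\sup_{\zeta\in\mathcal A_\gamma}\big\||f(x)|_\zeta\big\|_{L^p}+\sup_{\zeta\in\mathcal A_\gamma}\bigg\|\Big\|\frac1{|Q(0,4\lambda)|}\int_{Q(0,4\lambda)}\frac{|f(x+h)-\Gamma_{x+h,x}f(x)|_\zeta}{\lambda^{\gamma-\zeta}}\,dh\Big\|_{L^q_\lambda}\bigg\|_{L^p}.$$ Space $\bar{\mathcal F}^\gamma_{p,q}$: the Banach space of sequences $\bar f=(\bar f^{(n)})_{n\ge0}$ of maps $\bar f^{(n)}:\Lambda_n\to\mathcal T^-_\gamma$ such that, uniformly over $\zeta\in\mathcal A_\gamma$, the following are finite (the norm being given by these quantities): i) $\big(\sum_{y\in\Lambda_0}|\bar f^{(0)}(y)|_\zeta^p\big)^{1/p}$; ii) $\Big\|\Big(\sum_{n\ge0}\big|\sum_{y\in\Lambda_n}\sum_{h\in\mathcal E_n}2^{n(\gamma-\zeta)}|\bar f^{(n)}(y+h)-\Gamma_{y+h,y}\bar f^{(n)}(y)|_\zeta\,\chi^n_y(x)\big|^q\Big)^{1/q}\Big\|_{L^p}$; iii) $\Big\|\Big(\sum_{n\ge0}\big|\sum_{y\in\Lambda_n}2^{n(\gamma-\zeta)}|\bar f^{(n)}(y)-\bar f^{(n+1)}(y)|_\zeta\,\chi^n_y(x)\big|^q\Big)^{1/q}\Big\|_{L^p}$.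 *)

theory Defs
  imports "HOL-Analysis.Analysis" "HOL-Probability.Essential_Supremum" "HOL-Algebra.Bij"
begin

section \<open>Scalings and lattices\<close>

text \<open>The space \<open>R^d\<close> is \<open>real ^ 'd\<close>, and a scaling is a map \<open>s :: 'd \<Rightarrow> nat\<close>.\<close>

definition scaling :: "('d::finite \<Rightarrow> nat) \<Rightarrow> bool" where
  "scaling s \<longleftrightarrow> (\<forall>i. s i \<ge> 1)"

definition snorm :: "('d::finite \<Rightarrow> nat) \<Rightarrow> real ^ 'd \<Rightarrow> real" where
  "snorm s x = Max (range (\<lambda>i. \<bar>x $ i\<bar> powr (1 / real (s i))))"

definition Qbox :: "('d::finite \<Rightarrow> nat) \<Rightarrow> real ^ 'd \<Rightarrow> real \<Rightarrow> (real ^ 'd) set" where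
  "Qbox s x R = {y. snorm s (y - x) \<le> R}"

definition lattice_pts :: "('d::finite \<Rightarrow> nat) \<Rightarrow> nat \<Rightarrow> (real ^ 'd) set" where
  "lattice_pts s n = {y. \<exists>k :: 'd \<Rightarrow> int. \<forall>i. y $ i = real_of_int (k i) / 2 ^ (n * s i)}"

definition cell :: "('d::finite \<Rightarrow> nat) \<Rightarrow> nat \<Rightarrow> real ^ 'd \<Rightarrow> (real ^ 'd) set" where
  "cell s n y = {x. \<forall>i. y $ i \<le> x $ i \<and> x $ i < y $ i + 1 / 2 ^ (n * s i)}"

definition nbrs :: "('d::finite \<Rightarrow> nat) \<Rightarrow> nat \<Rightarrow> (real ^ 'd) set" where
  "nbrs s n = (Qbox s 0 (1 / 2 ^ n) \<inter> lattice_pts s n) - {0}"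

definition lattice_pt :: "('d::finite \<Rightarrow> nat) \<Rightarrow> nat \<Rightarrow> real ^ 'd \<Rightarrow> real ^ 'd" where
  "lattice_pt s n x = (THE y. y \<in> lattice_pts s n \<and> x \<in> cell s n y)"


section \<open>Test functions and distributions\<close>

definition partial :: "'d::finite \<Rightarrow> (real ^ 'd \<Rightarrow> real) \<Rightarrow> real ^ 'd \<Rightarrow> real" where
  "partial i f x = frechet_derivative f (at x) (axis i 1)"

text \<open>A list of directions stands for the multi-index that counts the occurrences of each
  direction. For smooth functions the order is irrelevant.\<close>

primrec partials :: "'d::finite list \<Rightarrow> (real ^ 'd \<Rightarrow> real) \<Rightarrow> real ^ 'd \<Rightarrow> real" where
  "partials [] f = f"
| "partials (i # is) f = partial i (partials is f)"

definition smooth :: "(real ^ 'd::finite \<Rightarrow> real) \<Rightarrow> bool" where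
  "smooth f \<longleftrightarrow> (\<forall>is x. partials is f differentiable (at x))"

definition test_fun_on :: "(real ^ 'd::finite) set \<Rightarrow> (real ^ 'd \<Rightarrow> real) set" where
  "test_fun_on K = {\<phi>. smooth \<phi> \<and> (\<forall>x. \<phi> x \<noteq> 0 \<longrightarrow> x \<in> K)}"

definition test_fun :: "(real ^ 'd::finite \<Rightarrow> real) set" where
  "test_fun = (\<Union>K \<in> {K. compact K}. test_fun_on K)"

text \<open>Distributions are the linear functionals on test functions that are of finite order on every
  compact set; \<open>B\<close> below ranges over the upper bounds of the \<open>C^N\<close>-norm of \<open>\<phi>\<close>.
  Values outside \<^const>\<open>test_fun\<close> are irrelevant.\<close>

definition distribution :: "((real ^ 'd::finite \<Rightarrow> real) \<Rightarrow> real) \<Rightarrow> bool" where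
  "distribution u \<longleftrightarrow>
     (\<forall>\<phi>\<in>test_fun. \<forall>\<psi>\<in>test_fun. \<forall>a b. u (\<lambda>x. a * \<phi> x + b * \<psi> x) = a * u \<phi> + b * u \<psi>) \<and>
     (\<forall>K. compact K \<longrightarrow> (\<exists>C N. \<forall>\<phi>\<in>test_fun_on K. \<forall>B.
        (\<forall>is x. length is \<le> N \<longrightarrow> \<bar>partials is \<phi> x\<bar> \<le> B) \<longrightarrow> \<bar>u \<phi>\<bar> \<le> C * B))"

definition unit_test_fun :: "('d::finite \<Rightarrow> nat) \<Rightarrow> nat \<Rightarrow> (real ^ 'd \<Rightarrow> real) set" where
  "unit_test_fun s r = {\<eta> \<in> test_fun_on (Qbox s 0 1).
     \<forall>is x. sum_list (map s is) \<le> r \<longrightarrow> \<bar>partials is \<eta> x\<bar> \<le> 1}"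

definition rescale :: "('d::finite \<Rightarrow> nat) \<Rightarrow> real \<Rightarrow> real ^ 'd \<Rightarrow> (real ^ 'd \<Rightarrow> real) \<Rightarrow> real ^ 'd \<Rightarrow> real" where
  "rescale s l x \<eta> z = \<eta> (\<chi> i. (z $ i - x $ i) / l ^ s i) / l ^ (\<Sum>i\<in>UNIV. s i)"


section \<open>Regularity structures and models\<close>

text \<open>The Banach spaces \<open>T_\<zeta>\<close> are closed subspaces \<open>V \<zeta>\<close> of one Banach space \<open>'b\<close>. This is no
  restriction: any family of Banach spaces embeds isometrically as closed subspaces into its
  \<open>l^1\<close>-sum. An element of a direct sum is the finitely supported family of its components,
  so \<open>\<tau> \<zeta>\<close> is the projection of \<open>\<tau>\<close> to \<open>T_\<zeta>\<close>.\<close>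

definition direct_sum :: "(real \<Rightarrow> 'b::real_vector set) \<Rightarrow> real set \<Rightarrow> (real \<Rightarrow> 'b) set" where
  "direct_sum V A = {\<tau>. finite {\<zeta>. \<tau> \<zeta> \<noteq> 0} \<and> (\<forall>\<zeta>. \<tau> \<zeta> \<noteq> 0 \<longrightarrow> \<zeta> \<in> A \<and> \<tau> \<zeta> \<in> V \<zeta>)}"

definition homog :: "real \<Rightarrow> 'b::zero \<Rightarrow> real \<Rightarrow> 'b" where
  "homog \<zeta> t = (\<lambda>\<beta>. if \<beta> = \<zeta> then t else 0)"

definition below :: "real set \<Rightarrow> real \<Rightarrow> real set" where
  "below A \<gamma> = A \<inter> {..<\<gamma>}"

definition linear_map_on :: "(real \<Rightarrow> 'b::real_vector) set \<Rightarrow> ((real \<Rightarrow> 'b) \<Rightarrow> (real \<Rightarrow> 'b)) \<Rightarrow> bool" where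
  "linear_map_on T g \<longleftrightarrow> (\<forall>\<sigma>\<in>T. \<forall>\<tau>\<in>T. \<forall>a b.
     g (\<lambda>\<zeta>. a *\<^sub>R \<sigma> \<zeta> + b *\<^sub>R \<tau> \<zeta>) = (\<lambda>\<zeta>. a *\<^sub>R g \<sigma> \<zeta> + b *\<^sub>R g \<tau> \<zeta>))"

definition regularity_structure ::
  "real set \<Rightarrow> (real \<Rightarrow> 'b::banach set) \<Rightarrow> ((real \<Rightarrow> 'b) \<Rightarrow> (real \<Rightarrow> 'b)) set \<Rightarrow> bool" where
  "regularity_structure A V G \<longleftrightarrow>
     bdd_below A \<and> (\<forall>a b. finite (A \<inter> {a..b})) \<and>
     (\<forall>\<zeta>\<in>A. subspace (V \<zeta>) \<and> closed (V \<zeta>)) \<and>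
     subgroup G (BijGroup (direct_sum V A)) \<and>
     (\<forall>g\<in>G. linear_map_on (direct_sum V A) g \<and>
        (\<forall>\<zeta>\<in>A. \<forall>t\<in>V \<zeta>. (\<lambda>\<beta>. g (homog \<zeta> t) \<beta> - homog \<zeta> t \<beta>) \<in> direct_sum V (below A \<zeta>)))"

text \<open>A power of a nonnegative base with \<open>0^0 = 1\<close>, whereas \<open>0 powr 0 = 0\<close>; the case \<open>0^0\<close> occurs
  in the bound on \<open>\<Gamma>\<close> for \<open>x = y\<close> and \<open>\<beta> = \<zeta>\<close>.\<close>

definition rpow :: "real \<Rightarrow> real \<Rightarrow> real" where
  "rpow t a = (if a = 0 then 1 else t powr a)"

text \<open>A set \<open>A\<close> that is bounded below and locally finite attains its infimum, and \<open>below A \<gamma>\<close> is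
  finite. If it is empty, the value below is irrelevant, as the bounds that use it are vacuous.\<close>

definition test_order :: "real set \<Rightarrow> real \<Rightarrow> nat" where
  "test_order A \<gamma> = (LEAST r. 0 < r \<and> max \<bar>Inf A\<bar> \<bar>Max (below A \<gamma>)\<bar> < real r)"

text \<open>Continuity of \<open>P x\<close> is stated on each summand, for the weak-* topology on distributions; since
  the summands are Banach spaces, this is equivalent to continuity for the strong topology.\<close>

definition model ::
  "('d::finite \<Rightarrow> nat) \<Rightarrow> real set \<Rightarrow> (real \<Rightarrow> 'b::banach set) \<Rightarrow> ((real \<Rightarrow> 'b) \<Rightarrow> (real \<Rightarrow> 'b)) set
   \<Rightarrow> (real ^ 'd \<Rightarrow> (real \<Rightarrow> 'b) \<Rightarrow> (real ^ 'd \<Rightarrow> real) \<Rightarrow> real)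
   \<Rightarrow> (real ^ 'd \<Rightarrow> real ^ 'd \<Rightarrow> (real \<Rightarrow> 'b) \<Rightarrow> (real \<Rightarrow> 'b)) \<Rightarrow> bool" where
  "model s A V G P \<Gamma> \<longleftrightarrow>
     (\<forall>x. \<forall>\<tau>\<in>direct_sum V A. distribution (P x \<tau>)) \<and>
     (\<forall>x. \<forall>\<sigma>\<in>direct_sum V A. \<forall>\<tau>\<in>direct_sum V A. \<forall>a b. \<forall>\<phi>\<in>test_fun.
        P x (\<lambda>\<zeta>. a *\<^sub>R \<sigma> \<zeta> + b *\<^sub>R \<tau> \<zeta>) \<phi> = a * P x \<sigma> \<phi> + b * P x \<tau> \<phi>) \<and>
     (\<forall>x. \<forall>\<zeta>\<in>A. \<forall>\<phi>\<in>test_fun. continuous_on (V \<zeta>) (\<lambda>t. P x (homog \<zeta> t) \<phi>)) \<and>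
     (\<forall>x y. \<Gamma> x y \<in> G) \<and>
     (\<forall>x. \<forall>\<tau>\<in>direct_sum V A. \<Gamma> x x \<tau> = \<tau>) \<and>
     (\<forall>x y z. \<forall>\<tau>\<in>direct_sum V A. \<Gamma> x z (\<Gamma> z y \<tau>) = \<Gamma> x y \<tau>) \<and>
     (\<forall>x y. \<forall>\<tau>\<in>direct_sum V A. \<forall>\<phi>\<in>test_fun. P y \<tau> \<phi> = P x (\<Gamma> x y \<tau>) \<phi>) \<and>
     (\<forall>\<gamma>>0.
        (\<exists>C. \<forall>x. \<forall>\<eta>\<in>unit_test_fun s (test_order A \<gamma>). \<forall>l\<in>{0<..1}. \<forall>\<zeta>\<in>below A \<gamma>. \<forall>t\<in>V \<zeta>.
           \<bar>P x (homog \<zeta> t) (rescale s l x \<eta>)\<bar> \<le> C * norm t * l powr \<zeta>) \<and>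
        (\<exists>C. \<forall>x. \<forall>y\<in>Qbox s x 1. \<forall>\<zeta>\<in>below A \<gamma>. \<forall>t\<in>V \<zeta>. \<forall>\<beta>\<in>A. \<beta> \<le> \<zeta> \<longrightarrow>
           norm (\<Gamma> x y (homog \<zeta> t) \<beta>) \<le> C * norm t * rpow (snorm s (x - y)) (\<zeta> - \<beta>)))"


section \<open>Lebesgue norms\<close>

text \<open>Meant for exponents \<open>r > 0\<close>.\<close>

definition epow :: "ennreal \<Rightarrow> real \<Rightarrow> ennreal" where
  "epow a r = (if a = \<infinity> then \<infinity> else ennreal (enn2real a powr r))"

text \<open>For a counting measure this is the \<open>l^p\<close>-norm, with the supremum if \<open>p = \<infinity>\<close>.\<close>

definition Lp_norm :: "ennreal \<Rightarrow> 'a measure \<Rightarrow> ('a \<Rightarrow> ennreal) \<Rightarrow> ennreal" where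
  "Lp_norm p M F = (if p = \<infinity> then esssup M F
     else epow (\<integral>\<^sup>+x. epow (F x) (enn2real p) \<partial>M) (1 / enn2real p))"

definition log_measure :: "real measure" where
  "log_measure = density (lebesgue_on {0<..1}) (\<lambda>l. ennreal (1 / l))"

text \<open>Bochner measurability, for Banach spaces that need not be separable.\<close>

definition strongly_measurable :: "'a measure \<Rightarrow> ('a \<Rightarrow> 'b::real_normed_vector) \<Rightarrow> bool" where
  "strongly_measurable M f \<longleftrightarrow>
     (\<exists>u. (\<forall>i::nat. simple_function M (u i)) \<and> (AE x in M. (\<lambda>i. u i x) \<longlonglongrightarrow> f x))"

definition in_Lp :: "ennreal \<Rightarrow> 'a measure \<Rightarrow> ('a \<Rightarrow> 'b::real_normed_vector) \<Rightarrow> bool" where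
  "in_Lp p M f \<longleftrightarrow> strongly_measurable M f \<and> Lp_norm p M (\<lambda>x. ennreal (norm (f x))) < \<infinity>"

definition tendsto_Lp ::
  "ennreal \<Rightarrow> 'a measure \<Rightarrow> (nat \<Rightarrow> 'a \<Rightarrow> 'b::real_normed_vector) \<Rightarrow> ('a \<Rightarrow> 'b) \<Rightarrow> bool" where
  "tendsto_Lp p M g f \<longleftrightarrow> (\<forall>n. in_Lp p M (g n)) \<and> in_Lp p M f \<and>
     (\<lambda>n. Lp_norm p M (\<lambda>x. ennreal (norm (g n x - f x)))) \<longlonglongrightarrow> 0"


section \<open>The spaces of modelled distributions\<close>

definition F_norm ::
  "('d::finite \<Rightarrow> nat) \<Rightarrow> real set \<Rightarrow> (real ^ 'd \<Rightarrow> real ^ 'd \<Rightarrow> (real \<Rightarrow> 'b::banach) \<Rightarrow> (real \<Rightarrow> 'b))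
   \<Rightarrow> real \<Rightarrow> ennreal \<Rightarrow> ennreal \<Rightarrow> (real ^ 'd \<Rightarrow> real \<Rightarrow> 'b) \<Rightarrow> ennreal" where
  "F_norm s A \<Gamma> \<gamma> p q f =
     (SUP \<zeta>\<in>below A \<gamma>. Lp_norm p lebesgue (\<lambda>x. ennreal (norm (f x \<zeta>)))) +
     (SUP \<zeta>\<in>below A \<gamma>. Lp_norm p lebesgue (\<lambda>x. Lp_norm q log_measure (\<lambda>l.
        (\<integral>\<^sup>+h\<in>Qbox s 0 (4 * l).
           ennreal (norm (f (x + h) \<zeta> - \<Gamma> (x + h) x (f x) \<zeta>) / l powr (\<gamma> - \<zeta>)) \<partial>lebesgue)
        / emeasure lebesgue (Qbox s 0 (4 * l)))))"

text \<open>Elements are represented by functions rather than by classes of functions that agree almost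
  everywhere.\<close>

definition F_space ::
  "('d::finite \<Rightarrow> nat) \<Rightarrow> real set \<Rightarrow> (real \<Rightarrow> 'b::banach set)
   \<Rightarrow> (real ^ 'd \<Rightarrow> real ^ 'd \<Rightarrow> (real \<Rightarrow> 'b) \<Rightarrow> (real \<Rightarrow> 'b))
   \<Rightarrow> real \<Rightarrow> ennreal \<Rightarrow> ennreal \<Rightarrow> (real ^ 'd \<Rightarrow> real \<Rightarrow> 'b) set" where
  "F_space s A V \<Gamma> \<gamma> p q = {f.
     (\<forall>x. f x \<in> direct_sum V (below A \<gamma>)) \<and>
     (\<forall>\<zeta>\<in>below A \<gamma>. strongly_measurable lebesgue (\<lambda>x. f x \<zeta>)) \<and>
     F_norm s A \<Gamma> \<gamma> p q f < \<infinity>}"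

text \<open>A sequence of maps on the lattices is a function of \<open>n\<close> and of a point of \<open>R^d\<close>; only its
  values on \<open>lattice_pts s n\<close> matter.\<close>

definition Fbar_norm ::
  "('d::finite \<Rightarrow> nat) \<Rightarrow> real set \<Rightarrow> (real ^ 'd \<Rightarrow> real ^ 'd \<Rightarrow> (real \<Rightarrow> 'b::banach) \<Rightarrow> (real \<Rightarrow> 'b))
   \<Rightarrow> real \<Rightarrow> ennreal \<Rightarrow> ennreal \<Rightarrow> (nat \<Rightarrow> real ^ 'd \<Rightarrow> real \<Rightarrow> 'b) \<Rightarrow> ennreal" where
  "Fbar_norm s A \<Gamma> \<gamma> p q g =
     (SUP \<zeta>\<in>below A \<gamma>. Lp_norm p (count_space (lattice_pts s 0)) (\<lambda>y. ennreal (norm (g 0 y \<zeta>)))) +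
     (SUP \<zeta>\<in>below A \<gamma>. Lp_norm p lebesgue (\<lambda>x. Lp_norm q (count_space UNIV) (\<lambda>n.
        \<Sum>\<^sub>\<infinity>y\<in>lattice_pts s n. \<Sum>h\<in>nbrs s n.
          ennreal (2 powr (real n * (\<gamma> - \<zeta>)) * norm (g n (y + h) \<zeta> - \<Gamma> (y + h) y (g n y) \<zeta>))
          * indicator (cell s n y) x))) +
     (SUP \<zeta>\<in>below A \<gamma>. Lp_norm p lebesgue (\<lambda>x. Lp_norm q (count_space UNIV) (\<lambda>n.
        \<Sum>\<^sub>\<infinity>y\<in>lattice_pts s n.
          ennreal (2 powr (real n * (\<gamma> - \<zeta>)) * norm (g n y \<zeta> - g (Suc n) y \<zeta>))
          * indicator (cell s n y) x)))"

definition Fbar_space ::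
  "('d::finite \<Rightarrow> nat) \<Rightarrow> real set \<Rightarrow> (real \<Rightarrow> 'b::banach set)
   \<Rightarrow> (real ^ 'd \<Rightarrow> real ^ 'd \<Rightarrow> (real \<Rightarrow> 'b) \<Rightarrow> (real \<Rightarrow> 'b))
   \<Rightarrow> real \<Rightarrow> ennreal \<Rightarrow> ennreal \<Rightarrow> (nat \<Rightarrow> real ^ 'd \<Rightarrow> real \<Rightarrow> 'b) set" where
  "Fbar_space s A V \<Gamma> \<gamma> p q = {g.
     (\<forall>n. \<forall>y\<in>lattice_pts s n. g n y \<in> direct_sum V (below A \<gamma>)) \<and>
     Fbar_norm s A \<Gamma> \<gamma> p q g < \<infinity>}"

text \<open>The average is taken componentwise. \<^const>\<open>integral\<close> is the Henstock-Kurzweil integral, which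
  extends the Bochner integral; the library's Bochner integral would need separable spaces.\<close>

definition averages ::
  "('d::finite \<Rightarrow> nat) \<Rightarrow> (real ^ 'd \<Rightarrow> real ^ 'd \<Rightarrow> (real \<Rightarrow> 'b::banach) \<Rightarrow> (real \<Rightarrow> 'b))
   \<Rightarrow> (real ^ 'd \<Rightarrow> real \<Rightarrow> 'b) \<Rightarrow> nat \<Rightarrow> real ^ 'd \<Rightarrow> real \<Rightarrow> 'b" where
  "averages s \<Gamma> f n y = (\<lambda>\<zeta>. (1 / measure lebesgue (Qbox s y (1 / 2 ^ n))) *\<^sub>R
     integral (Qbox s y (1 / 2 ^ n)) (\<lambda>z. \<Gamma> y z (f z) \<zeta>))"

definition reconstructed ::
  "('d::finite \<Rightarrow> nat) \<Rightarrow> (real ^ 'd \<Rightarrow> real ^ 'd \<Rightarrow> (real \<Rightarrow> 'b::banach) \<Rightarrow> (real \<Rightarrow> 'b))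
   \<Rightarrow> (nat \<Rightarrow> real ^ 'd \<Rightarrow> real \<Rightarrow> 'b) \<Rightarrow> nat \<Rightarrow> real ^ 'd \<Rightarrow> real \<Rightarrow> 'b" where
  "reconstructed s \<Gamma> g n x = \<Gamma> x (lattice_pt s n x) (g n (lattice_pt s n x))"

end

theory Submission
  imports Defs
begin


text \<open>The averages are compared with reexpansions of \<open>f\<close> at a single point. For \<open>w\<close> near \<open>y\<close>,
    \<open>\<Gamma> y z (f z) - \<Gamma> y w (f w) = \<Gamma> y z (f z - \<Gamma> z w (f w))\<close>,
  so the average of \<open>\<Gamma> y z (f z)\<close> over the box of radius \<open>2\<^sup>-\<^sup>n\<close> around \<open>y\<close> differs from \<open>\<Gamma> y w (f w)\<close> by an
  average of reexpanded deviations \<open>f z - \<Gamma> z w (f w)\<close>. Weight the component of degree \<open>\<zeta>\<close> by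
  \<open>2\<^sup>n\<^sup>(\<^sup>\<gamma>\<^sup>-\<^sup>\<zeta>\<^sup>)\<close>, as in both norms of the theorem. For these weighted norms, \<open>\<Gamma> y z\<close> is bounded uniformly in \<open>n\<close>
  when \<open>y\<close> and \<open>z\<close> are within distance \<open>2\<^sup>-\<^sup>n\<close>, because the power of the distance in the bound on the model
  is at most the ratio of the weights (\<open>Gamma_wnorm_exists\<close>). Hence the weighted norm of
  \<open>averages s \<Gamma> f n y - \<Gamma> y w (f w)\<close> is at most a constant times the oscillation of \<open>f\<close> around \<open>w\<close> at scale
  \<open>2\<^sup>-\<^sup>n\<close> (\<open>average_deviation_exists\<close>).

  All claims follow from this inequality by choosing \<open>w = x\<close>, where \<open>x\<close> is the point at which the
  norms of the theorem are evaluated. In the differences between neighbouring lattice points and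
  between consecutive levels, both terms are close to reexpansions of the same \<open>f x\<close>, which cancel. At level \<open>0\<close> the cells have volume \<open>1\<close>,
  and an average is bounded by \<open>f x\<close> and the oscillation at \<open>x\<close>, for every \<open>x\<close> in the cell, so
  the sum over the lattice is bounded by an integral over \<open>x\<close>. Finally, the reconstructed function at
  \<open>x\<close> minus \<open>f x\<close> is the reexpansion of such a difference, and the weight gives a factor
  \<open>2\<^sup>-\<^sup>n\<^sup>(\<^sup>\<gamma>\<^sup>-\<^sup>\<zeta>\<^sup>)\<close> that tends to \<open>0\<close>.

  The oscillation at scale \<open>2\<^sup>-\<^sup>n\<close> is at most a constant times the integrand of the norm of \<open>f\<close> at every
  scale \<open>l\<close> between \<open>3/4 * 2\<^sup>-\<^sup>n\<close> and \<open>2\<^sup>-\<^sup>n\<close>. These intervals are disjoint and have mass bounded below for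
  \<open>dl / l\<close>, so the \<open>l\<^sup>q\<close>-norm over \<open>n\<close> is bounded by the \<open>L\<^sup>q\<close>-norm over scales (\<open>lq_norm_le_log_norm\<close>), pointwise in \<open>x\<close>.

  Two points need care. The spaces need not be separable, so integrals of vector-valued functions are
  Henstock-Kurzweil integrals, which exist for strongly measurable functions with integrable norm
  (\<open>strongly_measurable_integrable_on\<close>). And splitting the \<open>L\<^sup>p\<close>-norm of a sum over the degrees requires
  the oscillation to be measurable in the base point (\<open>borel_measurable_osc\<close>), which follows because
  \<open>(w, z) \<mapsto> \<Gamma> z w (f w)\<close> is a limit of simple functions on the product.\<close>

section \<open>Integration of Banach-valued functions\<close>

lemma Riemann_sum_in_subspace:
  assumes "subspace W" and "\<And>x. x \<in> cbox a b \<Longrightarrow> g x \<in> W"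
    and "p tagged_division_of cbox a b"
  shows "(\<Sum>(x,K)\<in>p. measure lborel K *\<^sub>R g x) \<in> W"
proof (rule subspace_sum[OF assms(1)])
  fix xk assume "xk \<in> p"
  then obtain x K where "xk = (x, K)" "x \<in> cbox a b"
    using assms(3) by (metis subset_iff surj_pair tagged_division_ofD(2,3))
  then show "(case xk of (x, K) \<Rightarrow> measure lborel K *\<^sub>R g x) \<in> W"
    using assms(1,2) by (simp add: subspace_scale)
qed

text \<open>Riemann sums of a function with values in a closed subspace stay in the subspace, and so does
  their limit. A function that is not integrable has integral \<open>0\<close>.\<close>

lemma integral_in_closed_subspace:
  fixes g :: "'a::euclidean_space \<Rightarrow> 'b::banach"
  assumes W: "subspace W" "closed W" and g: "\<And>x. x \<in> cbox a b \<Longrightarrow> g x \<in> W"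
  shows "integral (cbox a b) g \<in> W"
proof (cases "g integrable_on cbox a b")
  case True
  then have I: "(g has_integral integral (cbox a b) g) (cbox a b)"
    by (rule integrable_integral)
  have "\<exists>y\<in>W. dist y (integral (cbox a b) g) < e" if e: "e > 0" for e
  proof -
    obtain d where d: "gauge d" "\<forall>p. p tagged_division_of cbox a b \<and> d fine p \<longrightarrow>
        norm ((\<Sum>(x,K)\<in>p. measure lborel K *\<^sub>R g x) - integral (cbox a b) g) < e"
      using has_integral[THEN iffD1, OF I, rule_format, OF e] by (elim exE conjE)
    obtain p where p: "p tagged_division_of cbox a b" "d fine p"
      using fine_division_exists[OF d(1)] by metis
    show ?thesis
    proof
      show "dist (\<Sum>(x,K)\<in>p. measure lborel K *\<^sub>R g x) (integral (cbox a b) g) < e"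
        unfolding dist_norm using d(2) p by simp
    qed (rule Riemann_sum_in_subspace[OF W(1) g p(1)])
  qed
  then have "integral (cbox a b) g \<in> closure W"
    by (simp add: closure_approachable)
  then show ?thesis
    using W(2) by simp
next
  case False
  then show ?thesis
    using W(1) by (simp add: not_integrable_integral subspace_0)
qed

text \<open>The difference of two Riemann sums of \<open>g\<close> is the one of \<open>u i\<close> up to two Riemann sums of
  \<open>norm (g x - u i x)\<close>, so the Cauchy criterion passes from the \<open>u i\<close> to \<open>g\<close>.\<close>

lemma integrable_on_L1_limit:
  fixes g :: "'a::euclidean_space \<Rightarrow> 'b::banach"
  assumes u: "\<And>i::nat. u i integrable_on cbox a b"
    and h: "\<And>i. (\<lambda>x. norm (g x - u i x)) integrable_on cbox a b"
    and lim: "(\<lambda>i. integral (cbox a b) (\<lambda>x. norm (g x - u i x))) \<longlonglongrightarrow> 0"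
  shows "g integrable_on cbox a b"
  unfolding integrable_Cauchy
proof (intro allI impI)
  fix e :: real assume e: "e > 0"
  then obtain i where i: "integral (cbox a b) (\<lambda>x. norm (g x - u i x)) < e / 4"
    using order_tendstoD(2)[OF lim, of "e / 4"] by (auto simp: eventually_sequentially)
  define S :: "('a \<Rightarrow> 'b) \<Rightarrow> ('a \<times> 'a set) set \<Rightarrow> 'b"
    where "S = (\<lambda>v p. \<Sum>(x,K)\<in>p. measure lborel K *\<^sub>R v x)"
  obtain d1 where d1: "gauge d1" "\<forall>p p'. p tagged_division_of cbox a b \<and> d1 fine p \<and>
        p' tagged_division_of cbox a b \<and> d1 fine p' \<longrightarrow> norm (S (u i) p - S (u i) p') < e / 4"
    using integrable_Cauchy[THEN iffD1, OF u[of i], rule_format, OF divide_pos_pos[OF e, of 4]]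
    unfolding S_def by auto
  obtain d2 where d2: "gauge d2" "\<forall>p. p tagged_division_of cbox a b \<and> d2 fine p \<longrightarrow>
        norm ((\<Sum>(x,K)\<in>p. measure lborel K *\<^sub>R norm (g x - u i x)) -
          integral (cbox a b) (\<lambda>x. norm (g x - u i x))) < e / 8"
    using has_integral[THEN iffD1, OF integrable_integral[OF h[of i]], rule_format,
        OF divide_pos_pos[OF e, of 8]] by auto
  have close: "norm (S g p - S (u i) p) < e * (3 / 8)"
    if p: "p tagged_division_of cbox a b" "d2 fine p" for p
  proof -
    have "norm (S g p - S (u i) p) = norm (\<Sum>(x,K)\<in>p. measure lborel K *\<^sub>R (g x - u i x))"
      unfolding S_def
      by (simp add: sum_subtractf[symmetric] split_beta scaleR_diff_right)
    also have "\<dots> \<le> (\<Sum>(x,K)\<in>p. measure lborel K *\<^sub>R norm (g x - u i x))"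
      by (rule order_trans[OF norm_sum]) (auto intro!: sum_mono)
    also have "\<dots> < e * (3 / 8)"
      using d2(2)[rule_format, OF conjI[OF p]] i unfolding real_norm_def by linarith
    finally show ?thesis .
  qed
  show "\<exists>d. gauge d \<and> (\<forall>p p'. p tagged_division_of cbox a b \<and> d fine p \<and>
      p' tagged_division_of cbox a b \<and> d fine p' \<longrightarrow>
      norm ((\<Sum>(x,K)\<in>p. measure lborel K *\<^sub>R g x) - (\<Sum>(x,K)\<in>p'. measure lborel K *\<^sub>R g x)) < e)"
  proof (intro exI[of _ "\<lambda>x. d1 x \<inter> d2 x"] conjI allI impI)
    show "gauge (\<lambda>x. d1 x \<inter> d2 x)"
      using d1(1) d2(1) by (rule gauge_Int)
    fix p p' assume "p tagged_division_of cbox a b \<and> (\<lambda>x. d1 x \<inter> d2 x) fine p \<and>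
      p' tagged_division_of cbox a b \<and> (\<lambda>x. d1 x \<inter> d2 x) fine p'"
    then have p: "p tagged_division_of cbox a b" "d1 fine p" "d2 fine p"
      and p': "p' tagged_division_of cbox a b" "d1 fine p'" "d2 fine p'"
      by (auto simp: fine_Int)
    have "norm (S g p - S g p') \<le> norm (S g p - S (u i) p) + norm (S (u i) p - S (u i) p')
        + norm (S g p' - S (u i) p')"
    proof -
      have "S g p - S g p' = (S g p - S (u i) p) + (S (u i) p - S (u i) p') - (S g p' - S (u i) p')"
        by simp
      also have "norm \<dots> \<le> norm ((S g p - S (u i) p) + (S (u i) p - S (u i) p')) + norm (S g p' - S (u i) p')"
        by (rule norm_triangle_ineq4)
      also have "\<dots> \<le> norm (S g p - S (u i) p) + norm (S (u i) p - S (u i) p') + norm (S g p' - S (u i) p')"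
        by (intro add_right_mono norm_triangle_ineq)
      finally show ?thesis .
    qed
    also have "\<dots> < e"
      using close[OF p(1,3)] close[OF p'(1,3)] d1(2)[rule_format, OF conjI[OF p(1) conjI[OF p(2) conjI[OF p'(1,2)]]]]
      by simp
    finally show "norm ((\<Sum>(x,K)\<in>p. measure lborel K *\<^sub>R g x) - (\<Sum>(x,K)\<in>p'. measure lborel K *\<^sub>R g x)) < e"
      unfolding S_def .
  qed
qed

lemma strongly_measurableE:
  assumes "strongly_measurable M g"
  obtains u where "\<And>i::nat. simple_function M (u i)" "AE x in M. (\<lambda>i. u i x) \<longlonglongrightarrow> g x"
  using assms unfolding strongly_measurable_def by (elim exE conjE) (rule that, auto)

lemma strongly_measurable_norm_diff:
  assumes "strongly_measurable lebesgue g" "strongly_measurable lebesgue g'"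
  shows "(\<lambda>x. norm (g x - g' x)) \<in> borel_measurable lebesgue"
proof -
  obtain u where u: "\<And>i::nat. simple_function lebesgue (u i)" "AE x in lebesgue. (\<lambda>i. u i x) \<longlonglongrightarrow> g x"
    by (rule strongly_measurableE[OF assms(1)]) (rule that)
  obtain u' where u': "\<And>i::nat. simple_function lebesgue (u' i)" "AE x in lebesgue. (\<lambda>i. u' i x) \<longlonglongrightarrow> g' x"
    by (rule strongly_measurableE[OF assms(2)]) (rule that)
  define L where "L = (\<lambda>x. lim (\<lambda>i. norm (u i x - u' i x)))"
  have "(\<lambda>x. norm (u i x - u' i x)) \<in> borel_measurable lebesgue" for i
    by (rule borel_measurable_simple_function)
      (rule simple_function_compose2[OF u(1) u'(1), of "\<lambda>a b. norm (a - b)"])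
  then have "L \<in> borel_measurable lebesgue"
    unfolding L_def by (rule borel_measurable_lim_metric)
  moreover have "AE x in lebesgue. L x = norm (g x - g' x)"
    using u(2) u'(2)
  proof eventually_elim
    case (elim x)
    then show ?case
      unfolding L_def by (intro limI tendsto_norm tendsto_diff)
  qed
  ultimately show ?thesis
    by (rule borel_measurable_AE)
qed

lemma strongly_measurable_const: "strongly_measurable M (\<lambda>_. c)"
  unfolding strongly_measurable_def by (intro exI[of _ "\<lambda>_ _. c"]) auto

lemma strongly_measurable_norm:
  assumes "strongly_measurable lebesgue g"
  shows "(\<lambda>x. norm (g x)) \<in> borel_measurable lebesgue"
  using strongly_measurable_norm_diff[OF assms strongly_measurable_const[of _ 0]] by simp

lemma integrable_on_nn_integral_finite:
  fixes h :: "'a::euclidean_space \<Rightarrow> real"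
  assumes "h \<in> borel_measurable lebesgue" "\<And>x. 0 \<le> h x" "S \<in> sets lebesgue"
    and "(\<integral>\<^sup>+x\<in>S. ennreal (h x) \<partial>lebesgue) < \<infinity>"
  shows "h integrable_on S" "ennreal (integral S h) = (\<integral>\<^sup>+x\<in>S. ennreal (h x) \<partial>lebesgue)"
proof -
  define r where "r = enn2real (\<integral>\<^sup>+x\<in>S. ennreal (h x) \<partial>lebesgue)"
  have r: "ennreal r = (\<integral>\<^sup>+x\<in>S. ennreal (h x) \<partial>lebesgue)"
    unfolding r_def using assms(4) by (simp add: less_top)
  have "((\<lambda>x. if x \<in> S then h x else 0) has_integral r) UNIV"
  proof (subst has_integral_iff_nn_integral_lebesgue, goal_cases)
    case 2
    have "(\<integral>\<^sup>+x. ennreal (if x \<in> S then h x else 0) \<partial>lebesgue) = ennreal r"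
      unfolding r by (intro nn_integral_cong) (auto simp: indicator_def)
    moreover have "(\<lambda>x. if x \<in> S then h x else 0) \<in> borel_measurable lebesgue"
      using assms(1,3) by (intro measurable_If_set) auto
    ultimately show ?case
      by (simp add: r_def)
  qed (use assms(2) in auto)
  then have I: "(h has_integral r) S"
    by (simp only: has_integral_restrict_UNIV)
  then show "h integrable_on S" "ennreal (integral S h) = (\<integral>\<^sup>+x\<in>S. ennreal (h x) \<partial>lebesgue)"
    using r by (auto simp: integral_unique)
qed

lemma simple_function_integrable_on_cbox:
  fixes v :: "'a::euclidean_space \<Rightarrow> 'b::banach"
  assumes "simple_function lebesgue v"
  shows "v integrable_on cbox a b"
proof -
  have fin: "finite (range v)"
    using assms by (simp add: simple_function_def)
  have "(\<lambda>x. \<Sum>c\<in>range v. indicat_real (v -` {c}) x *\<^sub>R c) integrable_on cbox a b"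
  proof (intro integrable_sum fin integrable_on_scaleR_left)
    fix c assume "c \<in> range v"
    then have c: "v -` {c} \<in> sets lebesgue"
      using assms by (auto simp: simple_function_def)
    have "(\<integral>\<^sup>+x\<in>cbox a b. ennreal (indicat_real (v -` {c}) x) \<partial>lebesgue) \<le> (\<integral>\<^sup>+x. indicator (cbox a b) x \<partial>lebesgue)"
      by (intro nn_integral_mono) (auto simp: indicator_def)
    also have "\<dots> < \<infinity>"
      using emeasure_lborel_cbox_finite[of a b] by (simp add: less_top)
    finally show "indicat_real (v -` {c}) integrable_on cbox a b"
      using c by (intro integrable_on_nn_integral_finite(1)) auto
  qed
  moreover have "(\<Sum>c\<in>range v. indicat_real (v -` {c}) x *\<^sub>R c) = v x" for x
  proof -
    have "(\<Sum>c\<in>range v. indicat_real (v -` {c}) x *\<^sub>R c) = (\<Sum>c\<in>range v. if v x = c then c else 0)"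
      by (intro sum.cong) (auto simp: indicator_def)
    then show ?thesis
      using fin by simp
  qed
  ultimately show ?thesis
    by simp
qed

lemma strongly_measurable_diff_const:
  assumes "strongly_measurable M g"
  shows "strongly_measurable M (\<lambda>x. g x - c)"
proof -
  obtain u where u: "\<And>i::nat. simple_function M (u i)" "AE x in M. (\<lambda>i. u i x) \<longlonglongrightarrow> g x"
    by (rule strongly_measurableE[OF assms]) (rule that)
  show ?thesis
    unfolding strongly_measurable_def
  proof (intro exI conjI allI)
    show "simple_function M (\<lambda>x. u i x - c)" for i
      by (rule simple_function_compose1[OF u(1)])
    show "AE x in M. (\<lambda>i. u i x - c) \<longlonglongrightarrow> g x - c"
      using u(2) by eventually_elim (intro tendsto_diff tendsto_const)
  qed
qed

lemma simple_function_finite_family: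
  assumes "finite J" "\<And>j. j \<in> J \<Longrightarrow> simple_function M (u j)"
  shows "simple_function M (\<lambda>x j. if j \<in> J then u j x else c)"
  using assms
proof (induction J)
  case (insert k J)
  have J: "simple_function M (\<lambda>x j. if j \<in> J then u j x else c)"
    by (rule insert.IH) (simp add: insert.prems)
  have k: "simple_function M (u k)"
    by (simp add: insert.prems)
  have "simple_function M (\<lambda>x. (\<lambda>j. if j \<in> J then u j x else c)(k := u k x))"
    by (rule simple_function_compose2[OF J k, of "\<lambda>g a. g(k := a)"])
  moreover have "(\<lambda>x j. if j \<in> insert k J then u j x else c)
      = (\<lambda>x. (\<lambda>j. if j \<in> J then u j x else c)(k := u k x))"
    by (auto simp: fun_eq_iff)
  ultimately show ?case
    by (simp only:)
qed simp

text \<open>A nearly closest point of \<open>W\<close>. Composed with simple functions, it turns an approximation of a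
  function with values in \<open>W\<close> into one by simple functions with values in \<open>W\<close>.\<close>

lemma near_projection_exists:
  fixes W :: "'b::real_normed_vector set"
  assumes "closed W" "W \<noteq> {}"
  obtains \<phi> where "\<And>c. \<phi> c \<in> W" "\<And>c w. w \<in> W \<Longrightarrow> norm (\<phi> c - w) \<le> 3 * norm (c - w)"
proof -
  have "\<exists>v\<in>W. dist c v \<le> 2 * infdist c W" for c
  proof (cases "c \<in> W")
    case True
    then show ?thesis
      by (intro bexI[of _ c]) (auto simp: infdist_nonneg)
  next
    case False
    then have "0 < infdist c W"
      using assms by (metis in_closed_iff_infdist_zero infdist_nonneg less_eq_real_def)
    then have "infdist c W < 2 * infdist c W"
      by simp
    then have "Inf (dist c ` W) < 2 * infdist c W"
      using assms(2) by (simp add: infdist_def)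
    then obtain v where "v \<in> W" "dist c v < 2 * infdist c W"
      using cInf_lessD[of "dist c ` W"] assms(2) by blast
    then show ?thesis
      by (auto intro: less_imp_le)
  qed
  then obtain \<phi> where \<phi>: "\<And>c. \<phi> c \<in> W" "\<And>c. dist c (\<phi> c) \<le> 2 * infdist c W"
    by metis
  have "norm (\<phi> c - w) \<le> 3 * norm (c - w)" if "w \<in> W" for c w
  proof -
    have "norm (\<phi> c - w) \<le> dist c (\<phi> c) + dist c w"
      using dist_triangle2[of "\<phi> c" w c] by (simp add: dist_commute[of c]) (simp add: dist_norm)
    then show ?thesis
      using \<phi>(2)[of c] infdist_le[OF that, of c] by (simp add: dist_norm)
  qed
  with \<phi>(1) show ?thesis
    by (rule that)
qed

text \<open>Truncating the approximating simple functions at twice the norm of the limit gives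
  convergence in \<open>L^1\<close> by dominated convergence.\<close>

lemma strongly_measurable_integrable_on:
  fixes g :: "'a::euclidean_space \<Rightarrow> 'b::banach"
  assumes g: "strongly_measurable lebesgue g"
    and fin: "(\<integral>\<^sup>+x\<in>cbox a b. ennreal (norm (g x)) \<partial>lebesgue) < \<infinity>"
  shows "g integrable_on cbox a b"
proof -
  obtain u where u: "\<And>i::nat. simple_function lebesgue (u i)" "AE x in lebesgue. (\<lambda>i. u i x) \<longlonglongrightarrow> g x"
    by (rule strongly_measurableE[OF g]) (rule that)
  note [measurable] = strongly_measurable_norm[OF g]
  define v where "v = (\<lambda>i x. if norm (u i x) \<le> 2 * norm (g x) then u i x else 0)"
  have [measurable]: "(\<lambda>x. norm (u i x)) \<in> borel_measurable lebesgue" for i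
    by (rule borel_measurable_simple_function) (rule simple_function_compose1[OF u(1), of norm])
  have v: "simple_function lebesgue (v i)" for i
  proof -
    have "{x \<in> space lebesgue. norm (u i x) \<le> 2 * norm (g x)} \<in> sets lebesgue"
      by measurable
    then show ?thesis
      unfolding v_def by (intro simple_function_If u) auto
  qed
  have v_lim: "AE x in lebesgue. (\<lambda>i. v i x) \<longlonglongrightarrow> g x"
    using u(2)
  proof eventually_elim
    case (elim x)
    show ?case
    proof (cases "g x = 0")
      case True
      then have "v i x = 0" for i
        by (simp add: v_def)
      then show ?thesis
        using True by simp
    next
      case False
      then have "\<forall>\<^sub>F i in sequentially. norm (u i x) < 2 * norm (g x)"
        by (intro order_tendstoD(2)[OF tendsto_norm[OF elim]]) simp
      then have "\<forall>\<^sub>F i in sequentially. v i x = u i x"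
        by eventually_elim (simp add: v_def)
      then show ?thesis
        using elim by (simp add: tendsto_cong)
    qed
  qed
  have v_meas: "(\<lambda>x. norm (g x - v i x)) \<in> borel_measurable lebesgue" for i
    by (intro strongly_measurable_norm_diff g)
      (auto simp: strongly_measurable_def intro!: exI[of _ "\<lambda>_. v i"] v)
  note [measurable] = v_meas
  have bound: "norm (g x - v i x) \<le> 3 * norm (g x)" for i x
    unfolding v_def using norm_triangle_ineq4[of "g x" "u i x"] by auto
  have fin3: "(\<integral>\<^sup>+x\<in>cbox a b. ennreal (3 * norm (g x)) \<partial>lebesgue) < \<infinity>"
    using fin by (simp add: ennreal_mult mult.assoc nn_integral_cmult borel_measurable_times_ennreal
        borel_measurable_indicator ennreal_mult_less_top)
  have fin_v: "(\<integral>\<^sup>+x\<in>cbox a b. ennreal (norm (g x - v i x)) \<partial>lebesgue) < \<infinity>" for i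
    by (rule le_less_trans[OF _ fin3]) (intro nn_integral_mono, auto simp: indicator_def bound intro!: ennreal_leI)
  have int: "(\<lambda>x. norm (g x - v i x)) integrable_on cbox a b"
      "ennreal (integral (cbox a b) (\<lambda>x. norm (g x - v i x))) =
        (\<integral>\<^sup>+x\<in>cbox a b. ennreal (norm (g x - v i x)) \<partial>lebesgue)" for i
    using integrable_on_nn_integral_finite[OF v_meas _ _ fin_v] by auto
  have "(\<lambda>i. \<integral>\<^sup>+x\<in>cbox a b. ennreal (norm (g x - v i x)) \<partial>lebesgue) \<longlonglongrightarrow> (\<integral>\<^sup>+x. 0 \<partial>(lebesgue :: 'a measure))"
  proof (rule nn_integral_dominated_convergence[where w="\<lambda>x. ennreal (3 * norm (g x)) * indicator (cbox a b) x"])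
    show "AE x in lebesgue. (\<lambda>i. ennreal (norm (g x - v i x)) * indicator (cbox a b) x) \<longlonglongrightarrow> 0"
      using v_lim
    proof eventually_elim
      case (elim x)
      have "(\<lambda>i. norm (g x - v i x)) \<longlonglongrightarrow> norm (g x - g x)"
        by (intro tendsto_norm tendsto_diff tendsto_const elim)
      then have "(\<lambda>i. ennreal (norm (g x - v i x))) \<longlonglongrightarrow> 0"
        by (simp add: tendsto_ennreal_iff flip: ennreal_0)
      then show ?case
        by (auto simp: indicator_def)
    qed
  qed (use fin3 bound in \<open>auto simp: ennreal_leI intro!: borel_measurable_times_ennreal borel_measurable_indicator mult_right_mono\<close>)
  then have "(\<lambda>i. ennreal (integral (cbox a b) (\<lambda>x. norm (g x - v i x)))) \<longlonglongrightarrow> ennreal 0"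
    by (simp only: int(2) nn_integral_const mult_zero_left ennreal_0)
  then have "(\<lambda>i. integral (cbox a b) (\<lambda>x. norm (g x - v i x))) \<longlonglongrightarrow> 0"
    by (subst (asm) tendsto_ennreal_iff) (auto intro!: always_eventually integral_nonneg int(1))
  with int(1) show ?thesis
    by (rule integrable_on_L1_limit[OF simple_function_integrable_on_cbox[OF v]])
qed

lemma norm_integral_le_nn_integral:
  fixes g :: "'a::euclidean_space \<Rightarrow> 'b::banach"
  assumes g: "strongly_measurable lebesgue g" and int: "g integrable_on cbox a b"
  shows "ennreal (norm (integral (cbox a b) g)) \<le> (\<integral>\<^sup>+x\<in>cbox a b. ennreal (norm (g x)) \<partial>lebesgue)"
proof (cases "(\<integral>\<^sup>+x\<in>cbox a b. ennreal (norm (g x)) \<partial>lebesgue) < \<infinity>")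
  case True
  note I = integrable_on_nn_integral_finite[OF strongly_measurable_norm[OF g] _ _ True]
  have "norm (integral (cbox a b) g) \<le> integral (cbox a b) (\<lambda>x. norm (g x))"
    by (intro integral_norm_bound_integral int I) auto
  then have "ennreal (norm (integral (cbox a b) g)) \<le> ennreal (integral (cbox a b) (\<lambda>x. norm (g x)))"
    by (rule ennreal_leI)
  also have "\<dots> = (\<integral>\<^sup>+x\<in>cbox a b. ennreal (norm (g x)) \<partial>lebesgue)"
    by (intro I) auto
  finally show ?thesis .
qed (simp add: less_top[symmetric])

section \<open>Lebesgue norms of extended nonnegative functions\<close>

lemma epow_0 [simp]: "epow 0 r = 0"
  by (simp add: epow_def)

lemma epow_ennreal: "0 \<le> a \<Longrightarrow> epow (ennreal a) r = ennreal (a powr r)"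
  by (simp add: epow_def)

lemma epow_mono:
  assumes "a \<le> b" "0 < r"
  shows "epow a r \<le> epow b r"
proof (cases b)
  case (real t)
  then obtain s where "a = ennreal s" "0 \<le> s"
    using assms(1) by (cases a) (auto simp: top_unique)
  then show ?thesis
    using real assms by (simp add: epow_ennreal powr_mono2)
qed (use assms in \<open>simp add: epow_def\<close>)

lemma epow_mult:
  assumes "0 < r"
  shows "epow (a * b) r = epow a r * epow b r"
proof (cases a; cases b)
  fix s t assume "0 \<le> s" "a = ennreal s" "0 \<le> t" "b = ennreal t"
  then show ?thesis
    by (simp add: epow_ennreal powr_mult flip: ennreal_mult)
qed (auto simp: epow_def ennreal_top_mult ennreal_mult_top)

lemma epow_epow_inverse:
  assumes "0 < r"
  shows "epow (epow a r) (1 / r) = a"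
  using assms by (cases a) (auto simp: epow_ennreal powr_powr epow_def)

lemma epow_le_self:
  assumes "1 \<le> a" "0 < r" "r \<le> 1"
  shows "epow a r \<le> a"
proof (cases a)
  case (real t)
  then have "1 \<le> t"
    using assms(1) by (simp flip: ennreal_1)
  then show ?thesis
    using real assms powr_mono[of r 1 t] by (simp add: epow_ennreal)
qed simp

lemma borel_measurable_epow [measurable (raw)]:
  assumes [measurable]: "F \<in> borel_measurable M"
  shows "(\<lambda>x. epow (F x) r) \<in> borel_measurable M"
  unfolding epow_def by measurable

text \<open>The sum is at most the number of terms times the largest term.\<close>

lemma epow_sum_le:
  assumes "finite J" "0 < r"
  shows "epow (\<Sum>j\<in>J. a j) r \<le> epow (of_nat (card J)) r * (\<Sum>j\<in>J. epow (a j) r)"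
proof (cases "J = {}")
  case False
  then have "Max (a ` J) \<in> a ` J"
    using assms(1) by (intro Max_in) auto
  then obtain k where k: "k \<in> J" "Max (a ` J) = a k"
    by auto
  have "(\<Sum>j\<in>J. a j) \<le> of_nat (card J) * a k"
    using assms(1) by (intro sum_bounded_above) (simp flip: k(2))
  then have "epow (\<Sum>j\<in>J. a j) r \<le> epow (of_nat (card J)) r * epow (a k) r"
    using epow_mono[OF _ assms(2)] epow_mult[OF assms(2)] by metis
  also have "\<dots> \<le> epow (of_nat (card J)) r * (\<Sum>j\<in>J. epow (a j) r)"
    using assms(1) k(1) by (intro mult_left_mono member_le_sum) auto
  finally show ?thesis .
qed simp

lemma enn2real_ge_1:
  assumes "1 \<le> (p::ennreal)" "p \<noteq> \<infinity>"
  shows "1 \<le> enn2real p"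
  using assms by (cases p) (auto simp flip: ennreal_1)

text \<open>A nonnegative integral is a supremum over measurable minorants and so is monotone, whereas the
  essential supremum of a function that is not measurable is \<open>\<infinity>\<close>.\<close>

lemma Lp_norm_mono:
  assumes "1 \<le> p" and "p = \<infinity> \<Longrightarrow> F \<in> borel_measurable M"
    and le: "\<And>x. x \<in> space M \<Longrightarrow> F x \<le> G x"
  shows "Lp_norm p M F \<le> Lp_norm p M G"
proof (cases "p = \<infinity>")
  case True
  then show ?thesis
    using assms unfolding Lp_norm_def by (auto intro!: esssup_AE_mono AE_I2)
next
  case False
  then have r: "0 < enn2real p"
    using enn2real_ge_1[OF assms(1)] by simp
  show ?thesis
    unfolding Lp_norm_def using False r le
    by (auto intro!: epow_mono nn_integral_mono)
qed

lemma Lp_norm_cmult_le: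
  assumes "1 \<le> p" and F [measurable]: "F \<in> borel_measurable M"
  shows "Lp_norm p M (\<lambda>x. c * F x) \<le> c * Lp_norm p M F"
proof (cases "p = \<infinity>")
  case True
  have "AE x in M. c * F x \<le> c * esssup M F"
    using esssup_AE[of F M] by eventually_elim (rule mult_left_mono, auto)
  then show ?thesis
    using True unfolding Lp_norm_def by (auto intro!: esssup_I)
next
  case False
  then have r: "0 < enn2real p"
    using enn2real_ge_1[OF assms(1)] by simp
  then show ?thesis
    using False by (simp add: Lp_norm_def epow_mult nn_integral_cmult epow_epow_inverse)
qed

text \<open>The elementary bound \<open>epow_sum_le\<close> takes the place of convexity, at the cost of powers of the
  number of summands. Measurability of the summands splits the integral of the sum.\<close>

lemma Lp_norm_sum_le:
  assumes p: "1 \<le> p" and J: "finite J" and F: "\<And>j. j \<in> J \<Longrightarrow> F j \<in> borel_measurable M"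
  shows "Lp_norm p M (\<lambda>x. \<Sum>j\<in>J. F j x) \<le> of_nat (card J) * of_nat (card J) * (\<Sum>j\<in>J. Lp_norm p M (F j))"
    (is "_ \<le> ?N * ?N * _")
proof (cases "J = {}")
  case True
  have "esssup M (\<lambda>_. 0::ennreal) \<le> 0"
    by (rule esssup_I) auto
  then show ?thesis
    using True by (simp add: Lp_norm_def)
next
  case ne: False
  then have N: "1 \<le> ?N"
    using J by (simp add: Suc_le_eq card_gt_0_iff)
  show ?thesis
  proof (cases "p = \<infinity>")
    case True
    have "\<forall>j\<in>J. AE x in M. F j x \<le> esssup M (F j)"
      by (simp add: esssup_AE)
    then have "AE x in M. \<forall>j\<in>J. F j x \<le> esssup M (F j)"
      using J by (simp add: AE_finite_all)
    then have "AE x in M. (\<Sum>j\<in>J. F j x) \<le> (\<Sum>j\<in>J. esssup M (F j))"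
      by eventually_elim (auto intro: sum_mono)
    then have "esssup M (\<lambda>x. \<Sum>j\<in>J. F j x) \<le> 1 * 1 * (\<Sum>j\<in>J. esssup M (F j))"
      using F by (auto intro!: esssup_I)
    also have "\<dots> \<le> ?N * ?N * (\<Sum>j\<in>J. esssup M (F j))"
      using N by (intro mult_right_mono mult_mono) auto
    finally show ?thesis
      using True by (simp add: Lp_norm_def)
  next
    case False
    define r where "r = enn2real p"
    have r: "1 \<le> r" "0 < r"
      using enn2real_ge_1[OF p False] by (auto simp: r_def)
    define X where "X = (\<lambda>j. \<integral>\<^sup>+x. epow (F j x) r \<partial>M)"
    have "(\<integral>\<^sup>+x. epow (\<Sum>j\<in>J. F j x) r \<partial>M) \<le> (\<integral>\<^sup>+x. epow ?N r * (\<Sum>j\<in>J. epow (F j x) r) \<partial>M)"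
      using J r by (intro nn_integral_mono epow_sum_le)
    also have "\<dots> = epow ?N r * (\<Sum>j\<in>J. X j)"
      unfolding X_def using F J by (simp add: nn_integral_cmult nn_integral_sum)
    finally have "epow (\<integral>\<^sup>+x. epow (\<Sum>j\<in>J. F j x) r \<partial>M) (1 / r) \<le> epow (epow ?N r * (\<Sum>j\<in>J. X j)) (1 / r)"
      using r by (intro epow_mono) auto
    also have "\<dots> = ?N * epow (\<Sum>j\<in>J. X j) (1 / r)"
      using r by (simp add: epow_mult epow_epow_inverse)
    also have "\<dots> \<le> ?N * (epow ?N (1 / r) * (\<Sum>j\<in>J. epow (X j) (1 / r)))"
      using r J by (intro mult_left_mono epow_sum_le) auto
    also have "\<dots> \<le> ?N * (?N * (\<Sum>j\<in>J. epow (X j) (1 / r)))"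
      using r N by (intro mult_left_mono mult_right_mono epow_le_self) auto
    finally show ?thesis
      using False by (simp add: Lp_norm_def X_def r_def mult.assoc)
  qed
qed

lemma Lp_norm_add_le:
  assumes p: "1 \<le> p" and F: "F \<in> borel_measurable M" and G: "G \<in> borel_measurable M"
  shows "Lp_norm p M (\<lambda>x. F x + G x) \<le> 4 * (Lp_norm p M F + Lp_norm p M G)"
  using Lp_norm_sum_le[OF p, of "UNIV :: bool set" "\<lambda>b. if b then F else G" M] F G
  by (simp add: UNIV_bool add.commute)

lemma esssup_count_space:
  fixes F :: "'a \<Rightarrow> ennreal"
  shows "esssup (count_space A) F = (SUP n\<in>A. F n)"
proof (rule antisym)
  show "esssup (count_space A) F \<le> (SUP n\<in>A. F n)"
    by (rule esssup_I) (auto simp: AE_count_space intro: SUP_upper)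
  show "(SUP n\<in>A. F n) \<le> esssup (count_space A) F"
    using esssup_AE[of F "count_space A"] by (auto simp: AE_count_space intro: SUP_least)
qed

lemma borel_measurable_lq_norm:
  assumes [measurable]: "\<And>n. c n \<in> borel_measurable M"
  shows "(\<lambda>x. Lp_norm q (count_space UNIV) (\<lambda>n::nat. c n x)) \<in> borel_measurable M"
  unfolding Lp_norm_def
  by (cases "q = \<infinity>") (simp_all add: esssup_count_space nn_integral_count_space_nat)

lemma term_le_lq_norm:
  assumes "1 \<le> q"
  shows "c n \<le> Lp_norm q (count_space UNIV) (c :: nat \<Rightarrow> ennreal)"
proof (cases "q = \<infinity>")
  case True
  then show ?thesis
    by (simp add: Lp_norm_def esssup_count_space SUP_upper)
next
  case False
  then have r: "0 < enn2real q"
    using enn2real_ge_1[OF assms] by simp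
  have "epow (c n) (enn2real q) \<le> (\<integral>\<^sup>+n. epow (c n) (enn2real q) \<partial>count_space UNIV)"
    unfolding nn_integral_count_space_nat using sum_le_suminf[of "\<lambda>n. epow (c n) (enn2real q)" "{n}"]
    by simp
  then have "epow (epow (c n) (enn2real q)) (1 / enn2real q)
      \<le> epow (\<integral>\<^sup>+n. epow (c n) (enn2real q) \<partial>count_space UNIV) (1 / enn2real q)"
    using r by (intro epow_mono) auto
  then show ?thesis
    using False r by (simp add: Lp_norm_def epow_epow_inverse)
qed

lemma ennreal_cmult_divide:
  assumes "0 < c"
  shows "ennreal c * (X / ennreal c) = X"
  using assms by (simp add: ennreal_times_divide mult.commute[of _ X] ennreal_mult_divide_eq)

lemma ennreal_divide_le:
  assumes "0 < a" "0 < b" "b \<le> K * a"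
  shows "X / ennreal a \<le> ennreal K * (X / ennreal b)"
proof -
  have K: "0 < K"
    using assms by (intro zero_less_mult_pos2[of K a]) auto
  have "1 / a \<le> K * (1 / b)"
    using assms by (simp add: field_simps)
  then have "ennreal (1 / a) \<le> ennreal K * ennreal (1 / b)"
    using assms K by (simp add: ennreal_leI flip: ennreal_mult)
  then have "X * ennreal (1 / a) \<le> X * (ennreal K * ennreal (1 / b))"
    by (intro mult_left_mono) auto
  then show ?thesis
    using assms by (simp add: divide_ennreal_def inverse_ennreal ac_simps inverse_eq_divide)
qed

text \<open>The constant is moved to the measurable side before it is taken out of the norm.\<close>

lemma Lp_norm_le_cmult:
  assumes "1 \<le> p" "0 < c" and F [measurable]: "F \<in> borel_measurable M"
    and le: "\<And>x. x \<in> space M \<Longrightarrow> F x \<le> ennreal c * G x"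
  shows "Lp_norm p M F \<le> ennreal c * Lp_norm p M G"
proof -
  have "F x / ennreal c \<le> G x" if "x \<in> space M" for x
    using le[OF that] assms(2) by (simp add: divide_le_posI_ennreal)
  then have "Lp_norm p M (\<lambda>x. F x / ennreal c) \<le> Lp_norm p M G"
    using assms(1) by (intro Lp_norm_mono) auto
  moreover have "Lp_norm p M F \<le> ennreal c * Lp_norm p M (\<lambda>x. F x / ennreal c)"
    using Lp_norm_cmult_le[OF assms(1), of "\<lambda>x. F x / ennreal c" M "ennreal c"] assms(2)
    by (simp add: ennreal_cmult_divide)
  ultimately show ?thesis
    by (meson mult_left_mono order_trans zero_le)
qed

lemma ennreal_le_1_plus_epow:
  assumes "1 \<le> r"
  shows "a \<le> 1 + epow a r"
proof (cases a)
  case (real t)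
  show ?thesis
  proof (cases "t \<le> 1")
    case True
    then have "a \<le> 1"
      using real by simp
    then show ?thesis
      by (rule order_trans) simp
  next
    case False
    then have "a \<le> epow a r"
      using real assms powr_mono[of 1 r t] by (simp add: epow_ennreal ennreal_leI)
    then show ?thesis
      by (rule order_trans) simp
  qed
qed (simp add: epow_def)

text \<open>By \<open>t \<le> 1 + t\<^sup>p\<close>, functions in \<open>L\<^sup>p\<close> are locally integrable.\<close>

lemma Lp_imp_locally_integrable:
  assumes p: "1 \<le> p" "p < \<infinity>" and F: "F \<in> borel_measurable lebesgue"
    and fin: "Lp_norm p lebesgue F < \<infinity>"
  shows "(\<integral>\<^sup>+z\<in>cbox a b. F z \<partial>lebesgue) < \<infinity>"
proof -
  have r: "1 \<le> enn2real p"
    using enn2real_ge_1[of p] p by auto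
  have int: "(\<integral>\<^sup>+z. epow (F z) (enn2real p) \<partial>lebesgue) < \<infinity>"
  proof (rule ccontr)
    assume "\<not> ?thesis"
    then have "(\<integral>\<^sup>+z. epow (F z) (enn2real p) \<partial>lebesgue) = \<infinity>"
      by (simp add: less_top[symmetric])
    then show False
      using fin p unfolding Lp_norm_def by (auto simp: epow_def split: if_splits)
  qed
  have "(\<integral>\<^sup>+z\<in>cbox a b. F z \<partial>lebesgue) \<le> (\<integral>\<^sup>+z. indicator (cbox a b) z + epow (F z) (enn2real p) \<partial>lebesgue)"
    using ennreal_le_1_plus_epow[OF r] by (intro nn_integral_mono) (auto simp: indicator_def)
  also have "\<dots> = emeasure lebesgue (cbox a b) + (\<integral>\<^sup>+z. epow (F z) (enn2real p) \<partial>lebesgue)"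
    using F by (subst nn_integral_add) (auto intro!: borel_measurable_indicator)
  also have "\<dots> < \<infinity>"
    using int emeasure_lborel_cbox_finite[of a b] by simp
  finally show ?thesis .
qed

section \<open>Dyadic scales and the measure of scales\<close>

text \<open>The left endpoint is chosen such that \<open>4 * l \<ge> 3 / 2 ^ n\<close> on the interval: the box of radius \<open>4 * l\<close>
  around \<open>w\<close> then contains the boxes of radius \<open>1 / 2 ^ n\<close> around all points within \<open>2 / 2 ^ n\<close> of \<open>w\<close>. As
  \<open>3 / 4 > 1 / 2\<close>, the intervals are disjoint.\<close>

definition scale_interval :: "nat \<Rightarrow> real set" where
  "scale_interval n = {3 / 4 / 2 ^ n .. 1 / 2 ^ n}"

lemma scale_interval_subset: "scale_interval n \<subseteq> {0<..1}"
proof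
  fix l :: real assume "l \<in> scale_interval n"
  then have l: "3 / 4 / 2 ^ n \<le> l" "l \<le> 1 / 2 ^ n"
    by (auto simp: scale_interval_def)
  have "(1::real) \<le> 2 ^ n"
    by simp
  then have "1 / 2 ^ n \<le> (1::real)"
    by (simp add: field_simps)
  moreover have "0 < l"
    by (rule less_le_trans[OF _ l(1)]) simp
  ultimately show "l \<in> {0<..1}"
    using order_trans[OF l(2)] by simp
qed

lemma scale_interval_disjoint:
  assumes "l \<in> scale_interval m" "l \<in> scale_interval n"
  shows "m = n"
proof -
  have False if "i < j" "l \<in> scale_interval i" "l \<in> scale_interval j" for i j
  proof -
    have "3 / 4 / 2 ^ i \<le> l" "l \<le> 1 / 2 ^ j"
      using that by (auto simp: scale_interval_def)
    then have "3 / 4 / 2 ^ i \<le> (1 / 2 ^ j :: real)"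
      by (rule order_trans)
    then have "(3 / 4) * 2 ^ j \<le> (2 ^ i :: real)"
      by (simp add: field_simps)
    moreover have "(2::real) * 2 ^ i \<le> 2 ^ j"
      using \<open>i < j\<close> power_increasing[of "Suc i" j "2::real"] by simp
    moreover have "(0::real) < 2 ^ i"
      by simp
    ultimately show False
      by linarith
  qed
  then show ?thesis
    using assms by (meson linorder_neqE_nat)
qed

lemma sets_log_measure: "A \<in> sets lebesgue \<Longrightarrow> A \<subseteq> {0<..1} \<Longrightarrow> A \<in> sets log_measure"
  by (simp add: log_measure_def sets_restrict_space_iff)

lemma scale_interval_sets: "scale_interval n \<in> sets log_measure"
  by (intro sets_log_measure scale_interval_subset) (simp add: scale_interval_def)

lemma emeasure_scale_interval: "ennreal (1 / 4) \<le> emeasure log_measure (scale_interval n)"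
proof -
  have meas: "(\<lambda>l. ennreal (1 / l)) \<in> borel_measurable (lebesgue_on {0<..1::real})"
    by (intro measurable_restrict_space1 measurable_completion) simp
  have sets: "scale_interval n \<in> sets (lebesgue_on {0<..1::real})"
    using scale_interval_subset[of n] by (simp add: sets_restrict_space_iff scale_interval_def)
  have "emeasure lborel (scale_interval n) = ennreal (1 / 2 ^ n - 3 / 4 / 2 ^ n)"
    unfolding scale_interval_def by (rule emeasure_lborel_Icc) (simp add: field_simps)
  then have "emeasure lebesgue (scale_interval n) = ennreal (1 / 4 / 2 ^ n)"
    by (simp add: scale_interval_def field_simps)
  then have vol: "emeasure (lebesgue_on {0<..1}) (scale_interval n) = ennreal (1 / 4 / 2 ^ n)"
    using scale_interval_subset[of n] by (simp add: emeasure_restrict_space)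
  have "ennreal (1 / 4) = ennreal (2 ^ n) * ennreal (1 / 4 / 2 ^ n)"
    by (subst ennreal_mult[symmetric]) auto
  also have "\<dots> = (\<integral>\<^sup>+l. ennreal (2 ^ n) * indicator (scale_interval n) l \<partial>lebesgue_on {0<..1})"
    using sets by (simp add: nn_integral_cmult_indicator vol)
  also have "\<dots> \<le> (\<integral>\<^sup>+l. ennreal (1 / l) * indicator (scale_interval n) l \<partial>lebesgue_on {0<..1})"
  proof (intro nn_integral_mono)
    fix l :: real
    have "2 ^ n \<le> 1 / l" if "l \<in> scale_interval n"
      using that scale_interval_subset[of n] by (auto simp: scale_interval_def field_simps)
    then show "ennreal (2 ^ n) * indicator (scale_interval n) l \<le> ennreal (1 / l) * indicator (scale_interval n) l"
      by (auto simp: indicator_def intro: ennreal_leI)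
  qed
  also have "\<dots> = emeasure log_measure (scale_interval n)"
    unfolding log_measure_def by (rule emeasure_density[OF meas sets, symmetric])
  finally show ?thesis .
qed

text \<open>The intervals of scales are disjoint and each of them has mass at least \<open>1 / 4\<close>, so a sequence
  that is bounded by a function of the scale on each of them is bounded in \<open>l^q\<close> by the norm of that
  function. If the function of the scale is not measurable, the right-hand side is \<open>\<infinity>\<close> for
  \<open>q = \<infinity>\<close>, and for \<open>q < \<infinity>\<close> its integral is a supremum over measurable minorants.\<close>

lemma lq_norm_le_log_norm:
  assumes q: "1 \<le> q" and le: "\<And>n l. l \<in> scale_interval (n + k) \<Longrightarrow> c n \<le> \<Phi> l"
  shows "Lp_norm q (count_space UNIV) (c :: nat \<Rightarrow> ennreal) \<le> 4 * Lp_norm q log_measure \<Phi>"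
proof (cases "q = \<infinity>")
  case True
  have "c n \<le> esssup log_measure \<Phi>" for n
  proof (rule ccontr)
    assume *: "\<not> c n \<le> esssup log_measure \<Phi>"
    have "AE l in log_measure. l \<notin> scale_interval (n + k)"
      using esssup_AE[of \<Phi> log_measure] by eventually_elim (use * le order_trans in blast)
    then have "scale_interval (n + k) \<in> null_sets log_measure"
      by (simp add: AE_iff_null_sets scale_interval_sets)
    then show False
      using emeasure_scale_interval[of "n + k"] by auto
  qed
  then have "(SUP n. c n) \<le> 1 * esssup log_measure \<Phi>"
    by (simp add: SUP_least)
  also have "\<dots> \<le> 4 * esssup log_measure \<Phi>"
    by (intro mult_right_mono) auto
  finally show ?thesis
    using True by (simp add: Lp_norm_def esssup_count_space)
next
  case False
  define r where "r = enn2real q"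
  have r: "1 \<le> r" "0 < r"
    using enn2real_ge_1[OF q False] by (auto simp: r_def)
  \<comment> \<open>a measurable minorant of \<open>epow (\<Phi> l) r\<close>\<close>
  define g where "g = (\<lambda>l. \<Sum>n. epow (c n) r * indicator (scale_interval (n + k)) l)"
  have g_le: "g l \<le> epow (\<Phi> l) r" for l
  proof (cases "\<exists>n. l \<in> scale_interval (n + k)")
    case True
    then obtain n where n: "l \<in> scale_interval (n + k)"
      by auto
    have "g l = (\<Sum>m\<in>{n}. epow (c m) r * indicator (scale_interval (m + k)) l)"
      unfolding g_def
    proof (rule suminf_finite)
      fix m assume "m \<notin> {n}"
      then show "epow (c m) r * indicator (scale_interval (m + k)) l = 0"
        using scale_interval_disjoint[OF n, of "m + k"] by (auto simp: indicator_def)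
    qed simp
    also have "\<dots> = epow (c n) r"
      using n by simp
    also have "\<dots> \<le> epow (\<Phi> l) r"
      using le[OF n] r by (intro epow_mono)
    finally show ?thesis .
  next
    case False
    then show ?thesis
      by (simp add: g_def indicator_def)
  qed
  have "ennreal (1 / 4) * (\<Sum>n. epow (c n) r) = (\<Sum>n. epow (c n) r * ennreal (1 / 4))"
    by (simp add: mult.commute flip: ennreal_suminf_cmult)
  also have "\<dots> \<le> (\<Sum>n. epow (c n) r * emeasure log_measure (scale_interval (n + k)))"
    by (intro suminf_le mult_left_mono emeasure_scale_interval) auto
  also have "\<dots> = (\<integral>\<^sup>+l. g l \<partial>log_measure)"
    unfolding g_def
    by (subst nn_integral_suminf)
      (auto intro!: borel_measurable_times_ennreal borel_measurable_indicator scale_interval_sets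
        simp: nn_integral_cmult_indicator scale_interval_sets)
  also have "\<dots> \<le> (\<integral>\<^sup>+l. epow (\<Phi> l) r \<partial>log_measure)"
    by (intro nn_integral_mono g_le)
  finally have "4 * (ennreal (1 / 4) * (\<Sum>n. epow (c n) r)) \<le> 4 * (\<integral>\<^sup>+l. epow (\<Phi> l) r \<partial>log_measure)"
    by (intro mult_left_mono) auto
  moreover have "4 * ennreal (1 / 4) = 1"
    by (simp flip: ennreal_numeral ennreal_mult)
  ultimately have "(\<Sum>n. epow (c n) r) \<le> 4 * (\<integral>\<^sup>+l. epow (\<Phi> l) r \<partial>log_measure)"
    by (simp add: mult.assoc[symmetric])
  then have "epow (\<Sum>n. epow (c n) r) (1 / r) \<le> epow (4 * (\<integral>\<^sup>+l. epow (\<Phi> l) r \<partial>log_measure)) (1 / r)"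
    using r by (intro epow_mono) auto
  also have "\<dots> = epow 4 (1 / r) * epow (\<integral>\<^sup>+l. epow (\<Phi> l) r \<partial>log_measure) (1 / r)"
    using r by (simp add: epow_mult)
  also have "\<dots> \<le> 4 * epow (\<integral>\<^sup>+l. epow (\<Phi> l) r \<partial>log_measure) (1 / r)"
    using r by (intro mult_right_mono epow_le_self) auto
  finally show ?thesis
    using False by (simp add: Lp_norm_def r_def nn_integral_count_space_nat)
qed

section \<open>The scaled norm\<close>

lemma powr_inverse_le_iff:
  fixes a R :: real
  assumes "0 \<le> a" "0 \<le> R" "1 \<le> m"
  shows "a powr (1 / real m) \<le> R \<longleftrightarrow> a \<le> R ^ m"
proof (cases "a = 0")
  case False
  then have a: "0 < a"
    using assms(1) by simp
  have pow: "(a powr (1 / real m)) ^ m = a"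
    using a assms(3) by (simp add: powr_powr flip: powr_realpow)
  have "a powr (1 / real m) \<le> R \<longleftrightarrow> (a powr (1 / real m)) ^ m \<le> R ^ m"
    using assms by (intro power_mono_iff[symmetric]) auto
  then show ?thesis
    by (simp only: pow)
qed (use assms in auto)

lemma snorm_le_iff:
  fixes s :: "'d::finite \<Rightarrow> nat"
  assumes "scaling s" "0 \<le> R"
  shows "snorm s x \<le> R \<longleftrightarrow> (\<forall>i. \<bar>x $ i\<bar> \<le> R ^ s i)"
  using assms by (simp add: snorm_def scaling_def powr_inverse_le_iff)

lemma snorm_nonneg: "0 \<le> snorm s x"
proof -
  have "\<bar>x $ i\<bar> powr (1 / real (s i)) \<le> snorm s x" for i
    unfolding snorm_def by (intro Max_ge) auto
  then show ?thesis
    using order_trans[OF powr_ge_zero] by blast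
qed

lemma snorm_minus: "snorm s (- x) = snorm s x"
  by (simp add: snorm_def)

lemma snorm_commute: "snorm s (x - y) = snorm s (y - x)"
  using snorm_minus[of s "x - y"] by simp

lemma power_add_le:
  fixes a b :: real
  assumes "0 \<le> a" "0 \<le> b" "1 \<le> m"
  shows "a ^ m + b ^ m \<le> (a + b) ^ m"
  using assms(3)
proof (induction m rule: dec_induct)
  case (step m)
  have "a ^ Suc m + b ^ Suc m \<le> (a + b) * (a ^ m + b ^ m)"
    using assms by (simp add: algebra_simps)
  also have "\<dots> \<le> (a + b) * (a + b) ^ m"
    using assms step by (intro mult_left_mono) auto
  finally show ?case
    by simp
qed simp

text \<open>By \<open>power_add_le\<close> in each coordinate, since the exponents are at least \<open>1\<close>.\<close>

lemma snorm_triangle: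
  assumes "scaling s"
  shows "snorm s (x + y) \<le> snorm s x + snorm s y"
proof -
  note nn = snorm_nonneg[of s x] snorm_nonneg[of s y]
  have x: "\<bar>x $ i\<bar> \<le> snorm s x ^ s i" and y: "\<bar>y $ i\<bar> \<le> snorm s y ^ s i" for i
    using snorm_le_iff[OF assms nn(1), of x] snorm_le_iff[OF assms nn(2), of y] by auto
  have "\<bar>(x + y) $ i\<bar> \<le> (snorm s x + snorm s y) ^ s i" for i
    using power_add_le[OF nn, of "s i"] x[of i] y[of i] assms
    by (simp add: scaling_def)
  then show ?thesis
    using nn by (subst snorm_le_iff[OF assms]) auto
qed

lemma snorm_triangle_diff:
  assumes "scaling s"
  shows "snorm s (x - z) \<le> snorm s (x - y) + snorm s (y - z)"
  using snorm_triangle[OF assms, of "x - y" "y - z"] by simp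

section \<open>Boxes\<close>

lemma mem_Qbox: "y \<in> Qbox s x R \<longleftrightarrow> snorm s (y - x) \<le> R"
  by (simp add: Qbox_def)

lemma Qbox_eq_cbox:
  assumes "scaling s" "0 \<le> R"
  shows "Qbox s x R = cbox (x - (\<chi> i. R ^ s i)) (x + (\<chi> i. R ^ s i))"
proof -
  have "\<bar>y $ i - x $ i\<bar> \<le> R ^ s i \<longleftrightarrow> x $ i - R ^ s i \<le> y $ i \<and> y $ i \<le> x $ i + R ^ s i" for y i
    by auto
  then show ?thesis
    by (auto simp: set_eq_iff mem_Qbox snorm_le_iff[OF assms] mem_box_cart)
qed

lemma emeasure_Qbox:
  fixes s :: "'d::finite \<Rightarrow> nat"
  assumes "scaling s" "0 \<le> R"
  shows "emeasure lebesgue (Qbox s x R) = ennreal (2 ^ CARD('d) * R ^ (\<Sum>i\<in>UNIV. s i))"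
proof -
  have "x - (\<chi> i. R ^ s i) \<in> cbox (x - (\<chi> i. R ^ s i)) (x + (\<chi> i. R ^ s i))"
    using assms by (simp add: mem_box_cart)
  then have "measure lborel (Qbox s x R) = (\<Prod>i\<in>UNIV. 2 * R ^ s i)"
    by (subst Qbox_eq_cbox[OF assms], subst content_cbox_cart) auto
  also have "\<dots> = 2 ^ CARD('d) * R ^ (\<Sum>i\<in>UNIV. s i)"
    by (simp add: prod.distrib power_sum)
  finally have "measure lborel (Qbox s x R) = 2 ^ CARD('d) * R ^ (\<Sum>i\<in>UNIV. s i)" .
  moreover have "emeasure lborel (Qbox s x R) = ennreal (measure lborel (Qbox s x R))"
    unfolding Qbox_eq_cbox[OF assms] using emeasure_lborel_cbox_finite
    by (intro emeasure_eq_ennreal_measure) (simp add: less_top)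
  ultimately show ?thesis
    by (simp add: Qbox_eq_cbox[OF assms])
qed

lemma measure_Qbox:
  fixes s :: "'d::finite \<Rightarrow> nat"
  assumes "scaling s" "0 \<le> R"
  shows "measure lebesgue (Qbox s x R) = 2 ^ CARD('d) * R ^ (\<Sum>i\<in>UNIV. s i)"
  using assms by (simp add: measure_def emeasure_Qbox del: emeasure_completion measure_completion)

lemma Qbox_sets: "scaling s \<Longrightarrow> 0 \<le> R \<Longrightarrow> Qbox s x R \<in> sets borel"
  by (simp add: Qbox_eq_cbox)

section \<open>Lattices\<close>

text \<open>An explicit formula for the point that \<^const>\<open>lattice_pt\<close> describes.\<close>

definition grid_floor :: "('d::finite \<Rightarrow> nat) \<Rightarrow> nat \<Rightarrow> real ^ 'd \<Rightarrow> real ^ 'd" where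
  "grid_floor s n x = (\<chi> i. real_of_int \<lfloor>x $ i * 2 ^ (n * s i)\<rfloor> / 2 ^ (n * s i))"

lemma cell_unique:
  assumes "y \<in> lattice_pts s n" "x \<in> cell s n y"
  shows "y = grid_floor s n x"
proof -
  obtain k where k: "\<And>i. y $ i = real_of_int (k i) / 2 ^ (n * s i)"
    using assms(1) by (auto simp: lattice_pts_def)
  have "\<lfloor>x $ i * 2 ^ (n * s i)\<rfloor> = k i" for i
  proof -
    have "y $ i \<le> x $ i" "x $ i < y $ i + 1 / 2 ^ (n * s i)"
      using assms(2) by (auto simp: cell_def)
    then show ?thesis
      unfolding k by (intro floor_unique) (auto simp: divide_le_eq less_divide_eq simp flip: add_divide_distrib)
  qed
  then show ?thesis
    by (simp add: vec_eq_iff grid_floor_def k)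
qed

lemma grid_floor_in: "grid_floor s n x \<in> lattice_pts s n"
  by (auto simp: grid_floor_def lattice_pts_def intro!: exI[of _ "\<lambda>i. \<lfloor>x $ i * 2 ^ (n * s i)\<rfloor>"])

lemma in_cell_grid_floor: "x \<in> cell s n (grid_floor s n x)"
proof -
  have "real_of_int \<lfloor>x $ i * 2 ^ (n * s i)\<rfloor> \<le> x $ i * 2 ^ (n * s i)"
    "x $ i * 2 ^ (n * s i) < real_of_int \<lfloor>x $ i * 2 ^ (n * s i)\<rfloor> + 1" for i
    by linarith+
  then show ?thesis
    by (auto simp: grid_floor_def cell_def divide_le_eq less_divide_eq simp flip: add_divide_distrib)
qed

lemma lattice_pt_eq: "lattice_pt s n x = grid_floor s n x"
  unfolding lattice_pt_def
  by (rule the_equality) (auto simp: grid_floor_in in_cell_grid_floor cell_unique)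

lemma lattice_pt_in: "lattice_pt s n x \<in> lattice_pts s n"
  by (simp add: lattice_pt_eq grid_floor_in)

lemma in_cell_lattice_pt: "x \<in> cell s n (lattice_pt s n x)"
  by (simp add: lattice_pt_eq in_cell_grid_floor)

lemma in_cell_iff: "y \<in> lattice_pts s n \<Longrightarrow> x \<in> cell s n y \<longleftrightarrow> y = lattice_pt s n x"
  using cell_unique in_cell_grid_floor by (auto simp: lattice_pt_eq)

lemma snorm_cell:
  assumes "scaling s" "x \<in> cell s n y"
  shows "snorm s (x - y) \<le> 1 / 2 ^ n"
  using assms by (subst snorm_le_iff) (auto simp: cell_def power_one_over power_mult less_imp_le abs_le_iff
      algebra_simps power_divide dest!: spec)

lemma snorm_lattice_pt: "scaling s \<Longrightarrow> snorm s (x - lattice_pt s n x) \<le> 1 / 2 ^ n"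
  by (rule snorm_cell[OF _ in_cell_lattice_pt])

lemma infsum_cell:
  "(\<Sum>\<^sub>\<infinity>y\<in>lattice_pts s n. (a y :: ennreal) * indicator (cell s n y) x) = a (lattice_pt s n x)"
proof -
  have "(\<Sum>\<^sub>\<infinity>y\<in>lattice_pts s n. a y * indicator (cell s n y) x)
      = (\<Sum>\<^sub>\<infinity>y\<in>{lattice_pt s n x}. a y)"
    by (rule infsum_cong_neutral) (auto simp: lattice_pt_in in_cell_iff indicator_def in_cell_lattice_pt)
  then show ?thesis
    by simp
qed

lemma countable_lattice_pts: "countable (lattice_pts s n)"
proof -
  have "lattice_pts s n \<subseteq> range (\<lambda>k. \<chi> i. real_of_int (k i) / 2 ^ (n * s i))"
    by (auto simp: lattice_pts_def vec_eq_iff image_iff)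
  moreover have "countable (UNIV :: ('a \<Rightarrow> int) set)"
    by simp
  ultimately show ?thesis
    by (meson countable_image countable_subset)
qed

lemma lattice_pts_bounded_finite:
  "finite {y \<in> lattice_pts s n. \<forall>i. \<bar>y $ i\<bar> \<le> real m / 2 ^ (n * s i)}" (is "finite ?A")
  and card_lattice_pts_bounded:
  "card {y \<in> lattice_pts s n. \<forall>i. \<bar>y $ i\<bar> \<le> real m / 2 ^ (n * s i)} \<le> (2 * m + 1) ^ CARD('d)"
  for s :: "'d::finite \<Rightarrow> nat"
proof -
  let ?K = "PiE (UNIV :: 'd set) (\<lambda>_. {- int m .. int m})"
  let ?g = "\<lambda>k. (\<chi> i. real_of_int (k i) / 2 ^ (n * s i)) :: real ^ 'd"
  have sub: "?A \<subseteq> ?g ` ?K"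
  proof
    fix y assume "y \<in> ?A"
    then obtain k where k: "\<And>i. y $ i = real_of_int (k i) / 2 ^ (n * s i)"
        and y: "\<And>i. \<bar>y $ i\<bar> \<le> real m / 2 ^ (n * s i)"
      by (auto simp: lattice_pts_def)
    have "\<bar>real_of_int (k i)\<bar> \<le> real m" for i
      using y[of i] by (simp add: k divide_le_cancel)
    then have "- int m \<le> k i \<and> k i \<le> int m" for i
      by (metis abs_le_iff minus_le_iff of_int_abs of_int_le_iff of_int_of_nat_eq)
    then have "k \<in> ?K"
      by auto
    moreover have "y = ?g k"
      by (simp add: vec_eq_iff k)
    ultimately show "y \<in> ?g ` ?K"
      by blast
  qed
  have fin: "finite ?K"
    by (intro finite_PiE) auto
  have "card ?K = (2 * m + 1) ^ CARD('d)"
    by (subst card_PiE) (auto simp: nat_add_distrib nat_mult_distrib intro!: arg_cong[where f="\<lambda>a. a ^ CARD('d)"])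
  then show "finite ?A" "card ?A \<le> (2 * m + 1) ^ CARD('d)"
    using finite_subset[OF sub] fin card_mono[OF _ sub] card_image_le[OF fin, of ?g] by auto
qed

lemma nbrs_subset:
  assumes "scaling s"
  shows "nbrs s n \<subseteq> {y \<in> lattice_pts s n. \<forall>i. \<bar>y $ i\<bar> \<le> real 1 / 2 ^ (n * s i)}"
  using assms by (auto simp: nbrs_def mem_Qbox snorm_le_iff power_one_over power_mult power_divide)

lemma card_nbrs:
  fixes s :: "'d::finite \<Rightarrow> nat"
  assumes "scaling s"
  shows "card (nbrs s n) \<le> 3 ^ CARD('d)"
  using card_mono[OF lattice_pts_bounded_finite nbrs_subset[OF assms, of n]]
    card_lattice_pts_bounded[where n=n and s=s and m=1] by simp

lemma borel_measurable_lattice_pt: "lattice_pt s n \<in> borel_measurable borel"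
proof -
  have "(\<lambda>x. lattice_pt s n x $ i) \<in> borel_measurable borel" for i
    unfolding lattice_pt_eq grid_floor_def by simp
  then have "(\<lambda>x. \<chi> i. lattice_pt s n x $ i) \<in> borel_measurable borel"
    by (subst borel_measurable_euclidean_space) (auto simp: Basis_vec_def inner_axis)
  then show ?thesis
    by simp
qed

text \<open>The lattice point of \<open>x\<close>, cut off outside a large box so that it takes finitely many values.\<close>

definition cut_pt :: "('d::finite \<Rightarrow> nat) \<Rightarrow> nat \<Rightarrow> nat \<Rightarrow> real ^ 'd \<Rightarrow> real ^ 'd" where
  "cut_pt s m n x = (if \<forall>i. \<bar>x $ i\<bar> \<le> real m then lattice_pt s n x else 0)"

lemma simple_function_cut_pt: "simple_function lebesgue (cut_pt s m n)"
proof (rule simple_function_borel_measurable)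
  have "closed {x :: real ^ 'a. \<forall>i. \<bar>x $ i\<bar> \<le> real m}"
    by (intro closed_Collect_all closed_Collect_le continuous_intros)
  then have "cut_pt s m n \<in> borel_measurable borel"
    unfolding cut_pt_def using borel_measurable_lattice_pt[of s n]
    by (intro measurable_If) (auto intro: borel_closed)
  then show "cut_pt s m n \<in> borel_measurable lebesgue"
    by (intro measurable_completion) simp
next
  define B where "B = Max (range (\<lambda>i. (m + 1) * 2 ^ (n * s i)))"
  have "cut_pt s m n x \<in> insert 0 {y \<in> lattice_pts s n. \<forall>i. \<bar>y $ i\<bar> \<le> real B / 2 ^ (n * s i)}" for x
  proof (cases "\<forall>i. \<bar>x $ i\<bar> \<le> real m")
    case True
    then have cut: "cut_pt s m n x = lattice_pt s n x"
      by (simp add: cut_pt_def)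
    have "\<bar>lattice_pt s n x $ i\<bar> \<le> real B / 2 ^ (n * s i)" for i
    proof -
      have "x $ i < lattice_pt s n x $ i + 1 / 2 ^ (n * s i)" "lattice_pt s n x $ i \<le> x $ i"
        using in_cell_lattice_pt[of x s n] by (auto simp: cell_def)
      moreover have "1 / 2 ^ (n * s i) \<le> (1::real)"
        by simp
      moreover have "\<bar>x $ i\<bar> \<le> real m"
        using True by simp
      ultimately have "\<bar>lattice_pt s n x $ i\<bar> \<le> real (m + 1)"
        by linarith
      moreover have "(m + 1) * 2 ^ (n * s i) \<le> B"
        unfolding B_def by (intro Max_ge) auto
      then have "real ((m + 1) * 2 ^ (n * s i)) \<le> real B"
        by (simp only: of_nat_le_iff)
      then have "real (m + 1) \<le> real B / 2 ^ (n * s i)"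
        by (simp add: le_divide_eq algebra_simps)
      ultimately show ?thesis
        by linarith
    qed
    then show ?thesis
      using lattice_pt_in cut by auto
  next
    case False
    then have "cut_pt s m n x = 0"
      unfolding cut_pt_def by (rule if_not_P)
    then show ?thesis
      by simp
  qed
  then have "cut_pt s m n ` space lebesgue
      \<subseteq> insert 0 {y \<in> lattice_pts s n. \<forall>i. \<bar>y $ i\<bar> \<le> real B / 2 ^ (n * s i)}"
    by (intro image_subsetI)
  then show "finite (cut_pt s m n ` space lebesgue)"
    by (rule finite_subset) (simp add: lattice_pts_bounded_finite)
qed

lemma eventually_cut_pt: "\<forall>\<^sub>F m in sequentially. \<forall>n. cut_pt s m n x = lattice_pt s n x"
proof -
  obtain N where N: "norm x \<le> real N"
    using real_arch_simple by blast
  have "cut_pt s m n x = lattice_pt s n x" if "N \<le> m" for m n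
  proof -
    have "\<bar>x $ i\<bar> \<le> real m" for i
      using component_le_norm_cart[of x i] N that by linarith
    then show ?thesis
      by (simp add: cut_pt_def)
  qed
  then show ?thesis
    unfolding eventually_sequentially by blast
qed

lemma tendsto_cut_pt:
  assumes "scaling s"
  shows "(\<lambda>m. snorm s (x - cut_pt s m m x)) \<longlonglongrightarrow> 0"
proof (rule tendsto_sandwich[of "\<lambda>_. 0"])
  show "\<forall>\<^sub>F m in sequentially. snorm s (x - cut_pt s m m x) \<le> (1 / 2) ^ m"
    using eventually_cut_pt[of s x]
    by eventually_elim (use snorm_lattice_pt[OF assms] in \<open>simp add: power_one_over\<close>)
  show "(\<lambda>m. (1 / 2 :: real) ^ m) \<longlonglongrightarrow> 0"
    by (intro LIMSEQ_power_zero) simp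
qed (auto simp: snorm_nonneg)

text \<open>The cells of level \<open>0\<close> have volume \<open>1\<close>, so a sum over the lattice is an integral.\<close>

lemma Lp_norm_lattice_le:
  fixes s :: "'d::finite \<Rightarrow> nat"
  assumes p: "1 \<le> p" "p < \<infinity>" and le: "\<And>y x. y \<in> lattice_pts s 0 \<Longrightarrow> x \<in> cell s 0 y \<Longrightarrow> a y \<le> H x"
  shows "Lp_norm p (count_space (lattice_pts s 0)) a \<le> Lp_norm p lebesgue H"
proof -
  define r where "r = enn2real p"
  have r: "0 < r"
    using enn2real_ge_1[of p] p by (auto simp: r_def intro: less_le_trans[of 0 1])
  have box: "box y (y + 1) \<subseteq> cell s 0 y" for y :: "real ^ 'd"
    by (auto simp: cell_def mem_box_cart less_imp_le)
  have sets: "cell s 0 y \<in> sets lebesgue" for y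
  proof -
    have "cell s 0 y = (\<Inter>i. {x. y $ i \<le> x $ i} \<inter> {x. x $ i < y $ i + 1})"
      by (auto simp: cell_def)
    also have "\<dots> \<in> sets borel"
      by (intro sets.finite_INT sets.Int borel_closed borel_open closed_Collect_le open_Collect_less
          continuous_intros) auto
    finally show ?thesis
      by simp
  qed
  have "emeasure lebesgue (box y (y + 1)) = 1" for y :: "real ^ 'd"
  proof -
    have "(\<Prod>b\<in>Basis. ((y + 1) - y) \<bullet> (b :: real ^ 'd)) = 1"
      by (intro prod.neutral) (auto simp: Basis_vec_def inner_axis)
    moreover have "emeasure lborel (box y (y + 1)) = ennreal (\<Prod>b\<in>Basis. ((y + 1) - y) \<bullet> b)"
      by (rule emeasure_lborel_box) (auto simp: Basis_vec_def inner_axis)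
    ultimately show ?thesis
      by simp
  qed
  then have vol: "1 \<le> emeasure lebesgue (cell s 0 y)" for y
    using emeasure_mono[OF box sets] by metis
  have "(\<integral>\<^sup>+y. epow (a y) r \<partial>count_space (lattice_pts s 0))
      \<le> (\<integral>\<^sup>+y. (\<integral>\<^sup>+x. epow (a y) r * indicator (cell s 0 y) x \<partial>lebesgue) \<partial>count_space (lattice_pts s 0))"
  proof (intro nn_integral_mono)
    fix y
    have "epow (a y) r * 1 \<le> epow (a y) r * emeasure lebesgue (cell s 0 y)"
      by (intro mult_left_mono vol) auto
    then show "epow (a y) r \<le> (\<integral>\<^sup>+x. epow (a y) r * indicator (cell s 0 y) x \<partial>lebesgue)"
      by (simp only: nn_integral_cmult_indicator[OF sets] mult_1_right)
  qed
  also have "\<dots> = (\<integral>\<^sup>+x. (\<integral>\<^sup>+y. epow (a y) r * indicator (cell s 0 y) x \<partial>count_space (lattice_pts s 0)) \<partial>lebesgue)"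
    using sets by (intro nn_integral_count_space_nn_integral[symmetric] countable_lattice_pts
        borel_measurable_times_ennreal borel_measurable_indicator) auto
  also have "\<dots> \<le> (\<integral>\<^sup>+x. epow (H x) r \<partial>lebesgue)"
  proof (intro nn_integral_mono)
    fix x
    have "(\<integral>\<^sup>+y. epow (a y) r * indicator (cell s 0 y) x \<partial>count_space (lattice_pts s 0))
        = (\<Sum>y\<in>{lattice_pt s 0 x}. epow (a y) r * indicator (cell s 0 y) x)"
      by (rule nn_integral_count_space') (auto simp: in_cell_iff lattice_pt_in indicator_def)
    also have "\<dots> \<le> epow (H x) r"
      using r by (auto simp: in_cell_lattice_pt intro!: epow_mono le lattice_pt_in)
    finally show "(\<integral>\<^sup>+y. epow (a y) r * indicator (cell s 0 y) x \<partial>count_space (lattice_pts s 0)) \<le> epow (H x) r" .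
  qed
  finally show ?thesis
    using p r by (auto simp: Lp_norm_def r_def intro!: epow_mono)
qed

section \<open>Translations and products of Lebesgue measure\<close>

lemma nn_integral_lebesgue_translation:
  fixes F :: "'a::euclidean_space \<Rightarrow> ennreal"
  assumes "F \<in> borel_measurable lebesgue"
  shows "(\<integral>\<^sup>+h. F (w + h) \<partial>lebesgue) = (\<integral>\<^sup>+z. F z \<partial>lebesgue)"
proof -
  have id: "(\<lambda>x. w + (\<Sum>j\<in>Basis. (1 * (x \<bullet> j)) *\<^sub>R j)) = (\<lambda>x::'a. w + x)"
    by (simp add: euclidean_representation)
  have "(\<lambda>x. w + x) \<in> lebesgue \<rightarrow>\<^sub>M lebesgue" "lebesgue = distr lebesgue lebesgue (\<lambda>x. w + x)"
    using lebesgue_affine_measurable[of "\<lambda>_. 1" w] lebesgue_affine_euclidean[of "\<lambda>_. 1" w]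
    unfolding id by (simp_all add: density_1)
  then show ?thesis
    using assms nn_integral_distr[of "\<lambda>x. w + x" lebesgue lebesgue F] by simp
qed

lemma sigma_finite_lebesgue: "sigma_finite_measure (lebesgue :: 'a::euclidean_space measure)"
proof -
  obtain A :: "'a set set" where "countable A" "A \<subseteq> sets lborel" "\<Union>A = space lborel" "\<forall>a\<in>A. emeasure lborel a \<noteq> \<infinity>"
    using lborel.sigma_finite_countable by metis
  then show ?thesis
    by (intro sigma_finite_measure.intro exI[of _ A]) (auto simp: subset_iff)
qed

lemma simple_function_fst:
  "simple_function M u \<Longrightarrow> simple_function (M \<Otimes>\<^sub>M N) (\<lambda>p. u (fst p))"
  and simple_function_snd:
  "simple_function N v \<Longrightarrow> simple_function (M \<Otimes>\<^sub>M N) (\<lambda>p. v (snd p))"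
proof -
  assume u: "simple_function M u"
  have "(\<lambda>p. u (fst p)) ` space (M \<Otimes>\<^sub>M N) \<subseteq> u ` space M"
    by (auto simp: space_pair_measure)
  then show "simple_function (M \<Otimes>\<^sub>M N) (\<lambda>p. u (fst p))"
    using u measurable_compose[OF measurable_fst, of u M "count_space UNIV" N]
    by (auto simp: simple_function_eq_measurable intro: finite_subset)
next
  assume v: "simple_function N v"
  have "(\<lambda>p. v (snd p)) ` space (M \<Otimes>\<^sub>M N) \<subseteq> v ` space N"
    by (auto simp: space_pair_measure)
  then show "simple_function (M \<Otimes>\<^sub>M N) (\<lambda>p. v (snd p))"
    using v measurable_compose[OF measurable_snd, of v N "count_space UNIV" M]
    by (auto simp: simple_function_eq_measurable intro: finite_subset)
qed

lemma borel_measurable_lebesgue_AE_eq: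
  fixes F :: "'a::euclidean_space \<Rightarrow> 'c::topological_space"
  assumes F: "F \<in> borel_measurable lebesgue" and AE: "AE x in lebesgue. F x = G x"
  shows "G \<in> borel_measurable lebesgue"
proof (rule measurableI)
  obtain N where N: "N \<in> null_sets lebesgue" "\<And>x. x \<notin> N \<Longrightarrow> F x = G x"
    using AE unfolding completion.AE_iff_null_sets by auto
  fix B :: "'c set" assume B: "B \<in> sets borel"
  have "G -` B \<inter> space lebesgue = (F -` B \<inter> space lebesgue - N) \<union> (G -` B \<inter> N)"
    using N(2) by auto
  moreover have "G -` B \<inter> N \<in> null_sets lebesgue"
    using N(1) by (rule completion.complete2[rotated]) auto
  moreover have "F -` B \<inter> space lebesgue \<in> sets lebesgue"
    using F B by (rule measurable_sets)
  ultimately show "G -` B \<inter> space lebesgue \<in> sets lebesgue"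
    using null_setsD2[OF N(1)] null_setsD2 by (simp only:) (intro sets.Un sets.Diff)
qed simp

section \<open>The reexpansion maps of a model\<close>

text \<open>Below, \<open>B\<close> is the finite set of degrees less than \<open>\<gamma>\<close>, and \<open>T\<close> is the sector of all elements with
  components of these degrees only. It is invariant under reexpansion.\<close>

locale model_on_sector =
  fixes s :: "'d::finite \<Rightarrow> nat"
    and A :: "real set"
    and V :: "real \<Rightarrow> 'b::banach set"
    and G :: "((real \<Rightarrow> 'b) \<Rightarrow> (real \<Rightarrow> 'b)) set"
    and P :: "real ^ 'd \<Rightarrow> (real \<Rightarrow> 'b) \<Rightarrow> (real ^ 'd \<Rightarrow> real) \<Rightarrow> real"
    and \<Gamma> :: "real ^ 'd \<Rightarrow> real ^ 'd \<Rightarrow> (real \<Rightarrow> 'b) \<Rightarrow> (real \<Rightarrow> 'b)"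
    and \<gamma> :: real
  assumes scaling: "scaling s"
    and reg_structure: "regularity_structure A V G"
    and model: "model s A V G P \<Gamma>"
    and gamma_pos: "\<gamma> > 0"
begin

abbreviation B :: "real set" where "B \<equiv> below A \<gamma>"

abbreviation T :: "(real \<Rightarrow> 'b) set" where "T \<equiv> direct_sum V B"

lemma finite_B: "finite B"
proof -
  obtain m where "\<And>\<zeta>. \<zeta> \<in> A \<Longrightarrow> m \<le> \<zeta>"
    using reg_structure unfolding regularity_structure_def bdd_below_def by auto
  then have "B \<subseteq> A \<inter> {m..\<gamma>}"
    by (auto simp: below_def)
  then show ?thesis
    using reg_structure finite_subset unfolding regularity_structure_def by blast
qed

lemma B_lt: "\<zeta> \<in> B \<Longrightarrow> \<zeta> < \<gamma>"
  by (simp add: below_def)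

lemma B_subset: "\<zeta> \<in> B \<Longrightarrow> \<zeta> \<in> A"
  by (simp add: below_def)

lemma subspace_V: "\<zeta> \<in> A \<Longrightarrow> subspace (V \<zeta>)" and closed_V: "\<zeta> \<in> A \<Longrightarrow> closed (V \<zeta>)"
  using reg_structure unfolding regularity_structure_def by auto

lemma T_iff: "\<tau> \<in> T \<longleftrightarrow> (\<forall>\<zeta>\<in>B. \<tau> \<zeta> \<in> V \<zeta>) \<and> (\<forall>\<zeta>. \<zeta> \<notin> B \<longrightarrow> \<tau> \<zeta> = 0)"
proof
  assume "\<tau> \<in> T"
  then show "(\<forall>\<zeta>\<in>B. \<tau> \<zeta> \<in> V \<zeta>) \<and> (\<forall>\<zeta>. \<zeta> \<notin> B \<longrightarrow> \<tau> \<zeta> = 0)"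
    using subspace_0[OF subspace_V[OF B_subset]] unfolding direct_sum_def by (auto, metis)
next
  assume *: "(\<forall>\<zeta>\<in>B. \<tau> \<zeta> \<in> V \<zeta>) \<and> (\<forall>\<zeta>. \<zeta> \<notin> B \<longrightarrow> \<tau> \<zeta> = 0)"
  then have "{\<zeta>. \<tau> \<zeta> \<noteq> 0} \<subseteq> B"
    by auto
  then show "\<tau> \<in> T"
    using * finite_subset[OF _ finite_B] unfolding direct_sum_def by auto
qed

lemma T_subset: "T \<subseteq> direct_sum V A"
  by (auto simp: direct_sum_def below_def)

lemma T_lincomb: "\<sigma> \<in> T \<Longrightarrow> \<tau> \<in> T \<Longrightarrow> (\<lambda>\<zeta>. a *\<^sub>R \<sigma> \<zeta> + b *\<^sub>R \<tau> \<zeta>) \<in> T"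
  unfolding T_iff using subspace_V[OF B_subset] by (auto intro!: subspace_add subspace_scale)

lemma T_diff: "\<sigma> \<in> T \<Longrightarrow> \<tau> \<in> T \<Longrightarrow> (\<lambda>\<zeta>. \<sigma> \<zeta> - \<tau> \<zeta>) \<in> T"
  using T_lincomb[of \<sigma> \<tau> 1 "-1"] by simp

lemma homog_in_T: "\<zeta> \<in> B \<Longrightarrow> t \<in> V \<zeta> \<Longrightarrow> homog \<zeta> t \<in> T"
  unfolding T_iff homog_def using subspace_0[OF subspace_V[OF B_subset]] by auto

lemma model_reexpansion:
  "\<forall>x y. \<Gamma> x y \<in> G"
  "\<forall>x. \<forall>\<tau>\<in>direct_sum V A. \<Gamma> x x \<tau> = \<tau>"
  "\<forall>x y z. \<forall>\<tau>\<in>direct_sum V A. \<Gamma> x z (\<Gamma> z y \<tau>) = \<Gamma> x y \<tau>"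
  "\<exists>C. \<forall>x. \<forall>y\<in>Qbox s x 1. \<forall>\<zeta>\<in>B. \<forall>t\<in>V \<zeta>. \<forall>\<beta>\<in>A. \<beta> \<le> \<zeta> \<longrightarrow>
     norm (\<Gamma> x y (homog \<zeta> t) \<beta>) \<le> C * norm t * rpow (snorm s (x - y)) (\<zeta> - \<beta>)"
  using model gamma_pos unfolding model_def by simp_all

lemma Gamma_in_G: "\<Gamma> x y \<in> G"
  using model_reexpansion(1) by simp

lemma Gamma_lincomb:
  assumes "\<sigma> \<in> T" "\<tau> \<in> T"
  shows "\<Gamma> x y (\<lambda>\<zeta>. a *\<^sub>R \<sigma> \<zeta> + b *\<^sub>R \<tau> \<zeta>) = (\<lambda>\<zeta>. a *\<^sub>R \<Gamma> x y \<sigma> \<zeta> + b *\<^sub>R \<Gamma> x y \<tau> \<zeta>)"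
  using reg_structure Gamma_in_G[of x y] assms T_subset
  unfolding regularity_structure_def linear_map_on_def by blast

lemma Gamma_diff:
  assumes "\<sigma> \<in> T" "\<tau> \<in> T"
  shows "\<Gamma> x y (\<lambda>\<zeta>. \<sigma> \<zeta> - \<tau> \<zeta>) = (\<lambda>\<zeta>. \<Gamma> x y \<sigma> \<zeta> - \<Gamma> x y \<tau> \<zeta>)"
  using Gamma_lincomb[OF assms, of x y 1 "-1"] by simp

lemma Gamma_refl: "\<tau> \<in> T \<Longrightarrow> \<Gamma> x x \<tau> = \<tau>"
  using model_reexpansion(2) T_subset by blast

lemma Gamma_trans: "\<tau> \<in> T \<Longrightarrow> \<Gamma> x z (\<Gamma> z y \<tau>) = \<Gamma> x y \<tau>"
  using model_reexpansion(3) T_subset by blast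

lemma Gamma_homog:
  assumes "\<zeta> \<in> B" "t \<in> V \<zeta>"
  shows "\<Gamma> x y (homog \<zeta> t) \<zeta> = t"
    and "\<beta> \<noteq> \<zeta> \<Longrightarrow> \<not> (\<beta> \<in> A \<and> \<beta> < \<zeta>) \<Longrightarrow> \<Gamma> x y (homog \<zeta> t) \<beta> = 0"
    and "\<beta> \<in> B \<Longrightarrow> \<Gamma> x y (homog \<zeta> t) \<beta> \<in> V \<beta>"
proof -
  have *: "(\<lambda>\<beta>. \<Gamma> x y (homog \<zeta> t) \<beta> - homog \<zeta> t \<beta>) \<in> direct_sum V (below A \<zeta>)"
    using reg_structure Gamma_in_G[of x y] assms B_subset unfolding regularity_structure_def by blast
  have low: "\<Gamma> x y (homog \<zeta> t) \<beta> - homog \<zeta> t \<beta> = 0 \<or>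
      \<beta> \<in> A \<and> \<beta> < \<zeta> \<and> \<Gamma> x y (homog \<zeta> t) \<beta> - homog \<zeta> t \<beta> \<in> V \<beta>" for \<beta>
    using * by (auto simp: direct_sum_def below_def)
  show "\<Gamma> x y (homog \<zeta> t) \<zeta> = t"
    using low[of \<zeta>] by (simp add: homog_def)
  show "\<beta> \<noteq> \<zeta> \<Longrightarrow> \<not> (\<beta> \<in> A \<and> \<beta> < \<zeta>) \<Longrightarrow> \<Gamma> x y (homog \<zeta> t) \<beta> = 0"
    using low[of \<beta>] by (auto simp: homog_def)
  show "\<Gamma> x y (homog \<zeta> t) \<beta> \<in> V \<beta>" if "\<beta> \<in> B"
    using low[of \<beta>] assms subspace_0[OF subspace_V[OF B_subset[OF that]]]
    by (cases "\<beta> = \<zeta>") (auto simp: homog_def)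
qed

lemma Gamma_expand:
  assumes "\<tau> \<in> T"
  shows "\<Gamma> x y \<tau> \<beta> = (\<Sum>\<zeta>\<in>B. \<Gamma> x y (homog \<zeta> (\<tau> \<zeta>)) \<beta>)"
proof -
  have part: "(\<lambda>\<zeta>. if \<zeta> \<in> F then \<tau> \<zeta> else 0) \<in> T" for F
    using assms subspace_0[OF subspace_V[OF B_subset]] by (simp add: T_iff)
  have "\<Gamma> x y (\<lambda>\<zeta>. if \<zeta> \<in> F then \<tau> \<zeta> else 0) \<beta> = (\<Sum>\<zeta>\<in>F. \<Gamma> x y (homog \<zeta> (\<tau> \<zeta>)) \<beta>)"
    if "F \<subseteq> B" for F
    using finite_subset[OF that finite_B] that
  proof (induction F)
    case empty
    show ?case
      using fun_cong[OF Gamma_lincomb[OF assms assms, of x y 0 0], of \<beta>] by simp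
  next
    case (insert k F)
    then have k: "homog k (\<tau> k) \<in> T"
      using assms by (auto simp: T_iff intro!: homog_in_T[unfolded T_iff])
    have "(\<lambda>\<zeta>. if \<zeta> \<in> insert k F then \<tau> \<zeta> else 0)
        = (\<lambda>\<zeta>. 1 *\<^sub>R homog k (\<tau> k) \<zeta> + 1 *\<^sub>R (if \<zeta> \<in> F then \<tau> \<zeta> else 0))"
      using insert.hyps by (auto simp: fun_eq_iff homog_def)
    then show ?case
      using insert by (simp only: Gamma_lincomb[OF k part]) simp
  qed
  moreover have "(\<lambda>\<zeta>. if \<zeta> \<in> B then \<tau> \<zeta> else 0) = \<tau>"
    using assms by (auto simp: fun_eq_iff T_iff)
  ultimately show ?thesis
    by (metis subset_refl)
qed

lemma Gamma_in_T:
  assumes "\<tau> \<in> T"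
  shows "\<Gamma> x y \<tau> \<in> T"
  unfolding T_iff
proof (intro conjI ballI allI impI)
  have \<tau>: "\<tau> \<zeta> \<in> V \<zeta>" if "\<zeta> \<in> B" for \<zeta>
    using assms that by (simp add: T_iff)
  fix \<beta>
  {
    assume "\<beta> \<in> B"
    then show "\<Gamma> x y \<tau> \<beta> \<in> V \<beta>"
      unfolding Gamma_expand[OF assms]
      by (intro subspace_sum subspace_V B_subset Gamma_homog(3) \<tau>)
  next
    assume "\<beta> \<notin> B"
    then have "\<Gamma> x y (homog \<zeta> (\<tau> \<zeta>)) \<beta> = 0" if "\<zeta> \<in> B" for \<zeta>
      using that \<tau>[OF that] by (intro Gamma_homog(2)) (auto simp: below_def)
    then show "\<Gamma> x y \<tau> \<beta> = 0"
      unfolding Gamma_expand[OF assms] by simp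
  }
qed

subsection \<open>Bounds\<close>

text \<open>Reexpansion preserves the component of the highest degree and changes the component of degree
  \<open>\<beta>\<close> only through components of degree \<open>\<zeta> > \<beta>\<close>, with a positive power of the distance. In this
  form the bound yields both the uniform bounds and the continuity of \<open>\<Gamma>\<close>.\<close>

lemma Gamma_bound_exists:
  "\<exists>C\<ge>0. \<forall>x y \<tau> \<beta>. snorm s (x - y) \<le> 1 \<longrightarrow> \<tau> \<in> T \<longrightarrow> \<beta> \<in> B \<longrightarrow>
     norm (\<Gamma> x y \<tau> \<beta> - \<tau> \<beta>) \<le> C * (\<Sum>\<zeta>\<in>{\<zeta>\<in>B. \<beta> < \<zeta>}. norm (\<tau> \<zeta>) * snorm s (x - y) powr (\<zeta> - \<beta>))"
proof -
  obtain C where "\<forall>x. \<forall>y\<in>Qbox s x 1. \<forall>\<zeta>\<in>B. \<forall>t\<in>V \<zeta>. \<forall>\<beta>\<in>A. \<beta> \<le> \<zeta> \<longrightarrow>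
      norm (\<Gamma> x y (homog \<zeta> t) \<beta>) \<le> C * norm t * rpow (snorm s (x - y)) (\<zeta> - \<beta>)"
    using model_reexpansion(4) by (rule exE) (rule that)
  then have C: "norm (\<Gamma> x y (homog \<zeta> t) \<beta>) \<le> C * norm t * snorm s (x - y) powr (\<zeta> - \<beta>)"
    if "snorm s (x - y) \<le> 1" "\<zeta> \<in> B" "t \<in> V \<zeta>" "\<beta> \<in> B" "\<beta> < \<zeta>" for x y \<zeta> t \<beta>
  proof -
    have "y \<in> Qbox s x 1" "rpow (snorm s (x - y)) (\<zeta> - \<beta>) = snorm s (x - y) powr (\<zeta> - \<beta>)"
      using that by (auto simp: mem_Qbox snorm_commute[of s y x] rpow_def)
    with that B_subset[OF that(4)] \<open>\<forall>x. _\<close> show ?thesis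
      by (metis less_imp_le)
  qed
  have "norm (\<Gamma> x y \<tau> \<beta> - \<tau> \<beta>)
      \<le> \<bar>C\<bar> * (\<Sum>\<zeta>\<in>{\<zeta>\<in>B. \<beta> < \<zeta>}. norm (\<tau> \<zeta>) * snorm s (x - y) powr (\<zeta> - \<beta>))"
    if xy: "snorm s (x - y) \<le> 1" and \<tau>: "\<tau> \<in> T" and \<beta>: "\<beta> \<in> B" for x y \<tau> \<beta>
  proof -
    have \<tau>V: "\<tau> \<zeta> \<in> V \<zeta>" if "\<zeta> \<in> B" for \<zeta>
      using \<tau> that by (simp add: T_iff)
    have "\<Gamma> x y \<tau> \<beta> = \<Gamma> x y (homog \<beta> (\<tau> \<beta>)) \<beta> + (\<Sum>\<zeta>\<in>B - {\<beta>}. \<Gamma> x y (homog \<zeta> (\<tau> \<zeta>)) \<beta>)"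
      unfolding Gamma_expand[OF \<tau>] using finite_B \<beta> by (rule sum.remove)
    also have "(\<Sum>\<zeta>\<in>B - {\<beta>}. \<Gamma> x y (homog \<zeta> (\<tau> \<zeta>)) \<beta>)
        = (\<Sum>\<zeta>\<in>{\<zeta>\<in>B. \<beta> < \<zeta>}. \<Gamma> x y (homog \<zeta> (\<tau> \<zeta>)) \<beta>)"
      using finite_B by (intro sum.mono_neutral_right) (auto intro!: Gamma_homog(2) \<tau>V)
    finally have "norm (\<Gamma> x y \<tau> \<beta> - \<tau> \<beta>) = norm (\<Sum>\<zeta>\<in>{\<zeta>\<in>B. \<beta> < \<zeta>}. \<Gamma> x y (homog \<zeta> (\<tau> \<zeta>)) \<beta>)"
      using Gamma_homog(1)[OF \<beta> \<tau>V[OF \<beta>], of x y] by simp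
    also have "\<dots> \<le> (\<Sum>\<zeta>\<in>{\<zeta>\<in>B. \<beta> < \<zeta>}. \<bar>C\<bar> * (norm (\<tau> \<zeta>) * snorm s (x - y) powr (\<zeta> - \<beta>)))"
    proof (intro sum_norm_le)
      fix \<zeta> assume "\<zeta> \<in> {\<zeta> \<in> B. \<beta> < \<zeta>}"
      then have "norm (\<Gamma> x y (homog \<zeta> (\<tau> \<zeta>)) \<beta>) \<le> C * (norm (\<tau> \<zeta>) * snorm s (x - y) powr (\<zeta> - \<beta>))"
        using C[OF xy _ \<tau>V \<beta>, of \<zeta>] by (simp add: mult.assoc)
      also have "\<dots> \<le> \<bar>C\<bar> * (norm (\<tau> \<zeta>) * snorm s (x - y) powr (\<zeta> - \<beta>))"
        by (intro mult_right_mono) auto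
      finally show "norm (\<Gamma> x y (homog \<zeta> (\<tau> \<zeta>)) \<beta>) \<le> \<bar>C\<bar> * (norm (\<tau> \<zeta>) * snorm s (x - y) powr (\<zeta> - \<beta>))" .
    qed
    finally show ?thesis
      by (simp add: sum_distrib_left)
  qed
  then show ?thesis
    by (intro exI[of _ "\<bar>C\<bar>"]) auto
qed

text \<open>The norm on \<open>T\<close> adapted to the scale \<open>2\<^sup>-\<^sup>n\<close>: the component of degree \<open>\<zeta>\<close> has weight
  \<open>2 powr (n * (\<gamma> - \<zeta>))\<close>, as in the norms of modelled distributions. For these norms the
  reexpansion maps over distances up to \<open>2\<^sup>-\<^sup>n\<close> are bounded uniformly in \<open>n\<close>.\<close>

definition wnorm :: "nat \<Rightarrow> (real \<Rightarrow> 'b) \<Rightarrow> real" where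
  "wnorm n \<tau> = (\<Sum>\<zeta>\<in>B. 2 powr (real n * (\<gamma> - \<zeta>)) * norm (\<tau> \<zeta>))"

lemma wnorm_nonneg: "0 \<le> wnorm n \<tau>"
  unfolding wnorm_def by (intro sum_nonneg) auto

lemma component_le_wnorm: "\<zeta> \<in> B \<Longrightarrow> 2 powr (real n * (\<gamma> - \<zeta>)) * norm (\<tau> \<zeta>) \<le> wnorm n \<tau>"
  unfolding wnorm_def using finite_B by (intro member_le_sum) auto

lemma wnorm_triangle: "wnorm n (\<lambda>\<zeta>. \<sigma> \<zeta> - \<tau> \<zeta>) \<le> wnorm n \<sigma> + wnorm n \<tau>"
  unfolding wnorm_def sum.distrib[symmetric] distrib_left[symmetric]
  by (intro sum_mono mult_left_mono norm_triangle_ineq4) auto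

lemma wnorm_mono: "m \<le> n \<Longrightarrow> wnorm m \<tau> \<le> wnorm n \<tau>"
  unfolding wnorm_def
  by (intro sum_mono mult_right_mono powr_mono) (auto simp: less_imp_le[OF B_lt])

text \<open>The power \<open>\<zeta> - \<beta>\<close> of a distance at most \<open>2\<^sup>-\<^sup>n\<close> makes up for the ratio of the weights of the
  degrees \<open>\<beta>\<close> and \<open>\<zeta>\<close>.\<close>

lemma Gamma_wnorm_exists:
  "\<exists>C\<ge>1. \<forall>n x y \<tau>. snorm s (x - y) \<le> 1 / 2 ^ n \<longrightarrow> \<tau> \<in> T \<longrightarrow> wnorm n (\<Gamma> x y \<tau>) \<le> C * wnorm n \<tau>"
proof -
  obtain C where C: "0 \<le> C" "\<And>x y \<tau> \<beta>. snorm s (x - y) \<le> 1 \<Longrightarrow> \<tau> \<in> T \<Longrightarrow> \<beta> \<in> B \<Longrightarrow>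
      norm (\<Gamma> x y \<tau> \<beta> - \<tau> \<beta>) \<le> C * (\<Sum>\<zeta>\<in>{\<zeta>\<in>B. \<beta> < \<zeta>}. norm (\<tau> \<zeta>) * snorm s (x - y) powr (\<zeta> - \<beta>))"
    using Gamma_bound_exists by blast
  have one: "2 powr (real n * (\<gamma> - \<beta>)) * norm (\<Gamma> x y \<tau> \<beta>) \<le> (1 + C) * wnorm n \<tau>"
    if xy: "snorm s (x - y) \<le> 1 / 2 ^ n" and \<tau>: "\<tau> \<in> T" and \<beta>: "\<beta> \<in> B" for n x y \<tau> \<beta>
  proof -
    let ?c = "2 powr (real n * (\<gamma> - \<beta>))"
    have "1 / 2 ^ n \<le> (1::real)"
      by simp
    then have xy1: "snorm s (x - y) \<le> 1"
      using xy by linarith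
    have "?c * (norm (\<tau> \<zeta>) * snorm s (x - y) powr (\<zeta> - \<beta>)) \<le> 2 powr (real n * (\<gamma> - \<zeta>)) * norm (\<tau> \<zeta>)"
      if "\<beta> < \<zeta>" for \<zeta>
    proof -
      have "(1 / 2 ^ n) powr (\<zeta> - \<beta>) = 2 powr (- (real n * (\<zeta> - \<beta>)))"
        by (simp add: powr_powr powr_divide powr_minus_divide flip: powr_realpow)
      moreover have "snorm s (x - y) powr (\<zeta> - \<beta>) \<le> (1 / 2 ^ n) powr (\<zeta> - \<beta>)"
        using xy that by (intro powr_mono2) (auto simp: snorm_nonneg)
      ultimately have "?c * (norm (\<tau> \<zeta>) * snorm s (x - y) powr (\<zeta> - \<beta>))
          \<le> ?c * (norm (\<tau> \<zeta>) * 2 powr (- (real n * (\<zeta> - \<beta>))))"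
        by (intro mult_left_mono) auto
      also have "\<dots> = 2 powr (real n * (\<gamma> - \<beta>) + - (real n * (\<zeta> - \<beta>))) * norm (\<tau> \<zeta>)"
        by (simp only: powr_add) simp
      also have "real n * (\<gamma> - \<beta>) + - (real n * (\<zeta> - \<beta>)) = real n * (\<gamma> - \<zeta>)"
        by (simp add: algebra_simps)
      finally show ?thesis .
    qed
    then have "?c * (\<Sum>\<zeta>\<in>{\<zeta>\<in>B. \<beta> < \<zeta>}. norm (\<tau> \<zeta>) * snorm s (x - y) powr (\<zeta> - \<beta>))
        \<le> (\<Sum>\<zeta>\<in>{\<zeta>\<in>B. \<beta> < \<zeta>}. 2 powr (real n * (\<gamma> - \<zeta>)) * norm (\<tau> \<zeta>))"
      unfolding sum_distrib_left by (intro sum_mono) auto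
    also have "\<dots> \<le> wnorm n \<tau>"
      unfolding wnorm_def using finite_B by (intro sum_mono2) auto
    finally have high: "?c * (\<Sum>\<zeta>\<in>{\<zeta>\<in>B. \<beta> < \<zeta>}. norm (\<tau> \<zeta>) * snorm s (x - y) powr (\<zeta> - \<beta>)) \<le> wnorm n \<tau>" .
    have "norm (\<Gamma> x y \<tau> \<beta>) \<le> norm (\<tau> \<beta>) + norm (\<Gamma> x y \<tau> \<beta> - \<tau> \<beta>)"
      by (rule norm_triangle_sub)
    also have "\<dots> \<le> norm (\<tau> \<beta>) + C * (\<Sum>\<zeta>\<in>{\<zeta>\<in>B. \<beta> < \<zeta>}. norm (\<tau> \<zeta>) * snorm s (x - y) powr (\<zeta> - \<beta>))"
      using C(2)[OF xy1 \<tau> \<beta>] by simp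
    finally have "?c * norm (\<Gamma> x y \<tau> \<beta>) \<le> ?c * (norm (\<tau> \<beta>) +
        C * (\<Sum>\<zeta>\<in>{\<zeta>\<in>B. \<beta> < \<zeta>}. norm (\<tau> \<zeta>) * snorm s (x - y) powr (\<zeta> - \<beta>)))"
      by (rule mult_left_mono) simp
    also have "\<dots> = ?c * norm (\<tau> \<beta>) +
        C * (?c * (\<Sum>\<zeta>\<in>{\<zeta>\<in>B. \<beta> < \<zeta>}. norm (\<tau> \<zeta>) * snorm s (x - y) powr (\<zeta> - \<beta>)))"
      by (simp only: distrib_left mult.left_commute)
    also have "\<dots> \<le> wnorm n \<tau> + C * wnorm n \<tau>"
      using component_le_wnorm[OF \<beta>] high C(1) by (intro add_mono mult_left_mono)
    finally show ?thesis
      by (simp add: algebra_simps)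
  qed
  have "wnorm n (\<Gamma> x y \<tau>) \<le> (1 + real (card B) * (1 + C)) * wnorm n \<tau>"
    if "snorm s (x - y) \<le> 1 / 2 ^ n" "\<tau> \<in> T" for n x y \<tau>
  proof -
    have "wnorm n (\<Gamma> x y \<tau>) \<le> real (card B) * ((1 + C) * wnorm n \<tau>)"
      unfolding wnorm_def[of n "\<Gamma> x y \<tau>"] by (intro sum_bounded_above one that)
    then show ?thesis
      using wnorm_nonneg[of n \<tau>] by (simp add: algebra_simps)
  qed
  then show ?thesis
    using C(1) by (intro exI[of _ "1 + real (card B) * (1 + C)"]) auto
qed

text \<open>Between two distant points, reexpand along a segment in steps of bounded length.\<close>

lemma Gamma_bounded:
  "\<exists>K. \<forall>\<tau>\<in>T. wnorm 0 (\<Gamma> x y \<tau>) \<le> K * wnorm 0 \<tau>"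
proof -
  obtain C where C: "1 \<le> C" "\<And>x y \<tau>. snorm s (x - y) \<le> 1 \<Longrightarrow> \<tau> \<in> T \<Longrightarrow> wnorm 0 (\<Gamma> x y \<tau>) \<le> C * wnorm 0 \<tau>"
    using Gamma_wnorm_exists by (metis div_by_1 power_0)
  have chain: "\<forall>\<tau>\<in>T. wnorm 0 (\<Gamma> x y \<tau>) \<le> C ^ N * wnorm 0 \<tau>"
    if "\<And>i. \<bar>x $ i - y $ i\<bar> \<le> real N" for N x y
    using that
  proof (induction N arbitrary: x)
    case 0
    then have "x = y"
      by (simp add: vec_eq_iff)
    then show ?case
      by (simp add: Gamma_refl)
  next
    case (Suc N)
    define m where "m = x + (1 / real (Suc N)) *\<^sub>R (y - x)"
    have "\<bar>(x - m) $ i\<bar> \<le> 1 ^ s i" for i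
    proof -
      have "\<bar>(x - m) $ i\<bar> = \<bar>x $ i - y $ i\<bar> / real (Suc N)"
        by (simp add: m_def abs_minus_commute)
      then show ?thesis
        using Suc.prems[of i] by (simp add: divide_le_eq)
    qed
    then have xm: "snorm s (x - m) \<le> 1"
      by (subst snorm_le_iff[OF scaling]) auto
    have my: "\<bar>m $ i - y $ i\<bar> \<le> real N" for i
    proof -
      have "m $ i - y $ i = (x $ i - y $ i) * (real N / real (Suc N))"
        by (simp add: m_def divide_simps) (simp add: algebra_simps)
      then have "\<bar>m $ i - y $ i\<bar> = \<bar>x $ i - y $ i\<bar> * (real N / real (Suc N))"
        by (simp only: abs_mult) simp
      also have "\<dots> \<le> real (Suc N) * (real N / real (Suc N))"
        using Suc.prems[of i] by (intro mult_right_mono) auto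
      finally show ?thesis
        by simp
    qed
    show ?case
    proof
      fix \<tau> assume \<tau>: "\<tau> \<in> T"
      have "wnorm 0 (\<Gamma> x y \<tau>) \<le> C * wnorm 0 (\<Gamma> m y \<tau>)"
        using C(2)[OF xm Gamma_in_T[OF \<tau>, of m y]] by (simp add: Gamma_trans \<tau>)
      also have "\<dots> \<le> C * (C ^ N * wnorm 0 \<tau>)"
        using Suc.IH[OF my] \<tau> C(1) by (intro mult_left_mono) auto
      finally show "wnorm 0 (\<Gamma> x y \<tau>) \<le> C ^ Suc N * wnorm 0 \<tau>"
        by simp
    qed
  qed
  obtain N where N: "norm (x - y) \<le> real N"
    using real_arch_simple by blast
  have "\<bar>x $ i - y $ i\<bar> \<le> real N" for i
    using component_le_norm_cart[of "x - y" i] N by simp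
  then show ?thesis
    using chain by blast
qed

subsection \<open>Continuity\<close>

lemma Gamma_tendsto:
  assumes "\<And>i. \<sigma> i \<in> T" "\<tau> \<in> T" "\<And>\<zeta>. \<zeta> \<in> B \<Longrightarrow> (\<lambda>i. \<sigma> i \<zeta>) \<longlonglongrightarrow> \<tau> \<zeta>"
  shows "(\<lambda>i. \<Gamma> x y (\<sigma> i) \<beta>) \<longlonglongrightarrow> \<Gamma> x y \<tau> \<beta>"
proof (cases "\<beta> \<in> B")
  case True
  obtain K where K: "\<And>\<tau>. \<tau> \<in> T \<Longrightarrow> wnorm 0 (\<Gamma> x y \<tau>) \<le> K * wnorm 0 \<tau>"
    using Gamma_bounded by blast
  have "(\<lambda>i. \<Gamma> x y (\<sigma> i) \<beta> - \<Gamma> x y \<tau> \<beta>) \<longlonglongrightarrow> 0"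
  proof (rule Lim_null_comparison)
    have "norm (\<Gamma> x y (\<sigma> i) \<beta> - \<Gamma> x y \<tau> \<beta>) \<le> K * wnorm 0 (\<lambda>\<zeta>. \<sigma> i \<zeta> - \<tau> \<zeta>)" for i
      using component_le_wnorm[OF True, of 0 "\<Gamma> x y (\<lambda>\<zeta>. \<sigma> i \<zeta> - \<tau> \<zeta>)"]
        K[OF T_diff[OF assms(1,2)], of i] by (simp add: Gamma_diff assms)
    then show "\<forall>\<^sub>F i in sequentially. norm (\<Gamma> x y (\<sigma> i) \<beta> - \<Gamma> x y \<tau> \<beta>) \<le> K * wnorm 0 (\<lambda>\<zeta>. \<sigma> i \<zeta> - \<tau> \<zeta>)"
      by simp
    have "(\<lambda>i. wnorm 0 (\<lambda>\<zeta>. \<sigma> i \<zeta> - \<tau> \<zeta>)) \<longlonglongrightarrow> (\<Sum>\<zeta>\<in>B. 2 powr (real 0 * (\<gamma> - \<zeta>)) * norm (\<tau> \<zeta> - \<tau> \<zeta>))"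
      unfolding wnorm_def by (intro tendsto_intros assms)
    then show "(\<lambda>i. K * wnorm 0 (\<lambda>\<zeta>. \<sigma> i \<zeta> - \<tau> \<zeta>)) \<longlonglongrightarrow> 0"
      by (intro tendsto_mult_right_zero) simp
  qed
  then show ?thesis
    by (simp add: LIM_zero_iff)
next
  case False
  then have "\<Gamma> x y \<sigma> \<beta> = 0" if "\<sigma> \<in> T" for \<sigma>
    using Gamma_in_T[OF that] by (simp add: T_iff)
  then show ?thesis
    using assms by simp
qed

text \<open>The base points and the element vary at the same time, as they do in the approximations of
  \<open>\<Gamma> z w (f w)\<close> below.\<close>

lemma Gamma_tendsto_id:
  assumes \<sigma>: "\<And>i. \<sigma> i \<in> T" and lim: "\<And>\<zeta>. \<zeta> \<in> B \<Longrightarrow> (\<lambda>i. \<sigma> i \<zeta>) \<longlonglongrightarrow> \<tau> \<zeta>"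
    and xy: "(\<lambda>i. snorm s (x i - y i)) \<longlonglongrightarrow> 0" and \<beta>: "\<beta> \<in> B"
  shows "(\<lambda>i. \<Gamma> (x i) (y i) (\<sigma> i) \<beta>) \<longlonglongrightarrow> \<tau> \<beta>"
proof -
  obtain C where C: "0 \<le> C" "\<And>x y \<tau> \<beta>. snorm s (x - y) \<le> 1 \<Longrightarrow> \<tau> \<in> T \<Longrightarrow> \<beta> \<in> B \<Longrightarrow>
      norm (\<Gamma> x y \<tau> \<beta> - \<tau> \<beta>) \<le> C * (\<Sum>\<zeta>\<in>{\<zeta>\<in>B. \<beta> < \<zeta>}. norm (\<tau> \<zeta>) * snorm s (x - y) powr (\<zeta> - \<beta>))"
    using Gamma_bound_exists by blast
  have "(\<lambda>i. \<Gamma> (x i) (y i) (\<sigma> i) \<beta> - \<sigma> i \<beta>) \<longlonglongrightarrow> 0"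
  proof (rule Lim_null_comparison)
    have "\<forall>\<^sub>F i in sequentially. snorm s (x i - y i) < 1"
      using xy by (rule order_tendstoD) simp
    then show "\<forall>\<^sub>F i in sequentially. norm (\<Gamma> (x i) (y i) (\<sigma> i) \<beta> - \<sigma> i \<beta>)
        \<le> C * (\<Sum>\<zeta>\<in>{\<zeta>\<in>B. \<beta> < \<zeta>}. norm (\<sigma> i \<zeta>) * snorm s (x i - y i) powr (\<zeta> - \<beta>))"
      by eventually_elim (intro C(2) \<sigma> \<beta>, simp)
    have "(\<lambda>i. snorm s (x i - y i) powr (\<zeta> - \<beta>)) \<longlonglongrightarrow> 0" if "\<beta> < \<zeta>" for \<zeta>
      using tendsto_powr2[OF xy tendsto_const[of "\<zeta> - \<beta>"]] that by (simp add: snorm_nonneg)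
    then have "(\<lambda>i. C * (\<Sum>\<zeta>\<in>{\<zeta>\<in>B. \<beta> < \<zeta>}. norm (\<sigma> i \<zeta>) * snorm s (x i - y i) powr (\<zeta> - \<beta>)))
        \<longlonglongrightarrow> C * (\<Sum>\<zeta>\<in>{\<zeta>\<in>B. \<beta> < \<zeta>}. norm (\<tau> \<zeta>) * 0)"
      by (intro tendsto_intros lim) auto
    then show "(\<lambda>i. C * (\<Sum>\<zeta>\<in>{\<zeta>\<in>B. \<beta> < \<zeta>}. norm (\<sigma> i \<zeta>) * snorm s (x i - y i) powr (\<zeta> - \<beta>))) \<longlonglongrightarrow> 0"
      by simp
  qed
  from tendsto_add[OF this lim[OF \<beta>]] show ?thesis
    by simp
qed

lemma Gamma_cut_pt_tendsto:
  assumes "\<tau> \<in> T" "\<beta> \<in> B"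
  shows "(\<lambda>i. \<Gamma> (cut_pt s i i x) x \<tau> \<beta>) \<longlonglongrightarrow> \<tau> \<beta>"
proof (rule Gamma_tendsto_id[where \<sigma>="\<lambda>_. \<tau>" and x="\<lambda>i. cut_pt s i i x" and y="\<lambda>_. x", OF assms(1) _ _ assms(2)])
  show "(\<lambda>i. snorm s (cut_pt s i i x - x)) \<longlonglongrightarrow> 0"
    using tendsto_cut_pt[OF scaling, of x] by (simp add: snorm_commute[of s x])
qed simp

subsection \<open>Approximation by simple functions\<close>

text \<open>The simple functions take values in \<open>T\<close>, so that they can be reexpanded.\<close>

lemma simple_approximation_exists:
  assumes f: "\<And>x. f x \<in> T" and meas: "\<And>\<zeta>. \<zeta> \<in> B \<Longrightarrow> strongly_measurable M (\<lambda>x. f x \<zeta>)"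
  obtains U where "\<And>i::nat. simple_function M (U i)" "\<And>i x. U i x \<in> T"
    "AE x in M. \<forall>\<zeta>\<in>B. (\<lambda>i. U i x \<zeta>) \<longlonglongrightarrow> f x \<zeta>"
proof -
  have "\<exists>u. (\<forall>i::nat. simple_function M (u i) \<and> (\<forall>x. u i x \<in> V \<zeta>)) \<and> (AE x in M. (\<lambda>i. u i x) \<longlonglongrightarrow> f x \<zeta>)"
    if \<zeta>: "\<zeta> \<in> B" for \<zeta>
  proof -
    obtain u where u: "\<And>i::nat. simple_function M (u i)" "AE x in M. (\<lambda>i. u i x) \<longlonglongrightarrow> f x \<zeta>"
      by (rule strongly_measurableE[OF meas[OF \<zeta>]]) (rule that)
    have "V \<zeta> \<noteq> {}"
      using f \<zeta> by (auto simp: T_iff)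
    then obtain \<phi> where \<phi>: "\<And>c. \<phi> c \<in> V \<zeta>" "\<And>c w. w \<in> V \<zeta> \<Longrightarrow> norm (\<phi> c - w) \<le> 3 * norm (c - w)"
      using near_projection_exists[OF closed_V[OF B_subset[OF \<zeta>]]] by blast
    have "AE x in M. (\<lambda>i. \<phi> (u i x)) \<longlonglongrightarrow> f x \<zeta>"
      using u(2)
    proof eventually_elim
      case (elim x)
      have "f x \<zeta> \<in> V \<zeta>"
        using f \<zeta> by (simp add: T_iff)
      then have le: "\<forall>\<^sub>F i in sequentially. norm (\<phi> (u i x) - f x \<zeta>) \<le> 3 * norm (u i x - f x \<zeta>)"
        using \<phi>(2) by simp
      have "(\<lambda>i. 3 * norm (u i x - f x \<zeta>)) \<longlonglongrightarrow> 0"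
        using elim by (intro tendsto_mult_right_zero tendsto_norm_zero) (simp add: LIM_zero_iff)
      with le have "(\<lambda>i. \<phi> (u i x) - f x \<zeta>) \<longlonglongrightarrow> 0"
        by (rule Lim_null_comparison)
      then show ?case
        by (simp add: LIM_zero_iff)
    qed
    moreover have "simple_function M (\<lambda>x. \<phi> (u i x))" for i
      by (rule simple_function_compose1[OF u(1)])
    ultimately show ?thesis
      using \<phi>(1) by (intro exI[of _ "\<lambda>i x. \<phi> (u i x)"]) auto
  qed
  then have "\<exists>u. \<forall>\<zeta>\<in>B. (\<forall>i::nat. simple_function M (u \<zeta> i) \<and> (\<forall>x. u \<zeta> i x \<in> V \<zeta>)) \<and>
      (AE x in M. (\<lambda>i. u \<zeta> i x) \<longlonglongrightarrow> f x \<zeta>)"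
    by (intro bchoice ballI)
  then obtain u where *: "\<forall>\<zeta>\<in>B. (\<forall>i::nat. simple_function M (u \<zeta> i) \<and> (\<forall>x. u \<zeta> i x \<in> V \<zeta>)) \<and>
      (AE x in M. (\<lambda>i. u \<zeta> i x) \<longlonglongrightarrow> f x \<zeta>)"
    by (rule exE)
  have u: "simple_function M (u \<zeta> i)" "u \<zeta> i x \<in> V \<zeta>" "AE x in M. (\<lambda>i. u \<zeta> i x) \<longlonglongrightarrow> f x \<zeta>"
    if "\<zeta> \<in> B" for \<zeta> i x
    using bspec[OF * that] by auto
  show ?thesis
  proof (rule that[of "\<lambda>i x \<zeta>. if \<zeta> \<in> B then u \<zeta> i x else 0"])
    show "simple_function M (\<lambda>x \<zeta>. if \<zeta> \<in> B then u \<zeta> i x else 0)" for i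
      by (intro simple_function_finite_family finite_B u(1))
    show "(\<lambda>\<zeta>. if \<zeta> \<in> B then u \<zeta> i x else 0) \<in> T" for i x
      using u(2) by (simp add: T_iff)
    have "AE x in M. \<forall>\<zeta>\<in>B. (\<lambda>i. u \<zeta> i x) \<longlonglongrightarrow> f x \<zeta>"
      using finite_B u(3) by (intro AE_finite_allI)
    then show "AE x in M. \<forall>\<zeta>\<in>B. (\<lambda>i. if \<zeta> \<in> B then u \<zeta> i x else 0) \<longlonglongrightarrow> f x \<zeta>"
      by eventually_elim simp
  qed
qed

text \<open>Replacing the base point by its lattice point makes the function simple, and continuity of
  \<open>\<Gamma>\<close> gives the limit. The same device serves in the lemmas that follow.\<close>

lemma strongly_measurable_Gamma_base:
  assumes "\<tau> \<in> T"
  shows "strongly_measurable lebesgue (\<lambda>z. \<Gamma> z w \<tau> \<beta>)"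
proof (cases "\<beta> \<in> B")
  case True
  have "(\<lambda>i. \<Gamma> (cut_pt s i i z) w \<tau> \<beta>) \<longlonglongrightarrow> \<Gamma> z w \<tau> \<beta>" for z
  proof -
    have "(\<lambda>i. \<Gamma> (cut_pt s i i z) z (\<Gamma> z w \<tau>) \<beta>) \<longlonglongrightarrow> \<Gamma> z w \<tau> \<beta>"
      by (rule Gamma_cut_pt_tendsto[OF Gamma_in_T[OF assms] True])
    then show ?thesis
      by (simp add: Gamma_trans assms)
  qed
  moreover have "simple_function lebesgue (\<lambda>z. \<Gamma> (cut_pt s i i z) w \<tau> \<beta>)" for i
    by (rule simple_function_compose1[OF simple_function_cut_pt])
  ultimately show ?thesis
    unfolding strongly_measurable_def by (intro exI[of _ "\<lambda>i z. \<Gamma> (cut_pt s i i z) w \<tau> \<beta>"]) auto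
next
  case False
  then have "\<Gamma> z w \<tau> \<beta> = 0" for z
    using Gamma_in_T[OF assms] by (simp add: T_iff)
  then show ?thesis
    by (simp add: strongly_measurable_const)
qed

lemma strongly_measurable_Gamma_section:
  assumes f: "\<And>x. f x \<in> T" and meas: "\<And>\<zeta>. \<zeta> \<in> B \<Longrightarrow> strongly_measurable lebesgue (\<lambda>x. f x \<zeta>)"
  shows "strongly_measurable lebesgue (\<lambda>z. \<Gamma> y z (f z) \<beta>)"
proof -
  obtain U where U: "\<And>i::nat. simple_function lebesgue (U i)" "\<And>i x. U i x \<in> T"
    "AE x in lebesgue. \<forall>\<zeta>\<in>B. (\<lambda>i. U i x \<zeta>) \<longlonglongrightarrow> f x \<zeta>"
    using simple_approximation_exists[OF f meas] by blast
  have "AE z in lebesgue. (\<lambda>i. \<Gamma> y (cut_pt s i i z) (U i z) \<beta>) \<longlonglongrightarrow> \<Gamma> y z (f z) \<beta>"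
    using U(3)
  proof eventually_elim
    case (elim z)
    have "(\<lambda>i. \<Gamma> y z (\<Gamma> z (cut_pt s i i z) (U i z)) \<beta>) \<longlonglongrightarrow> \<Gamma> y z (f z) \<beta>"
      using elim by (intro Gamma_tendsto Gamma_tendsto_id Gamma_in_T U(2) f tendsto_cut_pt scaling) auto
    then show ?case
      by (simp add: Gamma_trans U(2))
  qed
  moreover have "simple_function lebesgue (\<lambda>z. \<Gamma> y (cut_pt s i i z) (U i z) \<beta>)" for i
    by (rule simple_function_compose2[OF simple_function_cut_pt U(1)])
  ultimately show ?thesis
    unfolding strongly_measurable_def by (intro exI[of _ "\<lambda>i z. \<Gamma> y (cut_pt s i i z) (U i z) \<beta>"]) auto
qed

lemma strongly_measurable_reconstructed:
  assumes g: "\<And>y. g n y \<in> T" and \<beta>: "\<beta> \<in> B"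
  shows "strongly_measurable lebesgue (\<lambda>x. reconstructed s \<Gamma> g n x \<beta>)"
proof -
  define u where "u = (\<lambda>m x. \<Gamma> (cut_pt s m m x) (cut_pt s m n x) (g n (cut_pt s m n x)) \<beta>)"
  have "(\<lambda>m. u m x) \<longlonglongrightarrow> reconstructed s \<Gamma> g n x \<beta>" for x
  proof -
    let ?y = "lattice_pt s n x"
    have "(\<lambda>m. \<Gamma> (cut_pt s m m x) x (\<Gamma> x ?y (g n ?y)) \<beta>) \<longlonglongrightarrow> \<Gamma> x ?y (g n ?y) \<beta>"
      by (rule Gamma_cut_pt_tendsto[OF Gamma_in_T[OF g] \<beta>])
    moreover have "\<forall>\<^sub>F m in sequentially. \<Gamma> (cut_pt s m m x) x (\<Gamma> x ?y (g n ?y)) \<beta> = u m x"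
      using eventually_cut_pt[of s x] by eventually_elim (simp add: u_def Gamma_trans g)
    ultimately show ?thesis
      unfolding reconstructed_def by (rule Lim_transform_eventually)
  qed
  moreover have "simple_function lebesgue (u m)" for m
    unfolding u_def
    by (rule simple_function_compose2[OF simple_function_cut_pt simple_function_cut_pt, of "\<lambda>a b. \<Gamma> a b (g n b) \<beta>"])
  ultimately show ?thesis
    unfolding strongly_measurable_def by auto
qed

section \<open>Oscillation at dyadic scales\<close>

text \<open>The radius \<open>3 / 2 ^ n\<close> covers every averaging box of radius \<open>1 / 2 ^ n\<close> around a point within
  \<open>2 / 2 ^ n\<close> of \<open>w\<close>. The integral is normalised by the volume of an averaging box.\<close>

definition osc :: "(real ^ 'd \<Rightarrow> real \<Rightarrow> 'b) \<Rightarrow> nat \<Rightarrow> real \<Rightarrow> real ^ 'd \<Rightarrow> ennreal" where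
  "osc f n \<beta> w =
     (\<integral>\<^sup>+z\<in>Qbox s w (3 / 2 ^ n). ennreal (2 powr (real n * (\<gamma> - \<beta>)) * norm (f z \<beta> - \<Gamma> z w (f w) \<beta>)) \<partial>lebesgue)
     / emeasure lebesgue (Qbox s 0 (1 / 2 ^ n))"

text \<open>The integrand of the second part of \<^const>\<open>F_norm\<close>.\<close>

definition scale_osc :: "(real ^ 'd \<Rightarrow> real \<Rightarrow> 'b) \<Rightarrow> real \<Rightarrow> real ^ 'd \<Rightarrow> real \<Rightarrow> ennreal" where
  "scale_osc f \<beta> x l =
     (\<integral>\<^sup>+h\<in>Qbox s 0 (4 * l).
        ennreal (norm (f (x + h) \<beta> - \<Gamma> (x + h) x (f x) \<beta>) / l powr (\<gamma> - \<beta>)) \<partial>lebesgue)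
     / emeasure lebesgue (Qbox s 0 (4 * l))"

lemma F_norm_eq:
  "F_norm s A \<Gamma> \<gamma> p q f =
     (SUP \<zeta>\<in>B. Lp_norm p lebesgue (\<lambda>x. ennreal (norm (f x \<zeta>)))) +
     (SUP \<zeta>\<in>B. Lp_norm p lebesgue (\<lambda>x. Lp_norm q log_measure (scale_osc f \<zeta> x)))"
  unfolding F_norm_def scale_osc_def ..

definition measurable_section :: "(real ^ 'd \<Rightarrow> real \<Rightarrow> 'b) \<Rightarrow> bool" where
  "measurable_section f \<longleftrightarrow> (\<forall>x. f x \<in> T) \<and> (\<forall>\<zeta>\<in>B. strongly_measurable lebesgue (\<lambda>x. f x \<zeta>))"

lemma borel_measurable_deviation:
  assumes "measurable_section f" "\<beta> \<in> B"
  shows "(\<lambda>z. norm (f z \<beta> - \<Gamma> z w (f w) \<beta>)) \<in> borel_measurable lebesgue"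
  using assms unfolding measurable_section_def
  by (intro strongly_measurable_norm_diff strongly_measurable_Gamma_base) auto

text \<open>The integrand is almost everywhere a limit of simple functions of \<open>(w, z)\<close> on the product, so the
  integral over \<open>z\<close> is measurable in \<open>w\<close> by the theorem of Tonelli. Lebesgue measure is complete, which takes care of the
  exceptional null set of \<open>w\<close>.\<close>

lemma borel_measurable_osc:
  assumes f: "measurable_section f" and \<beta>: "\<beta> \<in> B"
  shows "osc f n \<beta> \<in> borel_measurable lebesgue"
proof -
  define R where "R = (3 :: real) / 2 ^ n"
  define c where "c = 2 powr (real n * (\<gamma> - \<beta>))"
  have fT: "f x \<in> T" for x
    using f by (simp add: measurable_section_def)
  obtain U where U: "\<And>i::nat. simple_function lebesgue (U i)" "\<And>i x. U i x \<in> T"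
    "AE x in lebesgue. \<forall>\<zeta>\<in>B. (\<lambda>i. U i x \<zeta>) \<longlonglongrightarrow> f x \<zeta>"
    using simple_approximation_exists[of f lebesgue] f unfolding measurable_section_def by blast
  define H where "H = (\<lambda>i w z. norm (U i z \<beta> - \<Gamma> (cut_pt s i i z) (cut_pt s i i w) (U i w) \<beta>))"
  define L where "L = (\<lambda>w z. liminf (\<lambda>i. ennreal (c * H i w z)) * indicator (Qbox s w R) z)"
  have "(\<lambda>p. H i (fst p) (snd p)) \<in> borel_measurable (lebesgue \<Otimes>\<^sub>M lebesgue)" for i
  proof -
    have W: "simple_function lebesgue (\<lambda>z. (U i z, cut_pt s i i z))"
      by (rule simple_function_Pair[OF U(1) simple_function_cut_pt])
    show ?thesis
      unfolding H_def
      using simple_function_compose2[OF simple_function_fst[OF W] simple_function_snd[OF W],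
          of "\<lambda>a b. norm (fst b \<beta> - \<Gamma> (snd b) (snd a) (fst a) \<beta>)"]
      by (intro borel_measurable_simple_function) simp
  qed
  moreover have "(\<lambda>p. indicator (Qbox s (fst p) R) (snd p) :: ennreal) \<in> borel_measurable (lebesgue \<Otimes>\<^sub>M lebesgue)"
  proof -
    have "(\<lambda>p. snd p - fst p :: real ^ 'd) \<in> borel_measurable (lebesgue \<Otimes>\<^sub>M lebesgue)"
      using measurable_compose[OF measurable_fst id_borel_measurable_lebesgue, of lebesgue]
        measurable_compose[OF measurable_snd id_borel_measurable_lebesgue, of lebesgue]
      by (intro borel_measurable_diff) auto
    moreover have "Qbox s (0 :: real ^ 'd) R \<in> sets borel"
      by (intro Qbox_sets scaling) (simp add: R_def)
    ultimately have "(\<lambda>p. indicator (Qbox s (0 :: real ^ 'd) R) (snd p - fst p) :: ennreal)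
        \<in> borel_measurable (lebesgue \<Otimes>\<^sub>M lebesgue)"
      by (intro measurable_compose[OF _ borel_measurable_indicator])
    then show ?thesis
      by (simp add: mem_Qbox indicator_def)
  qed
  ultimately have "(\<lambda>p. L (fst p) (snd p)) \<in> borel_measurable (lebesgue \<Otimes>\<^sub>M lebesgue)"
    unfolding L_def
    by (intro borel_measurable_times_ennreal borel_measurable_liminf measurable_compose[OF _ measurable_ennreal]
        borel_measurable_times borel_measurable_const)
  then have "case_prod L \<in> borel_measurable (lebesgue \<Otimes>\<^sub>M lebesgue)"
    by (simp add: split_beta')
  then have "(\<lambda>w. \<integral>\<^sup>+z. L w z \<partial>lebesgue) \<in> borel_measurable lebesgue"
    by (rule sigma_finite_measure.borel_measurable_nn_integral[OF sigma_finite_lebesgue])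
  moreover have "AE w in lebesgue. (\<integral>\<^sup>+z. L w z \<partial>lebesgue)
      = (\<integral>\<^sup>+z\<in>Qbox s w R. ennreal (c * norm (f z \<beta> - \<Gamma> z w (f w) \<beta>)) \<partial>lebesgue)"
    using U(3)
  proof eventually_elim
    case (elim w)
    then have w: "\<And>\<zeta>. \<zeta> \<in> B \<Longrightarrow> (\<lambda>i. U i w \<zeta>) \<longlonglongrightarrow> f w \<zeta>"
      by simp
    have "AE z in lebesgue. L w z = ennreal (c * norm (f z \<beta> - \<Gamma> z w (f w) \<beta>)) * indicator (Qbox s w R) z"
      using U(3)
    proof eventually_elim
      case (elim z)
      \<comment> \<open>The three factors of \<open>\<Gamma>\<close> converge one after the other, from the inside.\<close>
      have 1: "(\<lambda>i. \<Gamma> w (cut_pt s i i w) (U i w) \<zeta>) \<longlonglongrightarrow> f w \<zeta>" if "\<zeta> \<in> B" for \<zeta>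
        by (rule Gamma_tendsto_id[OF U(2) w tendsto_cut_pt[OF scaling] that])
      have 2: "(\<lambda>i. \<Gamma> z w (\<Gamma> w (cut_pt s i i w) (U i w)) \<zeta>) \<longlonglongrightarrow> \<Gamma> z w (f w) \<zeta>" for \<zeta>
        by (rule Gamma_tendsto[OF Gamma_in_T[OF U(2)] fT 1])
      have cut: "(\<lambda>i. snorm s (cut_pt s i i z - z)) \<longlonglongrightarrow> 0"
        using tendsto_cut_pt[OF scaling, of z] by (simp add: snorm_commute[of s z])
      have "(\<lambda>i. \<Gamma> (cut_pt s i i z) z (\<Gamma> z w (\<Gamma> w (cut_pt s i i w) (U i w))) \<beta>) \<longlonglongrightarrow> \<Gamma> z w (f w) \<beta>"
        by (rule Gamma_tendsto_id[OF Gamma_in_T[OF Gamma_in_T[OF U(2)]] 2 cut \<beta>])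
      then have 3: "(\<lambda>i. \<Gamma> (cut_pt s i i z) (cut_pt s i i w) (U i w) \<beta>) \<longlonglongrightarrow> \<Gamma> z w (f w) \<beta>"
        by (simp add: Gamma_trans Gamma_in_T U(2))
      have "(\<lambda>i. U i z \<beta>) \<longlonglongrightarrow> f z \<beta>"
        using elim \<beta> by simp
      then have "(\<lambda>i. H i w z) \<longlonglongrightarrow> norm (f z \<beta> - \<Gamma> z w (f w) \<beta>)"
        unfolding H_def using 3 by (intro tendsto_norm tendsto_diff)
      then have "(\<lambda>i. c * H i w z) \<longlonglongrightarrow> c * norm (f z \<beta> - \<Gamma> z w (f w) \<beta>)"
        by (rule tendsto_mult_left)
      then have "(\<lambda>i. ennreal (c * H i w z)) \<longlonglongrightarrow> ennreal (c * norm (f z \<beta> - \<Gamma> z w (f w) \<beta>))"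
        by (rule tendsto_ennrealI)
      then have "liminf (\<lambda>i. ennreal (c * H i w z)) = ennreal (c * norm (f z \<beta> - \<Gamma> z w (f w) \<beta>))"
        by (rule lim_imp_Liminf[OF sequentially_bot])
      then show ?case
        by (simp add: L_def)
    qed
    then show ?case
      by (rule nn_integral_cong_AE)
  qed
  ultimately have "(\<lambda>w. \<integral>\<^sup>+z\<in>Qbox s w R. ennreal (c * norm (f z \<beta> - \<Gamma> z w (f w) \<beta>)) \<partial>lebesgue)
      \<in> borel_measurable lebesgue"
    by (rule borel_measurable_lebesgue_AE_eq)
  then have "(\<lambda>w. (\<integral>\<^sup>+z\<in>Qbox s w R. ennreal (c * norm (f z \<beta> - \<Gamma> z w (f w) \<beta>)) \<partial>lebesgue)
      / emeasure lebesgue (Qbox s (0 :: real ^ 'd) (1 / 2 ^ n))) \<in> borel_measurable lebesgue"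
    by (intro borel_measurable_divide_ennreal borel_measurable_const)
  then show ?thesis
    unfolding osc_def[abs_def] R_def c_def .
qed

text \<open>For \<open>l\<close> in the interval of scales, \<open>3 / 2 ^ n \<le> 4 * l\<close> compares the domains of integration, and
  \<open>l \<le> 1 / 2 ^ n\<close> compares the weights and the volumes.\<close>

lemma osc_le_scale_osc:
  assumes f: "measurable_section f" and \<beta>: "\<beta> \<in> B" and l: "l \<in> scale_interval n"
  shows "osc f n \<beta> w \<le> ennreal (4 ^ (\<Sum>i\<in>UNIV. s i)) * scale_osc f \<beta> w l"
proof -
  have l_pos: "0 < l" and l_bd: "3 / 4 / 2 ^ n \<le> l" "l \<le> 1 / 2 ^ n"
    using l scale_interval_subset[of n] by (auto simp: scale_interval_def)
  let ?k = "\<Sum>i\<in>UNIV. s i"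
  let ?F = "\<lambda>z. ennreal (2 powr (real n * (\<gamma> - \<beta>)) * norm (f z \<beta> - \<Gamma> z w (f w) \<beta>)) * indicator (Qbox s w (3 / 2 ^ n)) z"
  have F: "?F \<in> borel_measurable lebesgue"
    using Qbox_sets[OF scaling, of "3 / 2 ^ n" w]
    by (intro borel_measurable_times_ennreal measurable_compose[OF _ measurable_ennreal] borel_measurable_times
        borel_measurable_const borel_measurable_deviation[OF f \<beta>] borel_measurable_indicator) auto
  have weight: "2 powr (real n * (\<gamma> - \<beta>)) \<le> 1 / l powr (\<gamma> - \<beta>)"
  proof -
    have "l powr (\<gamma> - \<beta>) \<le> (1 / 2 ^ n) powr (\<gamma> - \<beta>)"
      using l_pos l_bd B_lt[OF \<beta>] by (intro powr_mono2) auto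
    also have "\<dots> = 1 / 2 powr (real n * (\<gamma> - \<beta>))"
      by (simp add: powr_powr powr_divide flip: powr_realpow)
    finally show ?thesis
      using l_pos by (simp add: field_simps)
  qed
  have "(\<integral>\<^sup>+z. ?F z \<partial>lebesgue) = (\<integral>\<^sup>+h. ?F (w + h) \<partial>lebesgue)"
    by (rule nn_integral_lebesgue_translation[OF F, symmetric])
  also have "\<dots> \<le> (\<integral>\<^sup>+h\<in>Qbox s 0 (4 * l).
        ennreal (norm (f (w + h) \<beta> - \<Gamma> (w + h) w (f w) \<beta>) / l powr (\<gamma> - \<beta>)) \<partial>lebesgue)"
  proof (intro nn_integral_mono mult_mono)
    fix h
    show "ennreal (2 powr (real n * (\<gamma> - \<beta>)) * norm (f (w + h) \<beta> - \<Gamma> (w + h) w (f w) \<beta>))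
        \<le> ennreal (norm (f (w + h) \<beta> - \<Gamma> (w + h) w (f w) \<beta>) / l powr (\<gamma> - \<beta>))"
      using mult_right_mono[OF weight, of "norm (f (w + h) \<beta> - \<Gamma> (w + h) w (f w) \<beta>)"]
      by (intro ennreal_leI) simp
    have "3 / 2 ^ n \<le> 4 * l"
      using l_bd(1) by simp
    then show "indicator (Qbox s w (3 / 2 ^ n)) (w + h) \<le> (indicator (Qbox s 0 (4 * l)) h :: ennreal)"
      by (auto simp: indicator_def mem_Qbox)
  qed auto
  finally have num: "(\<integral>\<^sup>+z. ?F z \<partial>lebesgue) \<le> (\<integral>\<^sup>+h\<in>Qbox s 0 (4 * l).
        ennreal (norm (f (w + h) \<beta> - \<Gamma> (w + h) w (f w) \<beta>) / l powr (\<gamma> - \<beta>)) \<partial>lebesgue)" .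
  let ?a = "2 ^ CARD('d) * (1 / 2 ^ n) ^ ?k :: real" and ?b = "2 ^ CARD('d) * (4 * l) ^ ?k :: real"
  have "(4 * l) ^ ?k \<le> (4 * (1 / 2 ^ n)) ^ ?k"
    using l_pos l_bd(2) by (intro power_mono mult_left_mono) auto
  then have "?b \<le> 4 ^ ?k * ?a"
    by (simp only: power_mult_distrib) simp
  moreover have "0 < ?a" "0 < ?b"
    using l_pos by auto
  ultimately have "osc f n \<beta> w \<le> ennreal (4 ^ ?k) * ((\<integral>\<^sup>+z. ?F z \<partial>lebesgue) / ennreal ?b)"
    unfolding osc_def using scaling by (subst emeasure_Qbox) (auto intro: ennreal_divide_le)
  also have "\<dots> \<le> ennreal (4 ^ ?k) * scale_osc f \<beta> w l"
    unfolding scale_osc_def using scaling l_pos num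
    by (subst emeasure_Qbox) (auto intro!: mult_left_mono divide_right_mono_ennreal)
  finally show ?thesis .
qed

definition osc_norm :: "ennreal \<Rightarrow> ennreal \<Rightarrow> (real ^ 'd \<Rightarrow> real \<Rightarrow> 'b) \<Rightarrow> ennreal" where
  "osc_norm p q f = (SUP \<zeta>\<in>B. Lp_norm p lebesgue (\<lambda>x. Lp_norm q log_measure (scale_osc f \<zeta> x)))"

lemma borel_measurable_lq_osc:
  assumes "measurable_section f" "\<beta> \<in> B"
  shows "(\<lambda>x. Lp_norm q (count_space UNIV) (\<lambda>n. osc f (n + k) \<beta> x)) \<in> borel_measurable lebesgue"
  by (intro borel_measurable_lq_norm borel_measurable_osc assms)

lemma Lp_lq_osc_le:
  assumes f: "measurable_section f" and \<beta>: "\<beta> \<in> B" and p: "1 \<le> p" and q: "1 \<le> q"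
  shows "Lp_norm p lebesgue (\<lambda>x. Lp_norm q (count_space UNIV) (\<lambda>n. osc f (n + k) \<beta> x))
    \<le> ennreal (4 * 4 ^ (\<Sum>i\<in>UNIV. s i)) * osc_norm p q f"
proof -
  let ?K = "4 ^ (\<Sum>i\<in>UNIV. s i) :: real"
  have K: "0 < ?K"
    by simp
  have "Lp_norm q (count_space UNIV) (\<lambda>n. osc f (n + k) \<beta> x)
      \<le> ennreal (4 * ?K) * Lp_norm q log_measure (scale_osc f \<beta> x)" for x
  proof -
    have "Lp_norm q (count_space UNIV) (\<lambda>n. osc f (n + k) \<beta> x)
        \<le> ennreal ?K * Lp_norm q (count_space UNIV) (\<lambda>n. osc f (n + k) \<beta> x / ennreal ?K)"
      using K by (intro Lp_norm_le_cmult[OF q]) (auto simp: ennreal_cmult_divide)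
    also have "\<dots> \<le> ennreal ?K * (4 * Lp_norm q log_measure (scale_osc f \<beta> x))"
    proof (intro mult_left_mono lq_norm_le_log_norm[OF q])
      fix n l assume "l \<in> scale_interval (n + k)"
      then show "osc f (n + k) \<beta> x / ennreal ?K \<le> scale_osc f \<beta> x l"
        using osc_le_scale_osc[OF f \<beta>, of l "n + k" x] K by (intro divide_le_posI_ennreal) auto
    qed simp
    also have "\<dots> = ennreal (4 * ?K) * Lp_norm q log_measure (scale_osc f \<beta> x)"
      by (simp add: ennreal_mult ac_simps)
    finally show ?thesis .
  qed
  then have "Lp_norm p lebesgue (\<lambda>x. Lp_norm q (count_space UNIV) (\<lambda>n. osc f (n + k) \<beta> x))
      \<le> ennreal (4 * ?K) * Lp_norm p lebesgue (\<lambda>x. Lp_norm q log_measure (scale_osc f \<beta> x))"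
    by (intro Lp_norm_le_cmult[OF p] borel_measurable_lq_osc f \<beta>) auto
  also have "\<dots> \<le> ennreal (4 * ?K) * osc_norm p q f"
    unfolding osc_norm_def using \<beta> by (intro mult_left_mono SUP_upper) auto
  finally show ?thesis .
qed

definition total_osc :: "(real ^ 'd \<Rightarrow> real \<Rightarrow> 'b) \<Rightarrow> nat \<Rightarrow> real ^ 'd \<Rightarrow> ennreal" where
  "total_osc f n x = (\<Sum>\<beta>\<in>B. osc f n \<beta> x)"

text \<open>The shift by \<open>k\<close> admits the oscillation at the next finer scale, and the scale \<open>2\<^sup>-\<^sup>k\<close> on its own.\<close>

lemma Lp_lq_total_osc_le:
  assumes p: "1 \<le> p" and q: "1 \<le> q"
  shows "\<exists>C\<ge>1. \<forall>f k. measurable_section f \<longrightarrow>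
    Lp_norm p lebesgue (\<lambda>x. Lp_norm q (count_space UNIV) (\<lambda>n. total_osc f (n + k) x)) \<le> ennreal C * osc_norm p q f"
proof -
  define N where "N = real (card B)"
  define K where "K = (4 * 4 ^ (\<Sum>i\<in>UNIV. s i) :: real)"
  have NK: "0 \<le> N" "1 \<le> K"
    unfolding N_def K_def by (auto intro: mult_ge1_I)
  have "Lp_norm p lebesgue (\<lambda>x. Lp_norm q (count_space UNIV) (\<lambda>n. total_osc f (n + k) x))
      \<le> ennreal (1 + N * N * (N * N * (N * K))) * osc_norm p q f" if f: "measurable_section f" for f k
  proof -
    let ?l = "\<lambda>\<beta> x. Lp_norm q (count_space UNIV) (\<lambda>n. osc f (n + k) \<beta> x)"
    have meas: "?l \<beta> \<in> borel_measurable lebesgue" if "\<beta> \<in> B" for \<beta>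
      by (rule borel_measurable_lq_osc[OF f that])
    have NN: "of_nat (card B) = ennreal N"
      by (simp add: N_def ennreal_of_nat_eq_real_of_nat)
    have "Lp_norm p lebesgue (\<lambda>x. Lp_norm q (count_space UNIV) (\<lambda>n. total_osc f (n + k) x))
        \<le> Lp_norm p lebesgue (\<lambda>x. ennreal (N * N) * (\<Sum>\<beta>\<in>B. ?l \<beta> x))"
    proof (rule Lp_norm_mono[OF p])
      show "(\<lambda>x. Lp_norm q (count_space UNIV) (\<lambda>n. total_osc f (n + k) x)) \<in> borel_measurable lebesgue"
        unfolding total_osc_def by (intro borel_measurable_lq_norm borel_measurable_sum borel_measurable_osc f)
      show "Lp_norm q (count_space UNIV) (\<lambda>n. total_osc f (n + k) x) \<le> ennreal (N * N) * (\<Sum>\<beta>\<in>B. ?l \<beta> x)" for x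
        unfolding total_osc_def
        using Lp_norm_sum_le[OF q finite_B, of "\<lambda>\<beta> n. osc f (n + k) \<beta> x" "count_space UNIV"] NK
        by (simp add: NN ennreal_mult)
    qed
    also have "\<dots> \<le> ennreal (N * N) * Lp_norm p lebesgue (\<lambda>x. \<Sum>\<beta>\<in>B. ?l \<beta> x)"
      by (intro Lp_norm_cmult_le p borel_measurable_sum meas)
    also have "\<dots> \<le> ennreal (N * N) * (ennreal (N * N) * (\<Sum>\<beta>\<in>B. Lp_norm p lebesgue (?l \<beta>)))"
      using Lp_norm_sum_le[OF p finite_B meas] NK by (intro mult_left_mono) (auto simp: NN ennreal_mult)
    also have "\<dots> \<le> ennreal (N * N) * (ennreal (N * N) * (ennreal N * (ennreal K * osc_norm p q f)))"
      unfolding NN[symmetric] K_def by (intro mult_left_mono sum_bounded_above Lp_lq_osc_le f p q) auto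
    also have "\<dots> = ennreal (N * N * (N * N * (N * K))) * osc_norm p q f"
      using NK by (simp add: ennreal_mult mult.assoc)
    also have "\<dots> \<le> ennreal (1 + N * N * (N * N * (N * K))) * osc_norm p q f"
      by (intro mult_right_mono ennreal_leI) auto
    finally show ?thesis .
  qed
  then show ?thesis
    using NK by (intro exI[of _ "1 + N * N * (N * N * (N * K))"]) auto
qed

section \<open>Averages\<close>

definition locally_integrable_section :: "(real ^ 'd \<Rightarrow> real \<Rightarrow> 'b) \<Rightarrow> bool" where
  "locally_integrable_section f \<longleftrightarrow>
     measurable_section f \<and> (\<forall>\<zeta>\<in>B. \<forall>a b. (\<integral>\<^sup>+z\<in>cbox a b. ennreal (norm (f z \<zeta>)) \<partial>lebesgue) < \<infinity>)"

text \<open>On the box, the norm of the integrand is bounded by a multiple of the sum of the norms of the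
  components of \<open>f z\<close>.\<close>

lemma integrable_on_reexpansion:
  assumes f: "locally_integrable_section f"
  shows "(\<lambda>z. \<Gamma> y z (f z) \<zeta>) integrable_on Qbox s y (1 / 2 ^ n)"
proof (cases "\<zeta> \<in> B")
  case True
  have fT: "f x \<in> T" and sm: "\<zeta> \<in> B \<Longrightarrow> strongly_measurable lebesgue (\<lambda>x. f x \<zeta>)"
    and fin: "\<zeta> \<in> B \<Longrightarrow> (\<integral>\<^sup>+z\<in>cbox a b. ennreal (norm (f z \<zeta>)) \<partial>lebesgue) < \<infinity>" for x \<zeta> a b
    using f by (auto simp: locally_integrable_section_def measurable_section_def)
  obtain C where C: "1 \<le> C" "\<And>x y \<tau>. snorm s (x - y) \<le> 1 \<Longrightarrow> \<tau> \<in> T \<Longrightarrow> wnorm 0 (\<Gamma> x y \<tau>) \<le> C * wnorm 0 \<tau>"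
    using Gamma_wnorm_exists by (metis div_by_1 power_0)
  obtain a b where ab: "Qbox s y (1 / 2 ^ n) = cbox a b"
    using Qbox_eq_cbox[OF scaling, of "1 / 2 ^ n" y] by auto
  have "(1::real) / 2 ^ n \<le> 1"
    by simp
  then have near: "snorm s (y - z) \<le> 1" if "z \<in> cbox a b" for z
    using that unfolding ab[symmetric] mem_Qbox snorm_commute[of s y] by linarith
  have "(\<integral>\<^sup>+z\<in>cbox a b. ennreal (norm (\<Gamma> y z (f z) \<zeta>)) \<partial>lebesgue)
      \<le> (\<integral>\<^sup>+z. ennreal C * (\<Sum>\<beta>\<in>B. ennreal (norm (f z \<beta>)) * indicator (cbox a b) z) \<partial>lebesgue)"
  proof (intro nn_integral_mono)
    fix z
    have "ennreal (norm (\<Gamma> y z (f z) \<zeta>)) \<le> ennreal C * (\<Sum>\<beta>\<in>B. ennreal (norm (f z \<beta>)))" if "z \<in> cbox a b"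
    proof -
      have "norm (\<Gamma> y z (f z) \<zeta>) \<le> C * (\<Sum>\<beta>\<in>B. norm (f z \<beta>))"
        using order_trans[OF component_le_wnorm[OF True, of 0 "\<Gamma> y z (f z)"] C(2)[OF near[OF that] fT[of z]]]
        by (simp add: wnorm_def)
      then have "ennreal (norm (\<Gamma> y z (f z) \<zeta>)) \<le> ennreal (C * (\<Sum>\<beta>\<in>B. norm (f z \<beta>)))"
        by (rule ennreal_leI)
      then show ?thesis
        using C(1) by (simp add: ennreal_mult sum_nonneg)
    qed
    then show "ennreal (norm (\<Gamma> y z (f z) \<zeta>)) * indicator (cbox a b) z
        \<le> ennreal C * (\<Sum>\<beta>\<in>B. ennreal (norm (f z \<beta>)) * indicator (cbox a b) z)"
      by (auto simp: indicator_def)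
  qed
  also have "\<dots> = ennreal C * (\<Sum>\<beta>\<in>B. \<integral>\<^sup>+z\<in>cbox a b. ennreal (norm (f z \<beta>)) \<partial>lebesgue)"
  proof -
    have "(\<lambda>z. ennreal (norm (f z \<beta>)) * indicator (cbox a b) z) \<in> borel_measurable lebesgue" if "\<beta> \<in> B" for \<beta>
      using strongly_measurable_norm[OF sm[OF that]]
      by (intro borel_measurable_times_ennreal borel_measurable_indicator measurable_compose[OF _ measurable_ennreal]) auto
    then show ?thesis
      by (subst nn_integral_cmult) (auto simp: nn_integral_sum)
  qed
  also have "\<dots> < \<infinity>"
    using fin finite_B by (simp add: ennreal_mult_less_top)
  finally show ?thesis
    unfolding ab by (intro strongly_measurable_integrable_on strongly_measurable_Gamma_section fT sm)
next
  case False
  then have "\<Gamma> y z (f z) \<zeta> = 0" for z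
    using Gamma_in_T[of "f z" y z] f by (simp add: locally_integrable_section_def measurable_section_def T_iff)
  then show ?thesis
    by (simp add: integrable_0)
qed

lemma averages_in_T:
  assumes f: "\<And>x. f x \<in> T"
  shows "averages s \<Gamma> f n y \<in> T"
  unfolding T_iff averages_def
proof (intro conjI ballI allI impI)
  fix \<zeta> assume "\<zeta> \<in> B"
  then have "integral (Qbox s y (1 / 2 ^ n)) (\<lambda>z. \<Gamma> y z (f z) \<zeta>) \<in> V \<zeta>"
    using Gamma_in_T[OF f] unfolding Qbox_eq_cbox[OF scaling, of "1 / 2 ^ n", simplified]
    by (intro integral_in_closed_subspace subspace_V closed_V B_subset) (auto simp: T_iff)
  then show "(1 / measure lebesgue (Qbox s y (1 / 2 ^ n))) *\<^sub>R integral (Qbox s y (1 / 2 ^ n)) (\<lambda>z. \<Gamma> y z (f z) \<zeta>) \<in> V \<zeta>"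
    using \<open>\<zeta> \<in> B\<close> by (intro subspace_scale subspace_V B_subset)
next
  fix \<zeta> assume "\<zeta> \<notin> B"
  then have "\<Gamma> y z (f z) \<zeta> = 0" for z
    using Gamma_in_T[OF f] by (simp add: T_iff)
  then show "(1 / measure lebesgue (Qbox s y (1 / 2 ^ n))) *\<^sub>R integral (Qbox s y (1 / 2 ^ n)) (\<lambda>z. \<Gamma> y z (f z) \<zeta>) = 0"
    by simp
qed

text \<open>Since \<open>\<Gamma> y z (f z) - \<Gamma> y w (f w) = \<Gamma> y z (f z - \<Gamma> z w (f w))\<close>, the difference on the left is an
  average over \<open>z\<close> of reexpanded deviations of \<open>f z\<close> from \<open>f w\<close>, and the weighted norms are
  stable under reexpansion from \<open>z\<close> to \<open>y\<close>. All later estimates rest on this one; \<open>w\<close> will be the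
  point at which the norms are evaluated.\<close>

lemma average_deviation_exists:
  "\<exists>C\<ge>1. \<forall>f n y w. locally_integrable_section f \<longrightarrow> snorm s (y - w) \<le> 2 / 2 ^ n \<longrightarrow>
     ennreal (wnorm n (\<lambda>\<zeta>. averages s \<Gamma> f n y \<zeta> - \<Gamma> y w (f w) \<zeta>)) \<le> ennreal C * total_osc f n w"
proof -
  obtain C where C: "1 \<le> C"
    "\<And>n x y \<tau>. snorm s (x - y) \<le> 1 / 2 ^ n \<Longrightarrow> \<tau> \<in> T \<Longrightarrow> wnorm n (\<Gamma> x y \<tau>) \<le> C * wnorm n \<tau>"
    using Gamma_wnorm_exists by metis
  have "ennreal (wnorm n (\<lambda>\<zeta>. averages s \<Gamma> f n y \<zeta> - \<Gamma> y w (f w) \<zeta>)) \<le> ennreal C * total_osc f n w"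
    if f: "locally_integrable_section f" and yw: "snorm s (y - w) \<le> 2 / 2 ^ n" for f n y w
  proof -
    let ?Q = "Qbox s y (1 / 2 ^ n)"
    let ?c = "\<lambda>\<zeta>. 2 powr (real n * (\<gamma> - \<zeta>))"
    have ms: "measurable_section f"
      using f by (simp add: locally_integrable_section_def)
    then have fT: "f x \<in> T" and sm: "\<zeta> \<in> B \<Longrightarrow> strongly_measurable lebesgue (\<lambda>x. f x \<zeta>)" for x \<zeta>
      by (auto simp: measurable_section_def)
    obtain a b where ab: "?Q = cbox a b"
      using Qbox_eq_cbox[OF scaling, of "1 / 2 ^ n" y] by auto
    define v where "v = measure lebesgue ?Q"
    have v: "0 < v" "emeasure lebesgue (Qbox s (0 :: real ^ 'd) (1 / 2 ^ n)) = ennreal v"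
      using scaling by (simp_all add: v_def measure_Qbox emeasure_Qbox del: emeasure_completion measure_completion)
    let ?D = "\<lambda>z \<zeta>. \<Gamma> y z (f z) \<zeta> - \<Gamma> y w (f w) \<zeta>"
    have meas: "(\<lambda>z. ennreal (?c \<zeta> * norm (?D z \<zeta>)) * indicator ?Q z) \<in> borel_measurable lebesgue" for \<zeta>
      unfolding ab
      by (intro borel_measurable_times_ennreal borel_measurable_indicator measurable_compose[OF _ measurable_ennreal]
          borel_measurable_times borel_measurable_const strongly_measurable_norm_diff
          strongly_measurable_Gamma_section strongly_measurable_const fT sm) auto
    let ?E = "\<lambda>\<beta> z. ennreal (?c \<beta> * norm (f z \<beta> - \<Gamma> z w (f w) \<beta>)) * indicator (Qbox s w (3 / 2 ^ n)) z"
    have comp: "ennreal (?c \<zeta> * norm (averages s \<Gamma> f n y \<zeta> - \<Gamma> y w (f w) \<zeta>))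
        \<le> (\<integral>\<^sup>+z\<in>?Q. ennreal (?c \<zeta> * norm (?D z \<zeta>)) \<partial>lebesgue) / ennreal v" for \<zeta>
    proof -
      have int: "(\<lambda>z. \<Gamma> y z (f z) \<zeta>) integrable_on cbox a b"
        by (rule integrable_on_reexpansion[OF f, of y \<zeta> n, unfolded ab])
      have "integral (cbox a b) (\<lambda>z. ?D z \<zeta>) = integral (cbox a b) (\<lambda>z. \<Gamma> y z (f z) \<zeta>) - v *\<^sub>R \<Gamma> y w (f w) \<zeta>"
        by (simp add: integral_diff[OF int integrable_const] v_def ab)
      then have "averages s \<Gamma> f n y \<zeta> - \<Gamma> y w (f w) \<zeta> = (1 / v) *\<^sub>R integral (cbox a b) (\<lambda>z. ?D z \<zeta>)"
        using v(1) by (simp add: averages_def ab v_def[symmetric, unfolded ab] scaleR_diff_right)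
      then have "ennreal (?c \<zeta> * norm (averages s \<Gamma> f n y \<zeta> - \<Gamma> y w (f w) \<zeta>))
          = ennreal (?c \<zeta>) * (ennreal (norm (integral (cbox a b) (\<lambda>z. ?D z \<zeta>))) / ennreal v)"
        using v(1) ennreal_mult[of "?c \<zeta>" "norm (integral (cbox a b) (\<lambda>z. ?D z \<zeta>)) / v"]
        by (simp add: divide_ennreal)
      also have "\<dots> \<le> ennreal (?c \<zeta>) * ((\<integral>\<^sup>+z\<in>cbox a b. ennreal (norm (?D z \<zeta>)) \<partial>lebesgue) / ennreal v)"
      proof (intro mult_left_mono divide_right_mono_ennreal norm_integral_le_nn_integral)
        show "(\<lambda>z. ?D z \<zeta>) integrable_on cbox a b"
          using int by (intro integrable_diff) auto
        show "strongly_measurable lebesgue (\<lambda>z. ?D z \<zeta>)"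
          by (rule strongly_measurable_diff_const[OF strongly_measurable_Gamma_section[OF fT sm]])
      qed simp
      also have "\<dots> = (\<integral>\<^sup>+z\<in>?Q. ennreal (?c \<zeta> * norm (?D z \<zeta>)) \<partial>lebesgue) / ennreal v"
      proof -
        have "(\<lambda>z. ennreal (norm (?D z \<zeta>)) * indicator (cbox a b) z) \<in> borel_measurable lebesgue"
          by (intro borel_measurable_times_ennreal borel_measurable_indicator measurable_compose[OF _ measurable_ennreal]
              strongly_measurable_norm_diff strongly_measurable_Gamma_section strongly_measurable_const fT sm) auto
        then show ?thesis
          unfolding ab by (simp add: ennreal_mult mult.assoc nn_integral_cmult ennreal_times_divide)
      qed
      finally show ?thesis .
    qed
    have "ennreal (wnorm n (\<lambda>\<zeta>. averages s \<Gamma> f n y \<zeta> - \<Gamma> y w (f w) \<zeta>))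
        = (\<Sum>\<zeta>\<in>B. ennreal (?c \<zeta> * norm (averages s \<Gamma> f n y \<zeta> - \<Gamma> y w (f w) \<zeta>)))"
      unfolding wnorm_def by (rule sum_ennreal[symmetric]) simp
    also have "\<dots> \<le> (\<Sum>\<zeta>\<in>B. (\<integral>\<^sup>+z\<in>?Q. ennreal (?c \<zeta> * norm (?D z \<zeta>)) \<partial>lebesgue) / ennreal v)"
      by (intro sum_mono comp)
    also have "\<dots> = (\<integral>\<^sup>+z. (\<Sum>\<zeta>\<in>B. ennreal (?c \<zeta> * norm (?D z \<zeta>)) * indicator ?Q z) \<partial>lebesgue) / ennreal v"
      by (simp only: nn_integral_sum[OF meas] divide_ennreal_def sum_distrib_right)
    also have "\<dots> \<le> (\<integral>\<^sup>+z. ennreal C * (\<Sum>\<beta>\<in>B. ?E \<beta> z) \<partial>lebesgue) / ennreal v"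
    proof (intro divide_right_mono_ennreal nn_integral_mono)
      fix z
      show "(\<Sum>\<zeta>\<in>B. ennreal (?c \<zeta> * norm (?D z \<zeta>)) * indicator ?Q z)
          \<le> ennreal C * (\<Sum>\<beta>\<in>B. ?E \<beta> z)"
      proof (cases "z \<in> ?Q")
        case True
        then have yz: "snorm s (z - y) \<le> 1 / 2 ^ n"
          by (simp add: mem_Qbox)
        \<comment> \<open>\<open>osc\<close> integrates over a box around \<open>w\<close>, which contains the averaging box around \<open>y\<close>.\<close>
        then have zw: "z \<in> Qbox s w (3 / 2 ^ n)"
        proof -
          have "(1::real) / 2 ^ n + 2 / 2 ^ n = 3 / 2 ^ n"
            by (simp flip: add_divide_distrib)
          then show ?thesis
            using snorm_triangle_diff[OF scaling, of z w y] yw yz unfolding mem_Qbox by linarith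
        qed
        have "?D z = \<Gamma> y z (\<lambda>\<zeta>. f z \<zeta> - \<Gamma> z w (f w) \<zeta>)"
          by (simp add: Gamma_diff fT Gamma_in_T Gamma_trans)
        then have "wnorm n (?D z) \<le> C * wnorm n (\<lambda>\<zeta>. f z \<zeta> - \<Gamma> z w (f w) \<zeta>)"
          using C(2)[of y z n "\<lambda>\<zeta>. f z \<zeta> - \<Gamma> z w (f w) \<zeta>"] yz
          by (simp add: snorm_commute[of s z] T_diff fT Gamma_in_T)
        then have "ennreal (wnorm n (?D z)) \<le> ennreal C * ennreal (wnorm n (\<lambda>\<zeta>. f z \<zeta> - \<Gamma> z w (f w) \<zeta>))"
          using C(1) wnorm_nonneg by (simp add: ennreal_leI flip: ennreal_mult)
        then show ?thesis
          unfolding wnorm_def using True zw by (subst (asm) (1 2) sum_ennreal[symmetric]) auto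
      qed simp
    qed
    also have "\<dots> = ennreal C * total_osc f n w"
    proof -
      have E: "?E \<beta> \<in> borel_measurable lebesgue" if "\<beta> \<in> B" for \<beta>
        using Qbox_sets[OF scaling, of "3 / 2 ^ n" w]
        by (intro borel_measurable_times_ennreal measurable_compose[OF _ measurable_ennreal] borel_measurable_times
            borel_measurable_const borel_measurable_deviation[OF ms that] borel_measurable_indicator) auto
      have "(\<integral>\<^sup>+z. ennreal C * (\<Sum>\<beta>\<in>B. ?E \<beta> z) \<partial>lebesgue) = ennreal C * (\<integral>\<^sup>+z. (\<Sum>\<beta>\<in>B. ?E \<beta> z) \<partial>lebesgue)"
        by (intro nn_integral_cmult borel_measurable_sum E)
      also have "(\<integral>\<^sup>+z. (\<Sum>\<beta>\<in>B. ?E \<beta> z) \<partial>lebesgue) = (\<Sum>\<beta>\<in>B. \<integral>\<^sup>+z. ?E \<beta> z \<partial>lebesgue)"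
        by (rule nn_integral_sum[OF E])
      finally show ?thesis
        unfolding total_osc_def osc_def v(2)
        by (simp only: divide_ennreal_def sum_distrib_right mult.assoc)
    qed
    finally show ?thesis .
  qed
  then show ?thesis
    using C(1) by auto
qed

section \<open>Norm estimates for the averages\<close>

lemma F_space_imp_locally_integrable:
  assumes p: "1 \<le> p" "p < \<infinity>" and f: "f \<in> F_space s A V \<Gamma> \<gamma> p q"
  shows "locally_integrable_section f"
proof -
  have ms: "measurable_section f" and fin: "F_norm s A \<Gamma> \<gamma> p q f < \<infinity>"
    using f by (auto simp: F_space_def measurable_section_def)
  have "(\<integral>\<^sup>+z\<in>cbox a b. ennreal (norm (f z \<zeta>)) \<partial>lebesgue) < \<infinity>" if \<zeta>: "\<zeta> \<in> B" for \<zeta> a b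
  proof (rule Lp_imp_locally_integrable[OF p])
    show "(\<lambda>z. ennreal (norm (f z \<zeta>))) \<in> borel_measurable lebesgue"
      using ms \<zeta> strongly_measurable_norm unfolding measurable_section_def
      by (intro measurable_compose[OF _ measurable_ennreal]) auto
    have "Lp_norm p lebesgue (\<lambda>x. ennreal (norm (f x \<zeta>))) \<le> F_norm s A \<Gamma> \<gamma> p q f"
      unfolding F_norm_def using \<zeta> by (intro add_increasing2 SUP_upper) auto
    then show "Lp_norm p lebesgue (\<lambda>x. ennreal (norm (f x \<zeta>))) < \<infinity>"
      using fin by (rule le_less_trans)
  qed
  then show ?thesis
    using ms by (simp add: locally_integrable_section_def)
qed

text \<open>Both averages are close to \<open>\<Gamma> y x (f x)\<close>, where \<open>y\<close> is the lattice point of \<open>x\<close>. As the distance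
  from \<open>y\<close> to \<open>x\<close> is at most \<open>2 / 2 ^ Suc n\<close>, this holds at level \<open>Suc n\<close> too.\<close>

lemma average_level_difference_exists:
  "\<exists>C\<ge>1. \<forall>f n x \<zeta>. locally_integrable_section f \<longrightarrow> \<zeta> \<in> B \<longrightarrow>
     ennreal (2 powr (real n * (\<gamma> - \<zeta>)) * norm (averages s \<Gamma> f n (lattice_pt s n x) \<zeta>
       - averages s \<Gamma> f (Suc n) (lattice_pt s n x) \<zeta>))
     \<le> ennreal C * (total_osc f n x + total_osc f (Suc n) x)"
proof -
  obtain C where C: "1 \<le> C" "\<And>f n y w. locally_integrable_section f \<Longrightarrow> snorm s (y - w) \<le> 2 / 2 ^ n \<Longrightarrow>
     ennreal (wnorm n (\<lambda>\<zeta>. averages s \<Gamma> f n y \<zeta> - \<Gamma> y w (f w) \<zeta>)) \<le> ennreal C * total_osc f n w"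
    using average_deviation_exists by metis
  have "ennreal (2 powr (real n * (\<gamma> - \<zeta>)) * norm (averages s \<Gamma> f n (lattice_pt s n x) \<zeta>
       - averages s \<Gamma> f (Suc n) (lattice_pt s n x) \<zeta>))
     \<le> ennreal C * (total_osc f n x + total_osc f (Suc n) x)"
    if f: "locally_integrable_section f" and \<zeta>: "\<zeta> \<in> B" for f n x \<zeta>
  proof -
    let ?y = "lattice_pt s n x"
    let ?d = "\<lambda>m \<zeta>. averages s \<Gamma> f m ?y \<zeta> - \<Gamma> ?y x (f x) \<zeta>"
    have yx: "snorm s (?y - x) \<le> 1 / 2 ^ n"
      using snorm_lattice_pt[OF scaling, of x n] by (simp add: snorm_commute[of s ?y])
    then have near: "snorm s (?y - x) \<le> 2 / 2 ^ n" "snorm s (?y - x) \<le> 2 / 2 ^ Suc n"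
      by (auto simp: field_simps)
    have "2 powr (real n * (\<gamma> - \<zeta>)) * norm (averages s \<Gamma> f n ?y \<zeta> - averages s \<Gamma> f (Suc n) ?y \<zeta>)
        \<le> wnorm n (\<lambda>\<zeta>. ?d n \<zeta> - ?d (Suc n) \<zeta>)"
      using component_le_wnorm[OF \<zeta>, of n "\<lambda>\<zeta>. ?d n \<zeta> - ?d (Suc n) \<zeta>"] by simp
    also have "\<dots> \<le> wnorm n (?d n) + wnorm (Suc n) (?d (Suc n))"
      by (intro order_trans[OF wnorm_triangle] add_left_mono wnorm_mono) simp
    finally have "ennreal (2 powr (real n * (\<gamma> - \<zeta>)) * norm (averages s \<Gamma> f n ?y \<zeta> - averages s \<Gamma> f (Suc n) ?y \<zeta>))
        \<le> ennreal (wnorm n (?d n)) + ennreal (wnorm (Suc n) (?d (Suc n)))"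
      by (simp add: ennreal_leI wnorm_nonneg flip: ennreal_plus)
    also have "\<dots> \<le> ennreal C * total_osc f n x + ennreal C * total_osc f (Suc n) x"
      by (intro add_mono C(2) f near)
    finally show ?thesis
      by (simp only: distrib_left)
  qed
  then show ?thesis
    using C(1) by auto
qed

text \<open>After reexpansion to \<open>y + h\<close>, both averages are close to \<open>\<Gamma> (y + h) x (f x)\<close>.\<close>

lemma average_neighbour_difference_exists:
  "\<exists>C\<ge>1. \<forall>f n x \<zeta> h. locally_integrable_section f \<longrightarrow> \<zeta> \<in> B \<longrightarrow> snorm s h \<le> 1 / 2 ^ n \<longrightarrow>
     ennreal (2 powr (real n * (\<gamma> - \<zeta>)) * norm (averages s \<Gamma> f n (lattice_pt s n x + h) \<zeta>
       - \<Gamma> (lattice_pt s n x + h) (lattice_pt s n x) (averages s \<Gamma> f n (lattice_pt s n x)) \<zeta>))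
     \<le> ennreal C * total_osc f n x"
proof -
  obtain C where C: "1 \<le> C" "\<And>f n y w. locally_integrable_section f \<Longrightarrow> snorm s (y - w) \<le> 2 / 2 ^ n \<Longrightarrow>
     ennreal (wnorm n (\<lambda>\<zeta>. averages s \<Gamma> f n y \<zeta> - \<Gamma> y w (f w) \<zeta>)) \<le> ennreal C * total_osc f n w"
    using average_deviation_exists by metis
  obtain D where D: "1 \<le> D"
    "\<And>n x y \<tau>. snorm s (x - y) \<le> 1 / 2 ^ n \<Longrightarrow> \<tau> \<in> T \<Longrightarrow> wnorm n (\<Gamma> x y \<tau>) \<le> D * wnorm n \<tau>"
    using Gamma_wnorm_exists by metis
  have "ennreal (2 powr (real n * (\<gamma> - \<zeta>)) * norm (averages s \<Gamma> f n (lattice_pt s n x + h) \<zeta>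
       - \<Gamma> (lattice_pt s n x + h) (lattice_pt s n x) (averages s \<Gamma> f n (lattice_pt s n x)) \<zeta>))
     \<le> ennreal (C + D * C) * total_osc f n x"
    if f: "locally_integrable_section f" and \<zeta>: "\<zeta> \<in> B" and h: "snorm s h \<le> 1 / 2 ^ n" for f n x \<zeta> h
  proof -
    let ?y = "lattice_pt s n x"
    let ?d = "\<lambda>y \<zeta>. averages s \<Gamma> f n y \<zeta> - \<Gamma> y x (f x) \<zeta>"
    have fT: "f x \<in> T" for x
      using f by (simp add: locally_integrable_section_def measurable_section_def)
    have yx: "snorm s (?y - x) \<le> 1 / 2 ^ n"
      using snorm_lattice_pt[OF scaling, of x n] by (simp add: snorm_commute[of s ?y])
    have two: "(1::real) / 2 ^ n + 1 / 2 ^ n = 2 / 2 ^ n"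
      by simp
    have near: "snorm s (?y - x) \<le> 2 / 2 ^ n" "snorm s (?y + h - x) \<le> 2 / 2 ^ n"
      using snorm_triangle[OF scaling, of "?y - x" h] yx h two snorm_nonneg[of s "?y - x"] snorm_nonneg[of s h]
      by (simp_all add: algebra_simps)
    have "\<Gamma> (?y + h) ?y (?d ?y) = (\<lambda>\<zeta>. \<Gamma> (?y + h) ?y (averages s \<Gamma> f n ?y) \<zeta> - \<Gamma> (?y + h) x (f x) \<zeta>)"
      by (simp add: Gamma_diff averages_in_T fT Gamma_in_T Gamma_trans)
    then have eq: "averages s \<Gamma> f n (?y + h) \<zeta> - \<Gamma> (?y + h) ?y (averages s \<Gamma> f n ?y) \<zeta>
        = ?d (?y + h) \<zeta> - \<Gamma> (?y + h) ?y (?d ?y) \<zeta>" for \<zeta>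
      by simp
    have "2 powr (real n * (\<gamma> - \<zeta>)) * norm (averages s \<Gamma> f n (?y + h) \<zeta> - \<Gamma> (?y + h) ?y (averages s \<Gamma> f n ?y) \<zeta>)
        \<le> wnorm n (\<lambda>\<zeta>. ?d (?y + h) \<zeta> - \<Gamma> (?y + h) ?y (?d ?y) \<zeta>)"
      unfolding eq by (rule component_le_wnorm[OF \<zeta>])
    also have "\<dots> \<le> wnorm n (?d (?y + h)) + wnorm n (\<Gamma> (?y + h) ?y (?d ?y))"
      by (rule wnorm_triangle)
    also have "\<dots> \<le> wnorm n (?d (?y + h)) + D * wnorm n (?d ?y)"
      using h by (intro add_left_mono D(2) T_diff averages_in_T Gamma_in_T fT) simp
    finally have "ennreal (2 powr (real n * (\<gamma> - \<zeta>)) * norm (averages s \<Gamma> f n (?y + h) \<zeta> - \<Gamma> (?y + h) ?y (averages s \<Gamma> f n ?y) \<zeta>))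
        \<le> ennreal (wnorm n (?d (?y + h)) + D * wnorm n (?d ?y))"
      by (rule ennreal_leI)
    also have "\<dots> = ennreal (wnorm n (?d (?y + h))) + ennreal D * ennreal (wnorm n (?d ?y))"
      using D(1) by (simp add: wnorm_nonneg ennreal_mult)
    also have "\<dots> \<le> ennreal C * total_osc f n x + ennreal D * (ennreal C * total_osc f n x)"
      by (intro add_mono mult_left_mono C(2) f near) simp
    also have "\<dots> = ennreal (C + D * C) * total_osc f n x"
      using C(1) D(1) by (simp add: ennreal_mult distrib_right mult.assoc)
    finally show ?thesis .
  qed
  moreover have "0 \<le> D * C"
    using C(1) D(1) by simp
  then have "1 \<le> C + D * C"
    using C(1) by linarith
  ultimately show ?thesis
    by (intro exI[of _ "C + D * C"]) simp
qed

text \<open>This turns the pointwise bounds on differences of averages into bounds on the norms of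
  sequences.\<close>

lemma Lp_lq_le_osc_norm:
  assumes p: "1 \<le> p" "p < \<infinity>" and q: "1 \<le> q" and "0 \<le> C"
  shows "\<exists>K\<ge>0. \<forall>f S. measurable_section f \<longrightarrow>
    (\<forall>n x. S n x \<le> ennreal C * (total_osc f n x + total_osc f (Suc n) x)) \<longrightarrow>
    Lp_norm p lebesgue (\<lambda>x. Lp_norm q (count_space UNIV) (\<lambda>n. S n x)) \<le> ennreal K * osc_norm p q f"
proof -
  obtain D where D: "1 \<le> D" "\<And>f k. measurable_section f \<Longrightarrow>
    Lp_norm p lebesgue (\<lambda>x. Lp_norm q (count_space UNIV) (\<lambda>n. total_osc f (n + k) x)) \<le> ennreal D * osc_norm p q f"
    using Lp_lq_total_osc_le[OF p(1) q] by blast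
  have "Lp_norm p lebesgue (\<lambda>x. Lp_norm q (count_space UNIV) (\<lambda>n. S n x)) \<le> ennreal (C * 4 * 4 * (D + D)) * osc_norm p q f"
    if f: "measurable_section f" and S: "\<And>n x. S n x \<le> ennreal C * (total_osc f n x + total_osc f (Suc n) x)" for f S
  proof -
    let ?l = "\<lambda>k x. Lp_norm q (count_space UNIV) (\<lambda>n. total_osc f (n + k) x)"
    have osc_meas: "total_osc f n \<in> borel_measurable lebesgue" for n
      unfolding total_osc_def by (intro borel_measurable_sum borel_measurable_osc f)
    have meas: "?l k \<in> borel_measurable lebesgue" for k
      by (intro borel_measurable_lq_norm osc_meas)
    have "Lp_norm q (count_space UNIV) (\<lambda>n. S n x) \<le> ennreal C * 4 * (?l 0 x + ?l 1 x)" for x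
    proof -
      have "Lp_norm q (count_space UNIV) (\<lambda>n. S n x)
          \<le> Lp_norm q (count_space UNIV) (\<lambda>n. ennreal C * (total_osc f (n + 0) x + total_osc f (n + 1) x))"
        using S by (intro Lp_norm_mono q) auto
      also have "\<dots> \<le> ennreal C * Lp_norm q (count_space UNIV) (\<lambda>n. total_osc f (n + 0) x + total_osc f (n + 1) x)"
        by (intro Lp_norm_cmult_le q) simp
      also have "\<dots> \<le> ennreal C * (4 * (?l 0 x + ?l 1 x))"
        by (intro mult_left_mono Lp_norm_add_le q) auto
      finally show ?thesis
        by (simp only: mult.assoc)
    qed
    then have "Lp_norm p lebesgue (\<lambda>x. Lp_norm q (count_space UNIV) (\<lambda>n. S n x))
        \<le> Lp_norm p lebesgue (\<lambda>x. ennreal C * 4 * (?l 0 x + ?l 1 x))"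
      using p by (intro Lp_norm_mono) auto
    also have "\<dots> \<le> ennreal C * 4 * Lp_norm p lebesgue (\<lambda>x. ?l 0 x + ?l 1 x)"
      by (intro Lp_norm_cmult_le p borel_measurable_add meas)
    also have "\<dots> \<le> ennreal C * 4 * (4 * (Lp_norm p lebesgue (?l 0) + Lp_norm p lebesgue (?l 1)))"
      by (intro mult_left_mono Lp_norm_add_le p meas) auto
    also have "\<dots> \<le> ennreal C * 4 * (4 * (ennreal D * osc_norm p q f + ennreal D * osc_norm p q f))"
      by (intro mult_left_mono add_mono D(2) f) auto
    also have "ennreal D * osc_norm p q f + ennreal D * osc_norm p q f = ennreal (D + D) * osc_norm p q f"
      using D(1) by (simp only: distrib_right ennreal_plus)
    also have "ennreal C * 4 * (4 * (ennreal (D + D) * osc_norm p q f)) = ennreal (C * 4 * 4 * (D + D)) * osc_norm p q f"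
      using \<open>0 \<le> C\<close> D(1) by (simp add: ennreal_mult mult.assoc)
    finally show ?thesis .
  qed
  then show ?thesis
    using \<open>0 \<le> C\<close> D(1) by (intro exI[of _ "C * 4 * 4 * (D + D)"]) auto
qed

text \<open>At level \<open>0\<close>, comparison with \<open>f x\<close> for all \<open>x\<close> in the cell of \<open>y\<close> turns the sum over the
  lattice into an integral.\<close>

lemma average_level_0_exists:
  assumes p: "1 \<le> p" "p < \<infinity>" and q: "1 \<le> q"
  shows "\<exists>K\<ge>0. \<forall>f\<in>F_space s A V \<Gamma> \<gamma> p q. \<forall>\<zeta>\<in>B.
    Lp_norm p (count_space (lattice_pts s 0)) (\<lambda>y. ennreal (norm (averages s \<Gamma> f 0 y \<zeta>)))
    \<le> ennreal K * F_norm s A \<Gamma> \<gamma> p q f"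
proof -
  obtain C where C: "1 \<le> C" "\<And>f n y w. locally_integrable_section f \<Longrightarrow> snorm s (y - w) \<le> 2 / 2 ^ n \<Longrightarrow>
     ennreal (wnorm n (\<lambda>\<zeta>. averages s \<Gamma> f n y \<zeta> - \<Gamma> y w (f w) \<zeta>)) \<le> ennreal C * total_osc f n w"
    using average_deviation_exists by metis
  obtain D where D: "1 \<le> D"
    "\<And>n x y \<tau>. snorm s (x - y) \<le> 1 / 2 ^ n \<Longrightarrow> \<tau> \<in> T \<Longrightarrow> wnorm n (\<Gamma> x y \<tau>) \<le> D * wnorm n \<tau>"
    using Gamma_wnorm_exists by metis
  obtain E where E: "1 \<le> E" "\<And>f k. measurable_section f \<Longrightarrow>
    Lp_norm p lebesgue (\<lambda>x. Lp_norm q (count_space UNIV) (\<lambda>n. total_osc f (n + k) x)) \<le> ennreal E * osc_norm p q f"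
    using Lp_lq_total_osc_le[OF p(1) q] by blast
  define N where "N = real (card B)"
  have N: "0 \<le> N" "of_nat (card B) = ennreal N"
    by (simp_all add: N_def ennreal_of_nat_eq_real_of_nat)
  have "Lp_norm p (count_space (lattice_pts s 0)) (\<lambda>y. ennreal (norm (averages s \<Gamma> f 0 y \<zeta>)))
      \<le> ennreal (4 * (C * E + D * (N * N * N))) * F_norm s A \<Gamma> \<gamma> p q f"
    if f: "f \<in> F_space s A V \<Gamma> \<gamma> p q" and \<zeta>: "\<zeta> \<in> B" for f \<zeta>
  proof -
    note li = F_space_imp_locally_integrable[OF p f]
    have ms: "measurable_section f"
      using li by (simp add: locally_integrable_section_def)
    then have fT: "f x \<in> T" for x
      by (simp add: measurable_section_def)
    have norm_meas: "(\<lambda>x. ennreal (norm (f x \<beta>))) \<in> borel_measurable lebesgue" if "\<beta> \<in> B" for \<beta>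
      using ms that strongly_measurable_norm unfolding measurable_section_def
      by (intro measurable_compose[OF _ measurable_ennreal]) auto
    have osc_meas: "total_osc f n \<in> borel_measurable lebesgue" for n
      unfolding total_osc_def by (intro borel_measurable_sum borel_measurable_osc ms)
    let ?n = "\<lambda>x. \<Sum>\<beta>\<in>B. ennreal (norm (f x \<beta>))"
    have "Lp_norm p (count_space (lattice_pts s 0)) (\<lambda>y. ennreal (norm (averages s \<Gamma> f 0 y \<zeta>)))
        \<le> Lp_norm p lebesgue (\<lambda>x. ennreal C * total_osc f 0 x + ennreal D * ?n x)"
    proof (rule Lp_norm_lattice_le[OF p])
      fix y x assume "x \<in> cell s 0 y"
      then have yx: "snorm s (y - x) \<le> 1 / 2 ^ 0"
        unfolding snorm_commute[of s y] by (rule snorm_cell[OF scaling])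
      let ?d = "\<lambda>\<zeta>. averages s \<Gamma> f 0 y \<zeta> - \<Gamma> y x (f x) \<zeta>"
      have "norm (averages s \<Gamma> f 0 y \<zeta>) \<le> norm (?d \<zeta>) + norm (\<Gamma> y x (f x) \<zeta>)"
        using norm_triangle_sub[of "averages s \<Gamma> f 0 y \<zeta>" "\<Gamma> y x (f x) \<zeta>"] by simp
      also have "\<dots> \<le> wnorm 0 ?d + D * wnorm 0 (f x)"
        using component_le_wnorm[OF \<zeta>, of 0 ?d] component_le_wnorm[OF \<zeta>, of 0 "\<Gamma> y x (f x)"]
          D(2)[OF yx fT[of x]] by simp
      finally have "ennreal (norm (averages s \<Gamma> f 0 y \<zeta>)) \<le> ennreal (wnorm 0 ?d + D * wnorm 0 (f x))"
        by (rule ennreal_leI)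
      also have "\<dots> = ennreal (wnorm 0 ?d) + ennreal D * ennreal (wnorm 0 (f x))"
        using D(1) by (simp add: wnorm_nonneg ennreal_mult)
      also have "ennreal (wnorm 0 (f x)) = ?n x"
        unfolding wnorm_def by simp
      also have "ennreal (wnorm 0 ?d) \<le> ennreal C * total_osc f 0 x"
        using yx by (intro C(2) li) simp
      finally show "ennreal (norm (averages s \<Gamma> f 0 y \<zeta>)) \<le> ennreal C * total_osc f 0 x + ennreal D * ?n x"
        by (simp add: add_right_mono)
    qed
    also have "\<dots> \<le> 4 * (Lp_norm p lebesgue (\<lambda>x. ennreal C * total_osc f 0 x) + Lp_norm p lebesgue (\<lambda>x. ennreal D * ?n x))"
      by (intro Lp_norm_add_le p borel_measurable_times_ennreal borel_measurable_const borel_measurable_sum osc_meas norm_meas)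
    also have "\<dots> \<le> 4 * (ennreal C * Lp_norm p lebesgue (total_osc f 0) + ennreal D * Lp_norm p lebesgue ?n)"
      by (intro mult_left_mono add_mono Lp_norm_cmult_le p borel_measurable_sum osc_meas norm_meas) auto
    also have "\<dots> \<le> 4 * (ennreal C * (ennreal E * osc_norm p q f) + ennreal D * (ennreal N * ennreal N * (ennreal N * F_norm s A \<Gamma> \<gamma> p q f)))"
    proof (intro mult_left_mono add_mono)
      have "Lp_norm p lebesgue (total_osc f 0)
          \<le> Lp_norm p lebesgue (\<lambda>x. Lp_norm q (count_space UNIV) (\<lambda>n. total_osc f (n + 0) x))"
        using term_le_lq_norm[OF q, of "\<lambda>n. total_osc f n _" 0] by (intro Lp_norm_mono p osc_meas) auto
      also have "\<dots> \<le> ennreal E * osc_norm p q f"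
        by (rule E(2)[OF ms])
      finally show "Lp_norm p lebesgue (total_osc f 0) \<le> ennreal E * osc_norm p q f" .
      have "Lp_norm p lebesgue ?n \<le> ennreal N * ennreal N * (\<Sum>\<beta>\<in>B. Lp_norm p lebesgue (\<lambda>x. ennreal (norm (f x \<beta>))))"
        unfolding N(2)[symmetric] by (intro Lp_norm_sum_le p finite_B norm_meas)
      also have "\<dots> \<le> ennreal N * ennreal N * (ennreal N * F_norm s A \<Gamma> \<gamma> p q f)"
        unfolding N(2)[symmetric] F_norm_def
        by (intro mult_left_mono sum_bounded_above add_increasing2 SUP_upper) auto
      finally show "Lp_norm p lebesgue ?n \<le> ennreal N * ennreal N * (ennreal N * F_norm s A \<Gamma> \<gamma> p q f)" .
    qed auto
    also have "\<dots> \<le> 4 * (ennreal C * (ennreal E * F_norm s A \<Gamma> \<gamma> p q f) + ennreal D * (ennreal N * ennreal N * (ennreal N * F_norm s A \<Gamma> \<gamma> p q f)))"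
      unfolding F_norm_eq osc_norm_def by (intro mult_left_mono add_right_mono) auto
    also have "\<dots> = ennreal (4 * (C * E + D * (N * N * N))) * F_norm s A \<Gamma> \<gamma> p q f"
      using C(1) D(1) E(1) N(1) by (simp add: ennreal_mult distrib_left distrib_right mult.assoc)
    finally show ?thesis .
  qed
  then show ?thesis
    using C(1) D(1) E(1) N(1) by (intro exI[of _ "4 * (C * E + D * (N * N * N))"]) auto
qed

theorem Fbar_norm_averages_le:
  assumes p: "1 \<le> p" "p < \<infinity>" and q: "1 \<le> q"
  shows "\<exists>K\<ge>0. \<forall>f\<in>F_space s A V \<Gamma> \<gamma> p q.
    Fbar_norm s A \<Gamma> \<gamma> p q (averages s \<Gamma> f) \<le> ennreal K * F_norm s A \<Gamma> \<gamma> p q f"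
proof -
  obtain K0 where K0: "0 \<le> K0" "\<And>f \<zeta>. f \<in> F_space s A V \<Gamma> \<gamma> p q \<Longrightarrow> \<zeta> \<in> B \<Longrightarrow>
      Lp_norm p (count_space (lattice_pts s 0)) (\<lambda>y. ennreal (norm (averages s \<Gamma> f 0 y \<zeta>)))
      \<le> ennreal K0 * F_norm s A \<Gamma> \<gamma> p q f"
    using average_level_0_exists[OF p q] by blast
  obtain C1 where C1: "1 \<le> C1" "\<And>f n x \<zeta> h. locally_integrable_section f \<Longrightarrow> \<zeta> \<in> B \<Longrightarrow> snorm s h \<le> 1 / 2 ^ n \<Longrightarrow>
     ennreal (2 powr (real n * (\<gamma> - \<zeta>)) * norm (averages s \<Gamma> f n (lattice_pt s n x + h) \<zeta>
       - \<Gamma> (lattice_pt s n x + h) (lattice_pt s n x) (averages s \<Gamma> f n (lattice_pt s n x)) \<zeta>))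
     \<le> ennreal C1 * total_osc f n x"
    using average_neighbour_difference_exists by metis
  obtain C2 where C2: "1 \<le> C2" "\<And>f n x \<zeta>. locally_integrable_section f \<Longrightarrow> \<zeta> \<in> B \<Longrightarrow>
     ennreal (2 powr (real n * (\<gamma> - \<zeta>)) * norm (averages s \<Gamma> f n (lattice_pt s n x) \<zeta>
       - averages s \<Gamma> f (Suc n) (lattice_pt s n x) \<zeta>))
     \<le> ennreal C2 * (total_osc f n x + total_osc f (Suc n) x)"
    using average_level_difference_exists by metis
  define M where "M = (3 :: real) ^ CARD('d)"
  have "0 \<le> M * C1" "0 \<le> C2"
    using C1(1) C2(1) by (auto simp: M_def)
  obtain K1 where K1: "0 \<le> K1" "\<And>f S. measurable_section f \<Longrightarrow>
    (\<forall>n x. S n x \<le> ennreal (M * C1) * (total_osc f n x + total_osc f (Suc n) x)) \<Longrightarrow>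
    Lp_norm p lebesgue (\<lambda>x. Lp_norm q (count_space UNIV) (\<lambda>n. S n x)) \<le> ennreal K1 * osc_norm p q f"
    using Lp_lq_le_osc_norm[OF p q \<open>0 \<le> M * C1\<close>] by blast
  obtain K2 where K2: "0 \<le> K2" "\<And>f S. measurable_section f \<Longrightarrow>
    (\<forall>n x. S n x \<le> ennreal C2 * (total_osc f n x + total_osc f (Suc n) x)) \<Longrightarrow>
    Lp_norm p lebesgue (\<lambda>x. Lp_norm q (count_space UNIV) (\<lambda>n. S n x)) \<le> ennreal K2 * osc_norm p q f"
    using Lp_lq_le_osc_norm[OF p q \<open>0 \<le> C2\<close>] by blast
  have "Fbar_norm s A \<Gamma> \<gamma> p q (averages s \<Gamma> f) \<le> ennreal (K0 + K1 + K2) * F_norm s A \<Gamma> \<gamma> p q f"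
    if f: "f \<in> F_space s A V \<Gamma> \<gamma> p q" for f
  proof -
    note li = F_space_imp_locally_integrable[OF p f]
    have ms: "measurable_section f"
      using li by (simp add: locally_integrable_section_def)
    have "osc_norm p q f \<le> F_norm s A \<Gamma> \<gamma> p q f"
      unfolding F_norm_eq osc_norm_def by simp
    then have osc: "ennreal K * osc_norm p q f \<le> ennreal K * F_norm s A \<Gamma> \<gamma> p q f" for K
      by (intro mult_left_mono) auto
    have neighbour: "(\<Sum>\<^sub>\<infinity>y\<in>lattice_pts s n. \<Sum>h\<in>nbrs s n.
          ennreal (2 powr (real n * (\<gamma> - \<zeta>)) * norm (averages s \<Gamma> f n (y + h) \<zeta> - \<Gamma> (y + h) y (averages s \<Gamma> f n y) \<zeta>))
          * indicator (cell s n y) x) \<le> ennreal (M * C1) * (total_osc f n x + total_osc f (Suc n) x)"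
      if "\<zeta> \<in> B" for \<zeta> n x
    proof -
      have "(\<Sum>h\<in>nbrs s n. ennreal (2 powr (real n * (\<gamma> - \<zeta>)) *
            norm (averages s \<Gamma> f n (lattice_pt s n x + h) \<zeta>
              - \<Gamma> (lattice_pt s n x + h) (lattice_pt s n x) (averages s \<Gamma> f n (lattice_pt s n x)) \<zeta>)))
          \<le> of_nat (card (nbrs s n)) * (ennreal C1 * total_osc f n x)"
        by (intro sum_bounded_above C1(2) li that) (auto simp: nbrs_def mem_Qbox)
      also have "\<dots> \<le> ennreal M * (ennreal C1 * (total_osc f n x + total_osc f (Suc n) x))"
      proof (intro mult_mono)
        have "real (card (nbrs s n)) \<le> M"
          unfolding M_def using card_nbrs[OF scaling, of n] by (metis of_nat_le_iff of_nat_numeral of_nat_power)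
        then show "of_nat (card (nbrs s n)) \<le> ennreal M"
          by (simp add: ennreal_of_nat_eq_real_of_nat ennreal_leI)
      qed auto
      also have "\<dots> = ennreal (M * C1) * (total_osc f n x + total_osc f (Suc n) x)"
        using C1(1) by (simp add: M_def ennreal_mult mult.assoc)
      finally show ?thesis
        by (simp only: sum_distrib_right[symmetric] infsum_cell)
    qed
    have level: "(\<Sum>\<^sub>\<infinity>y\<in>lattice_pts s n.
          ennreal (2 powr (real n * (\<gamma> - \<zeta>)) * norm (averages s \<Gamma> f n y \<zeta> - averages s \<Gamma> f (Suc n) y \<zeta>))
          * indicator (cell s n y) x) \<le> ennreal C2 * (total_osc f n x + total_osc f (Suc n) x)"
      if "\<zeta> \<in> B" for \<zeta> n x
      using C2(2)[OF li that] by (simp only: infsum_cell)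
    have "Fbar_norm s A \<Gamma> \<gamma> p q (averages s \<Gamma> f)
        \<le> ennreal K0 * F_norm s A \<Gamma> \<gamma> p q f + ennreal K1 * F_norm s A \<Gamma> \<gamma> p q f + ennreal K2 * F_norm s A \<Gamma> \<gamma> p q f"
      unfolding Fbar_norm_def
      by (intro add_mono SUP_least K0(2)[OF f] order_trans[OF K1(2)[OF ms] osc] order_trans[OF K2(2)[OF ms] osc]
          allI neighbour level)
    also have "\<dots> = ennreal (K0 + K1 + K2) * F_norm s A \<Gamma> \<gamma> p q f"
      using K0(1) K1(1) K2(1) by (simp add: distrib_right)
    finally show ?thesis .
  qed
  then show ?thesis
    using K0(1) K1(1) K2(1) by (intro exI[of _ "K0 + K1 + K2"]) auto
qed

section \<open>Convergence of the reconstructed functions\<close>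

text \<open>Reexpanding \<open>\<Gamma> y x (f x)\<close> from \<open>y\<close> back to \<open>x\<close> gives \<open>f x\<close>, so the left-hand side is a component of
  the reexpansion of the deviation of an average. Its weight provides the power of \<open>2\<close>.\<close>

lemma reconstruction_deviation_exists:
  "\<exists>C\<ge>1. \<forall>f n x \<zeta>. locally_integrable_section f \<longrightarrow> \<zeta> \<in> B \<longrightarrow>
     ennreal (norm (reconstructed s \<Gamma> (averages s \<Gamma> f) n x \<zeta> - f x \<zeta>))
     \<le> ennreal (C * (2 powr - (\<gamma> - \<zeta>)) ^ n) * total_osc f n x"
proof -
  obtain C where C: "1 \<le> C" "\<And>f n y w. locally_integrable_section f \<Longrightarrow> snorm s (y - w) \<le> 2 / 2 ^ n \<Longrightarrow>
     ennreal (wnorm n (\<lambda>\<zeta>. averages s \<Gamma> f n y \<zeta> - \<Gamma> y w (f w) \<zeta>)) \<le> ennreal C * total_osc f n w"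
    using average_deviation_exists by metis
  obtain D where D: "1 \<le> D"
    "\<And>n x y \<tau>. snorm s (x - y) \<le> 1 / 2 ^ n \<Longrightarrow> \<tau> \<in> T \<Longrightarrow> wnorm n (\<Gamma> x y \<tau>) \<le> D * wnorm n \<tau>"
    using Gamma_wnorm_exists by metis
  have "ennreal (norm (reconstructed s \<Gamma> (averages s \<Gamma> f) n x \<zeta> - f x \<zeta>))
     \<le> ennreal (D * C * (2 powr - (\<gamma> - \<zeta>)) ^ n) * total_osc f n x"
    if f: "locally_integrable_section f" and \<zeta>: "\<zeta> \<in> B" for f n x \<zeta>
  proof -
    let ?y = "lattice_pt s n x"
    let ?d = "\<lambda>\<zeta>. averages s \<Gamma> f n ?y \<zeta> - \<Gamma> ?y x (f x) \<zeta>"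
    let ?c = "2 powr (real n * (\<gamma> - \<zeta>))"
    have fT: "f x \<in> T" for x
      using f by (simp add: locally_integrable_section_def measurable_section_def)
    have xy: "snorm s (x - ?y) \<le> 1 / 2 ^ n"
      by (rule snorm_lattice_pt[OF scaling])
    moreover have "(1 :: real) / 2 ^ n \<le> 2 / 2 ^ n"
      by (intro divide_right_mono) auto
    ultimately have yx: "snorm s (?y - x) \<le> 2 / 2 ^ n"
      unfolding snorm_commute[of s ?y x] by linarith
    have "(2 powr - (\<gamma> - \<zeta>)) ^ n = 2 powr (- (real n * (\<gamma> - \<zeta>)))"
      by (simp add: powr_powr algebra_simps flip: powr_realpow)
    then have c: "(2 powr - (\<gamma> - \<zeta>)) ^ n = 1 / ?c"
      by (simp only: powr_minus_divide)
    have "\<Gamma> x ?y ?d = (\<lambda>\<zeta>. reconstructed s \<Gamma> (averages s \<Gamma> f) n x \<zeta> - f x \<zeta>)"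
      by (simp add: reconstructed_def Gamma_diff averages_in_T fT Gamma_in_T Gamma_trans Gamma_refl)
    then have "?c * norm (reconstructed s \<Gamma> (averages s \<Gamma> f) n x \<zeta> - f x \<zeta>) \<le> wnorm n (\<Gamma> x ?y ?d)"
      using component_le_wnorm[OF \<zeta>, of n "\<Gamma> x ?y ?d"] by simp
    also have "\<dots> \<le> D * wnorm n ?d"
      by (intro D(2) xy T_diff averages_in_T Gamma_in_T fT)
    finally have "norm (reconstructed s \<Gamma> (averages s \<Gamma> f) n x \<zeta> - f x \<zeta>) \<le> D * (2 powr - (\<gamma> - \<zeta>)) ^ n * wnorm n ?d"
      unfolding c by (simp add: field_simps)
    then have "ennreal (norm (reconstructed s \<Gamma> (averages s \<Gamma> f) n x \<zeta> - f x \<zeta>))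
        \<le> ennreal (D * (2 powr - (\<gamma> - \<zeta>)) ^ n * wnorm n ?d)"
      by (rule ennreal_leI)
    also have "\<dots> = ennreal (D * (2 powr - (\<gamma> - \<zeta>)) ^ n) * ennreal (wnorm n ?d)"
      using D(1) by (intro ennreal_mult wnorm_nonneg) auto
    also have "\<dots> \<le> ennreal (D * (2 powr - (\<gamma> - \<zeta>)) ^ n) * (ennreal C * total_osc f n x)"
      by (intro mult_left_mono C(2) f yx) auto
    also have "\<dots> = ennreal (D * C * (2 powr - (\<gamma> - \<zeta>)) ^ n) * total_osc f n x"
      using C(1) D(1) by (simp add: ennreal_mult ac_simps)
    finally show ?thesis .
  qed
  moreover have "1 \<le> D * C"
    using mult_mono[of 1 D 1 C] C(1) D(1) by simp
  ultimately show ?thesis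
    by (intro exI[of _ "D * C"]) auto
qed

text \<open>The oscillation at each level is bounded in \<open>L\<^sup>p\<close> by the \<open>l\<^sup>q\<close>-norm over all levels.\<close>

theorem reconstructed_averages_tendsto:
  assumes p: "1 \<le> p" "p < \<infinity>" and q: "1 \<le> q"
    and f: "f \<in> F_space s A V \<Gamma> \<gamma> p q" and \<zeta>: "\<zeta> \<in> B"
  shows "tendsto_Lp p lebesgue (\<lambda>n x. reconstructed s \<Gamma> (averages s \<Gamma> f) n x \<zeta>) (\<lambda>x. f x \<zeta>)"
proof -
  note li = F_space_imp_locally_integrable[OF p f]
  have ms: "measurable_section f"
    using li by (simp add: locally_integrable_section_def)
  then have fT: "\<And>x. f x \<in> T" and sm: "strongly_measurable lebesgue (\<lambda>x. f x \<zeta>)"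
    using \<zeta> by (auto simp: measurable_section_def)
  have fin: "F_norm s A \<Gamma> \<gamma> p q f < \<infinity>"
    using f by (simp add: F_space_def)
  let ?g = "\<lambda>n x. reconstructed s \<Gamma> (averages s \<Gamma> f) n x \<zeta>"
  have g_sm: "strongly_measurable lebesgue (?g n)" for n
    by (intro strongly_measurable_reconstructed averages_in_T fT \<zeta>)
  have "Lp_norm p lebesgue (\<lambda>x. ennreal (norm (f x \<zeta>))) \<le> F_norm s A \<Gamma> \<gamma> p q f"
    unfolding F_norm_def using \<zeta> by (intro add_increasing2 SUP_upper) auto
  then have f_fin: "Lp_norm p lebesgue (\<lambda>x. ennreal (norm (f x \<zeta>))) < \<infinity>"
    using fin by (rule le_less_trans)
  obtain C where C: "1 \<le> C" "\<And>n x. ennreal (norm (?g n x - f x \<zeta>))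
     \<le> ennreal (C * (2 powr - (\<gamma> - \<zeta>)) ^ n) * total_osc f n x"
    using reconstruction_deviation_exists li \<zeta> by metis
  obtain E where E: "1 \<le> E" "\<And>k. Lp_norm p lebesgue (\<lambda>x. Lp_norm q (count_space UNIV) (\<lambda>n. total_osc f (n + k) x))
      \<le> ennreal E * osc_norm p q f"
    using Lp_lq_total_osc_le[OF p(1) q] ms by blast
  define M where "M = enn2real (osc_norm p q f)"
  have "osc_norm p q f \<le> F_norm s A \<Gamma> \<gamma> p q f"
    unfolding F_norm_eq osc_norm_def by simp
  then have M: "osc_norm p q f = ennreal M"
    unfolding M_def using fin by (simp add: less_top[symmetric] top_unique) (metis ennreal_enn2real le_less_trans less_top)
  have osc_meas: "total_osc f n \<in> borel_measurable lebesgue" for n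
    unfolding total_osc_def by (intro borel_measurable_sum borel_measurable_osc ms)
  have dist: "Lp_norm p lebesgue (\<lambda>x. ennreal (norm (?g n x - f x \<zeta>))) \<le> ennreal (C * E * M * (2 powr - (\<gamma> - \<zeta>)) ^ n)" for n
  proof -
    have "Lp_norm p lebesgue (\<lambda>x. ennreal (norm (?g n x - f x \<zeta>)))
        \<le> Lp_norm p lebesgue (\<lambda>x. ennreal (C * (2 powr - (\<gamma> - \<zeta>)) ^ n) * total_osc f n x)"
      using p by (intro Lp_norm_mono C(2)) auto
    also have "\<dots> \<le> ennreal (C * (2 powr - (\<gamma> - \<zeta>)) ^ n) * Lp_norm p lebesgue (total_osc f n)"
      by (intro Lp_norm_cmult_le p osc_meas)
    also have "\<dots> \<le> ennreal (C * (2 powr - (\<gamma> - \<zeta>)) ^ n) * (ennreal E * ennreal M)"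
    proof (intro mult_left_mono)
      have "Lp_norm p lebesgue (total_osc f n)
          \<le> Lp_norm p lebesgue (\<lambda>x. Lp_norm q (count_space UNIV) (\<lambda>m. total_osc f (m + n) x))"
        using term_le_lq_norm[OF q, of "\<lambda>m. total_osc f (m + n) _" 0] by (intro Lp_norm_mono p osc_meas) auto
      also have "\<dots> \<le> ennreal E * ennreal M"
        unfolding M[symmetric] by (rule E(2))
      finally show "Lp_norm p lebesgue (total_osc f n) \<le> ennreal E * ennreal M" .
    qed simp
    also have "\<dots> = ennreal (C * E * M * (2 powr - (\<gamma> - \<zeta>)) ^ n)"
      using C(1) E(1) by (simp add: M_def ac_simps flip: ennreal_mult)
    finally show ?thesis .
  qed
  have "in_Lp p lebesgue (?g n)" for n
  proof -
    have d_meas: "(\<lambda>x. ennreal (norm (?g n x - f x \<zeta>))) \<in> borel_measurable lebesgue"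
      by (intro measurable_compose[OF _ measurable_ennreal] strongly_measurable_norm_diff g_sm sm)
    have f_meas: "(\<lambda>x. ennreal (norm (f x \<zeta>))) \<in> borel_measurable lebesgue"
      by (intro measurable_compose[OF _ measurable_ennreal] strongly_measurable_norm sm)
    have "Lp_norm p lebesgue (\<lambda>x. ennreal (norm (?g n x)))
        \<le> Lp_norm p lebesgue (\<lambda>x. ennreal (norm (?g n x - f x \<zeta>)) + ennreal (norm (f x \<zeta>)))"
    proof (rule Lp_norm_mono[OF p(1)])
      fix x
      have "norm (?g n x) \<le> norm (?g n x - f x \<zeta>) + norm (f x \<zeta>)"
        using norm_triangle_sub[of "?g n x" "f x \<zeta>"] by simp
      then show "ennreal (norm (?g n x)) \<le> ennreal (norm (?g n x - f x \<zeta>)) + ennreal (norm (f x \<zeta>))"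
        by (simp add: ennreal_leI flip: ennreal_plus)
    qed (use p in auto)
    also have "\<dots> \<le> 4 * (Lp_norm p lebesgue (\<lambda>x. ennreal (norm (?g n x - f x \<zeta>))) + Lp_norm p lebesgue (\<lambda>x. ennreal (norm (f x \<zeta>))))"
      by (intro Lp_norm_add_le p d_meas f_meas)
    also have "\<dots> < \<infinity>"
      using f_fin le_less_trans[OF dist[of n], of \<infinity>] by (simp add: ennreal_mult_less_top)
    finally show ?thesis
      using g_sm by (simp add: in_Lp_def)
  qed
  moreover have "in_Lp p lebesgue (\<lambda>x. f x \<zeta>)"
    using sm f_fin by (simp add: in_Lp_def)
  moreover have "(\<lambda>n. Lp_norm p lebesgue (\<lambda>x. ennreal (norm (?g n x - f x \<zeta>)))) \<longlonglongrightarrow> 0"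
  proof (rule tendsto_sandwich[of "\<lambda>_. 0"])
    have "2 powr - (\<gamma> - \<zeta>) < 2 powr (0 :: real)"
      using B_lt[OF \<zeta>] by (intro powr_less_mono) auto
    then have "(\<lambda>n. C * E * M * (2 powr - (\<gamma> - \<zeta>)) ^ n) \<longlonglongrightarrow> C * E * M * 0"
      by (intro tendsto_mult_left LIMSEQ_power_zero) simp
    then show "(\<lambda>n. ennreal (C * E * M * (2 powr - (\<gamma> - \<zeta>)) ^ n)) \<longlonglongrightarrow> 0"
      using tendsto_ennrealI by fastforce
  qed (use dist in auto)
  ultimately show ?thesis
    by (simp add: tendsto_Lp_def)
qed

end

section \<open>Averages and reconstruction of modelled distributions\<close>

theorem proposition3p8:
  fixes s :: "'d::finite \<Rightarrow> nat"
    and A :: "real set"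
    and V :: "real \<Rightarrow> 'b::banach set"
    and G :: "((real \<Rightarrow> 'b) \<Rightarrow> (real \<Rightarrow> 'b)) set"
    and P :: "real ^ 'd \<Rightarrow> (real \<Rightarrow> 'b) \<Rightarrow> (real ^ 'd \<Rightarrow> real) \<Rightarrow> real"
    and \<Gamma> :: "real ^ 'd \<Rightarrow> real ^ 'd \<Rightarrow> (real \<Rightarrow> 'b) \<Rightarrow> (real \<Rightarrow> 'b)"
    and \<gamma> :: real and p q :: ennreal
  assumes "scaling s"
    and "regularity_structure A V G"
    and "model s A V G P \<Gamma>"
    and "1 \<le> p" "p < \<infinity>" "1 \<le> q"
    and "\<gamma> > 0" "\<gamma> \<notin> A"
  shows "(\<exists>C::real. \<forall>f \<in> F_space s A V \<Gamma> \<gamma> p q.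
            averages s \<Gamma> f \<in> Fbar_space s A V \<Gamma> \<gamma> p q \<and>
            Fbar_norm s A \<Gamma> \<gamma> p q (averages s \<Gamma> f) \<le> ennreal C * F_norm s A \<Gamma> \<gamma> p q f)
       \<and> (\<forall>f \<in> F_space s A V \<Gamma> \<gamma> p q. \<forall>\<zeta> \<in> below A \<gamma>.
            tendsto_Lp p lebesgue
              (\<lambda>n x. reconstructed s \<Gamma> (averages s \<Gamma> f) n x \<zeta>) (\<lambda>x. f x \<zeta>))"
proof -
  interpret model_on_sector s A V G P \<Gamma> \<gamma>
    using assms by unfold_locales
  obtain K where K: "0 \<le> K" "\<And>f. f \<in> F_space s A V \<Gamma> \<gamma> p q \<Longrightarrow>
      Fbar_norm s A \<Gamma> \<gamma> p q (averages s \<Gamma> f) \<le> ennreal K * F_norm s A \<Gamma> \<gamma> p q f"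
    using Fbar_norm_averages_le[OF assms(4-6)] by blast
  have "averages s \<Gamma> f \<in> Fbar_space s A V \<Gamma> \<gamma> p q" if f: "f \<in> F_space s A V \<Gamma> \<gamma> p q" for f
  proof -
    have "ennreal K * F_norm s A \<Gamma> \<gamma> p q f < \<infinity>" "\<And>x. f x \<in> T"
      using f by (auto simp: F_space_def ennreal_mult_less_top)
    then show ?thesis
      using K(2)[OF f] averages_in_T by (auto simp: Fbar_space_def intro: le_less_trans)
  qed
  with K(2) reconstructed_averages_tendsto[OF assms(4-6)] show ?thesis
    by (intro conjI exI[of _ K] ballI) auto
qed

end
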